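(* Let $\mathcal H$ be a real Hilbert space, $\Xi$ a Polish space, $(\mathsf m_x)_{x\in\mathcal H}$ a family of probability measures on $\Xi$, and $\beta,\tau,L>0$. Let $A:\mathcal H\rightrightarrows\mathcal H$ be maximal monotone with $\operatorname{int}(\operatorname{dom}A)\neq\emptyset$. Let $B:\mathcal H\times\Xi\to\mathcal H$ be single-valued, with $\xi\mapsto B(x,\xi)$ $\mathsf m_x$-measurable and $\beta$-Lipschitz for every $x\in\mathcal H$. Assume that $\mathbb W_1(\mathsf m_x,\mathsf m_y)\le\tau\|x-y\|$ for all $x,y\in\mathcal H$, and that $B_{\mathsf m_x}$ is $L$-Lipschitz on $\mathcal H$ for every $x\in\mathcal H$. Assume moreover that either (a) there is $\mu>0$ such that $F_{\mathsf m_x}$ is $\mu$-strongly monotone for every $x\in\mathcal H$; or (b) there is a function $\phi$ with $\phi(t)>\beta\tau t$ for all $t>0$ such that $F_{\mathsf m_x}$ is uniformly monotone with modulus $\phi$ for every $x\in\mathcal H$. Let $\bar x$ be an equilibrium point and $0<t_0<T$. Then, given $x_0\in\overline{\operatorname{dom}(F_{\mathsf m_{\bar x}})}$, the system $$\dot x(t)+F_{\mathsf m_{\bar x}}(x(t))+\mathbf e_{\bar x}(x(t))\ni 0\ \text{ a.e. } t>t_0,\qquad x(t_0)=x_0,$$ and hence the system $$\dot x(t)+F_{\mathsf m_{x(t)}}(x(t))\ni 0\ \text{ a.e. } t>t_0,\qquad x(t_0)=x_0,$$ admits a unique strong solution $x$ on $[t_0,T]$.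
   Context: For a probability measure $\mathsf m$ on $\Xi$: $B_{\mathsf m}(x):=\mathbb E_{\xi\sim\mathsf m}(B(x,\xi))$ and $F_{\mathsf m}(x):=A(x)+B_{\mathsf m}(x)$. The distance is $\mathbb W_1(\mathsf m,\nu)=\sup_h|\mathbb E_{\xi\sim\mathsf m}h(\xi)-\mathbb E_{\zeta\sim\nu}h(\zeta)|$ over 1-Lipschitz $h:\Xi\to\mathbb R$. All expectations of Lipschitz functions are understood to be well defined (measures have finite first moment). An equilibrium point is $\bar x\in\mathcal H$ with $0\in F_{\mathsf m_{\bar x}}(\bar x)$. The gap is $\mathbf e_{\bar x}(x):=B_{\mathsf m_x}(x)-B_{\mathsf m_{\bar x}}(x)$. An operator $T$ is uniformly monotone with modulus $\phi:[0,\infty)\to[0,\infty)$ if $\phi$ is increasing, $\phi(0)=0$, $\phi(t)\to\infty$ as $t\to\infty$, and $\langle x-y,u-v\rangle\ge\|x-y\|\phi(\|x-y\|)$ for all $(x,u),(y,v)$ in its graph. It is $\mu$-strongly monotone if $\langle x-y,u-v\rangle\ge\mu\|x-y\|^2$ for all such pairs. A strong solution on $[t_0,T]$ is a function $x:[t_0,T]\to\mathcal H$ that is continuous on $[t_0,T]$ and absolutely continuous on every compact subset of $]t_0,T[$, with $x(t)\in\operatorname{dom}(A)$ for a.e. $t\in]t_0,T]$, satisfying the inclusion for a.e. $t\in]t_0,T[$ and the initial condition. *)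

theory Defs
  imports "HOL-Probability.Probability"
begin
text \<open>
  The library's Bochner integral requires a second-countable range type, whereas the Hilbert
  space here need not be separable.  The following repeats the library definition without that
  sort constraint; the two agree whenever both make sense (lemma below).
\<close>

inductive has_expectation :: "'b measure \<Rightarrow> ('b \<Rightarrow> 'a) \<Rightarrow> 'a::real_normed_vector \<Rightarrow> bool"
  for M f v where
  "f \<in> borel_measurable M \<Longrightarrow>
    (\<And>i. Bochner_Integration.simple_bochner_integrable M (s i)) \<Longrightarrow>
    (\<lambda>i. \<integral>\<^sup>+\<xi>. norm (f \<xi> - s i \<xi>) \<partial>M) \<longlonglongrightarrow> 0 \<Longrightarrow>
    (\<lambda>i. Bochner_Integration.simple_bochner_integral M (s i)) \<longlonglongrightarrow> v \<Longrightarrow>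
    has_expectation M f v"

definition expect :: "'b measure \<Rightarrow> ('b \<Rightarrow> 'a) \<Rightarrow> 'a::real_normed_vector" where
  "expect M f = (if \<exists>v. has_expectation M f v then THE v. has_expectation M f v else 0)"

lemma has_expectation_iff_has_bochner_integral:
  fixes f :: "'b \<Rightarrow> 'a::{real_normed_vector, second_countable_topology}"
  shows "has_expectation M f v \<longleftrightarrow> has_bochner_integral M f v"
  by (simp add: has_expectation.simps has_bochner_integral.simps)

lemma expect_eq_lebesgue_integral:
  fixes f :: "'b \<Rightarrow> 'a::{banach, second_countable_topology}"
  shows "expect M f = integral\<^sup>L M f"
  unfolding expect_def lebesgue_integral_def has_expectation_iff_has_bochner_integral ..

definition prob_measure_finite_first_moment :: "'b::metric_space measure \<Rightarrow> bool" where
  "prob_measure_finite_first_moment M \<longleftrightarrow>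
     prob_space M \<and> sets M = sets borel \<and> (\<forall>\<zeta>. integrable M (\<lambda>\<xi>. dist \<xi> \<zeta>))"

text \<open>Taken in the extended reals, so that the supremum is never a junk value.\<close>

definition W1 :: "'b::metric_space measure \<Rightarrow> 'b measure \<Rightarrow> ereal" where
  "W1 M N = (SUP h\<in>{h :: 'b \<Rightarrow> real. 1-lipschitz_on UNIV h}.
               ereal \<bar>integral\<^sup>L M h - integral\<^sup>L N h\<bar>)"

definition op_dom :: "('a \<Rightarrow> 'a set) \<Rightarrow> 'a set" where
  "op_dom A = {x. A x \<noteq> {}}"

definition monotone_op :: "('a::real_inner \<Rightarrow> 'a set) \<Rightarrow> bool" where
  "monotone_op A \<longleftrightarrow> (\<forall>x y. \<forall>u\<in>A x. \<forall>v\<in>A y. inner (x - y) (u - v) \<ge> 0)"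

definition maximal_monotone_op :: "('a::real_inner \<Rightarrow> 'a set) \<Rightarrow> bool" where
  "maximal_monotone_op A \<longleftrightarrow>
     monotone_op A \<and> (\<forall>A'. monotone_op A' \<and> (\<forall>x. A x \<subseteq> A' x) \<longrightarrow> A' = A)"

definition strongly_monotone_op :: "real \<Rightarrow> ('a::real_inner \<Rightarrow> 'a set) \<Rightarrow> bool" where
  "strongly_monotone_op \<mu> A \<longleftrightarrow>
     (\<forall>x y. \<forall>u\<in>A x. \<forall>v\<in>A y. inner (x - y) (u - v) \<ge> \<mu> * (norm (x - y))\<^sup>2)"

text \<open>
  A modulus is a function from the nonnegative reals to the nonnegative reals; its values at
  negative arguments are irrelevant.  ``Increasing'' is read as nondecreasing.
\<close>

definition uniformly_monotone_op :: "(real \<Rightarrow> real) \<Rightarrow> ('a::real_inner \<Rightarrow> 'a set) \<Rightarrow> bool" where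
  "uniformly_monotone_op \<phi> A \<longleftrightarrow>
     (\<forall>t\<ge>0. \<phi> t \<ge> 0) \<and> mono_on {0..} \<phi> \<and> \<phi> 0 = 0 \<and> filterlim \<phi> at_top at_top \<and>
     (\<forall>x y. \<forall>u\<in>A x. \<forall>v\<in>A y. inner (x - y) (u - v) \<ge> norm (x - y) * \<phi> (norm (x - y)))"

definition Bexp :: "('a \<Rightarrow> 'b \<Rightarrow> 'a::real_normed_vector) \<Rightarrow> 'b measure \<Rightarrow> 'a \<Rightarrow> 'a" where
  "Bexp B M x = expect M (\<lambda>\<xi>. B x \<xi>)"

definition Fop :: "('a \<Rightarrow> 'a set) \<Rightarrow> ('a \<Rightarrow> 'b \<Rightarrow> 'a::real_normed_vector) \<Rightarrow> 'b measure \<Rightarrow> 'a \<Rightarrow> 'a set"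
  where "Fop A B M x = (\<lambda>u. u + Bexp B M x) ` A x"

definition equilibrium ::
  "('a \<Rightarrow> 'a set) \<Rightarrow> ('a \<Rightarrow> 'b \<Rightarrow> 'a::real_normed_vector) \<Rightarrow> ('a \<Rightarrow> 'b measure) \<Rightarrow> 'a \<Rightarrow> bool" where
  "equilibrium A B m xbar \<longleftrightarrow> 0 \<in> Fop A B (m xbar) xbar"

definition gap ::
  "('a \<Rightarrow> 'b \<Rightarrow> 'a::real_normed_vector) \<Rightarrow> ('a \<Rightarrow> 'b measure) \<Rightarrow> 'a \<Rightarrow> 'a \<Rightarrow> 'a" where
  "gap B m xbar x = Bexp B (m x) x - Bexp B (m xbar) x"

definition abs_continuous_on :: "real set \<Rightarrow> (real \<Rightarrow> 'a::metric_space) \<Rightarrow> bool" where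
  "abs_continuous_on S f \<longleftrightarrow>
     (\<forall>\<epsilon>>0. \<exists>\<delta>>0. \<forall>(n::nat) a b.
        (\<forall>i<n. a i \<in> S \<and> b i \<in> S \<and> a i \<le> b i) \<and>
        (\<forall>i<n. \<forall>j<n. i \<noteq> j \<longrightarrow> {a i<..<b i} \<inter> {a j<..<b j} = {}) \<and>
        (\<Sum>i<n. b i - a i) < \<delta>
        \<longrightarrow> (\<Sum>i<n. dist (f (a i)) (f (b i))) < \<epsilon>)"

text \<open>
  \<open>strong_solution A G t0 T x0 x\<close>: \<open>x\<close> is a strong solution on \<open>[t0, T]\<close> of
  \<open>x'(t) + G (x(t)) \<ni> 0\<close>, \<open>x(t0) = x0\<close>.  The operator \<open>A\<close> enters only through the requirement
  that \<open>x(t)\<close> lies in its domain for almost every \<open>t\<close>.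
\<close>

definition strong_solution ::
  "('a \<Rightarrow> 'a set) \<Rightarrow> ('a \<Rightarrow> 'a set) \<Rightarrow> real \<Rightarrow> real \<Rightarrow> 'a \<Rightarrow> (real \<Rightarrow> 'a::real_normed_vector) \<Rightarrow> bool"
  where
  "strong_solution A G t0 T x0 x \<longleftrightarrow>
     continuous_on {t0..T} x \<and>
     (\<forall>K. compact K \<and> K \<subseteq> {t0<..<T} \<longrightarrow> abs_continuous_on K x) \<and>
     (AE t in lborel. t \<in> {t0<..T} \<longrightarrow> x t \<in> op_dom A) \<and>
     (AE t in lborel. t \<in> {t0<..<T} \<longrightarrow>
        (\<exists>v. (x has_vector_derivative v) (at t) \<and> 0 \<in> (\<lambda>u. v + u) ` G (x t))) \<and>
     x t0 = x0"

text \<open>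
  Functions are total on the reals, so uniqueness means coincidence on \<open>[t0, T]\<close>.
\<close>

definition is_unique_strong_solution ::
  "('a \<Rightarrow> 'a set) \<Rightarrow> ('a \<Rightarrow> 'a set) \<Rightarrow> real \<Rightarrow> real \<Rightarrow> 'a \<Rightarrow> (real \<Rightarrow> 'a::real_normed_vector) \<Rightarrow> bool"
  where
  "is_unique_strong_solution A G t0 T x0 x \<longleftrightarrow>
     strong_solution A G t0 T x0 x \<and>
     (\<forall>y. strong_solution A G t0 T x0 y \<longrightarrow> (\<forall>t\<in>{t0..T}. y t = x t))"

end

theory Submission
  imports Defs
begin

text \<open>
  Since \<open>F\<^bsub>m x\<^esub> x = A x + D x\<close> with \<open>D x = B\<^bsub>m x\<^esub> x\<close>, both systems are the same inclusion
  \<open>x' + A x + D x \<ni> 0\<close>, and by the duality defining \<open>W1\<close> the map \<open>D\<close> is Lipschitz with constant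
  \<open>\<omega> = L + \<beta> \<tau>\<close>.  Uniqueness is Gronwall's inequality for the absolutely continuous function
  \<open>exp (- 2 \<omega> t) \<bar>x - y\<bar>\<^sup>2\<close>.  For existence, \<open>G = A + D + \<omega> I\<close> is maximal monotone and the inclusion reads
  \<open>x' + G x \<ni> \<omega> x\<close>.  Replacing \<open>G\<close> by its Yosida approximations, whose existence rests on Minty's
  theorem, gives Lipschitz differential equations whose solutions converge uniformly to some \<open>u\<close>.  By
  Baire's theorem \<open>G\<close> is bounded near an interior point of its domain, which bounds the total variation
  of the approximate solutions and so makes \<open>u\<close> Lipschitz away from the initial time, with values in the domain
  of \<open>G\<close>.  Finally \<open>u\<close> has the right derivative \<open>- g\<close>, where \<open>g t\<close> is the element of minimal norm of
  \<open>G (u t) - \<omega> u t\<close>; since \<open>exp (- \<omega> t) \<bar>g t\<bar>\<close> is monotone, \<open>u\<close> is differentiable off a countable set,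
  and no vector-valued Rademacher theorem is needed.
\<close>

section \<open>Minty's theorem\<close>

text \<open>Two obstacles shape the proof: the Hilbert space may be infinite-dimensional and
  nonseparable, and x0 lies only in the closure of the domain. Against the first, every limit is a
  strong one, extracted from convexity or from monotone norms (\<open>yosida_dist_le\<close>), and
  vector integrals are reached through inner products with fixed vectors. Against the second, note
  that the initial speeds of the approximate solutions may blow up when x0 is outside the domain;
  regularity is therefore sought only for t > 0, with a constant of the form C / t, and this is
  where the interior point of the domain enters. The shift by \<omega> is there because D need not
  be monotone, but inner (x - y) (D x - D y) >= - \<omega> |x - y|^2; the price is a factor exp
  (\<omega> t) in each contraction estimate. The limit u is at first known only through inequalities
  without derivatives (\<open>flow_dist\<close>, \<open>flow_integral_ineq\<close>). Applied to
  difference quotients, one bounds their norm by that of the minimal selection and the other bounds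
  their inner products from below; together they leave only one possible limit.\<close>

lemma monotone_opD:
  "monotone_op A \<Longrightarrow> u \<in> A x \<Longrightarrow> v \<in> A y \<Longrightarrow> inner (x - y) (u - v) \<ge> 0"
  unfolding monotone_op_def by blast

text \<open>If (x, u) is monotonically related to the whole graph, then adding u to A x alone is a
  monotone extension, so by maximality u was there already.\<close>

lemma maximal_monotone_op_iff:
  "maximal_monotone_op A \<longleftrightarrow>
     monotone_op A \<and> (\<forall>x u. (\<forall>y. \<forall>v\<in>A y. inner (x - y) (u - v) \<ge> 0) \<longrightarrow> u \<in> A x)"
  (is "_ \<longleftrightarrow> _ \<and> ?R")
proof (intro iffI conjI)
  assume A: "maximal_monotone_op A"
  then show mono: "monotone_op A"
    by (simp add: maximal_monotone_op_def)
  show ?R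
  proof (intro allI impI)
    fix x u assume *: "\<forall>y. \<forall>v\<in>A y. inner (x - y) (u - v) \<ge> 0"
    let ?A = "A(x := insert u (A x))"
    have **: "\<forall>y. \<forall>v\<in>A y. inner (y - x) (v - u) \<ge> 0"
      using * by (metis inner_minus_left inner_minus_right minus_diff_eq)
    have "monotone_op ?A"
      using mono * ** unfolding monotone_op_def by (auto split: if_splits)
    then have "?A = A"
      using A unfolding maximal_monotone_op_def by auto
    then show "u \<in> A x"
      by (metis fun_upd_same insertI1)
  qed
next
  assume A: "monotone_op A \<and> ?R"
  show "maximal_monotone_op A"
    unfolding maximal_monotone_op_def
  proof (intro conjI allI impI)
    fix A' assume A': "monotone_op A' \<and> (\<forall>x. A x \<subseteq> A' x)"
    have "u \<in> A x" if "u \<in> A' x" for x u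
      using A A' that unfolding monotone_op_def by blast
    then show "A' = A"
      using A' by (intro ext) blast
  qed (use A in blast)
qed

lemma maximal_monotone_opD:
  "maximal_monotone_op A \<Longrightarrow> (\<And>y v. v \<in> A y \<Longrightarrow> inner (x - y) (u - v) \<ge> 0) \<Longrightarrow> u \<in> A x"
  unfolding maximal_monotone_op_iff by blast

lemma maximal_monotone_op_nonempty:
  "maximal_monotone_op A \<Longrightarrow> \<exists>x u. u \<in> A x"
  using maximal_monotone_opD[of A] by blast

text \<open>
  Minimising \<open>F x u + \<bar>x\<bar>\<^sup>2 / 2 + \<bar>u\<bar>\<^sup>2 / 2\<close>, where
  \<open>F x u = Sup {\<langle>x, v\<rangle> + \<langle>y, u\<rangle> - \<langle>y, v\<rangle> | v \<in> A y}\<close> is the Fitzpatrick function.  A triple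
  \<open>(x, u, t)\<close> below is a point of the epigraph of \<open>F\<close>.  Strong convexity makes minimising
  sequences Cauchy, so no weak compactness is needed.
\<close>

lemma Fitzpatrick_minimizer:
  fixes A :: "'h::{real_inner, complete_space} \<Rightarrow> 'h set"
  assumes A: "maximal_monotone_op A"
  defines "E \<equiv> \<lambda>x u t. \<forall>y. \<forall>v\<in>A y. inner x v + inner y u - inner y v \<le> t"
    and "V \<equiv> \<lambda>x u t. t + inner x x / 2 + inner u u / 2"
  obtains x u t where "E x u t" "\<And>x' u' t'. E x' u' t' \<Longrightarrow> V x u t \<le> V x' u' t'"
    "inner x u \<le> t" "\<And>y v. v \<in> A y \<Longrightarrow> E y v (inner y v)"
proof -
  have E_ge: "inner x u \<le> t" if "E x u t" for x u t
  proof (rule ccontr)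
    assume neg: "\<not> inner x u \<le> t"
    \<comment> \<open>If t < inner x u, this identity makes every inner (x - y) (u - v) positive, so
      (x, u) is in the graph; but then E at (x, u) itself says inner x u <= t.\<close>
    have eq: "inner (x - y) (u - v) = inner x u - (inner x v + inner y u - inner y v)" for y v
      by (simp add: algebra_simps)
    have "u \<in> A x"
    proof (rule maximal_monotone_opD[OF A])
      fix y v assume "v \<in> A y"
      then show "inner (x - y) (u - v) \<ge> 0"
        unfolding eq using that neg unfolding E_def by force
    qed
    then show False
      using that neg unfolding E_def by force
  qed
  have E_graph: "E y v (inner y v)" if "v \<in> A y" for y v
    using A that unfolding E_def maximal_monotone_op_def monotone_op_def
    by (force simp: algebra_simps)
  have V_nonneg: "V x u t \<ge> 0" if "E x u t" for x u t
  proof -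
    have "0 \<le> inner (x + u) (x + u) / 2" by simp
    also have "\<dots> = inner x u + inner x x / 2 + inner u u / 2"
      by (simp add: algebra_simps inner_commute)
    finally show ?thesis using E_ge[OF that] unfolding V_def by simp
  qed
  define S where "S = {V x u t | x u t. E x u t}"
  define m where "m = Inf S"
  have "S \<noteq> {}"
    using E_graph maximal_monotone_op_nonempty[OF A] unfolding S_def by blast
  have bdd: "bdd_below S"
    unfolding S_def by (rule bdd_belowI[of _ 0]) (use V_nonneg in blast)
  have m_le: "m \<le> V x u t" if "E x u t" for x u t
    unfolding m_def by (rule cInf_lower[OF _ bdd]) (use that S_def in blast)
  have "\<exists>x u t. E x u t \<and> V x u t < m + 1 / Suc n" for n
    using cInf_lessD[OF \<open>S \<noteq> {}\<close>, of "m + 1 / Suc n"] unfolding m_def S_def by auto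
  then obtain X U Tt where E: "\<And>n. E (X n) (U n) (Tt n)"
    and V: "\<And>n. V (X n) (U n) (Tt n) < m + 1 / Suc n"
    by metis
  \<comment> \<open>Compare with the midpoint, which stays in the epigraph because E is a family of
    affine inequalities: the parallelogram law lowers V there by one eighth of the squared distance,
    and V cannot drop below m.\<close>
  have close: "(norm (X n - X k))\<^sup>2 + (norm (U n - U k))\<^sup>2 \<le> 4 / Suc n + 4 / Suc k" for n k
  proof -
    let ?x = "(X n + X k) /\<^sub>R 2" and ?u = "(U n + U k) /\<^sub>R 2" and ?t = "(Tt n + Tt k) / 2"
    have "E ?x ?u ?t"
      unfolding E_def
    proof (intro allI ballI)
      fix y v assume v: "v \<in> A y"
      have "inner ?x v + inner y ?u - inner y v
        = ((inner (X n) v + inner y (U n) - inner y v) + (inner (X k) v + inner y (U k) - inner y v)) / 2"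
        by (simp add: algebra_simps add_divide_distrib diff_divide_distrib)
      also have "\<dots> \<le> ?t"
        using E v unfolding E_def by (smt (verit, best) divide_right_mono)
      finally show "inner ?x v + inner y ?u - inner y v \<le> ?t" .
    qed
    then have "m \<le> V ?x ?u ?t" by (rule m_le)
    also have "V ?x ?u ?t = (V (X n) (U n) (Tt n) + V (X k) (U k) (Tt k)) / 2
        - ((norm (X n - X k))\<^sup>2 + (norm (U n - U k))\<^sup>2) / 8"
      unfolding V_def
      by (simp add: power2_norm_eq_inner algebra_simps inner_commute divide_simps)
    finally have "(norm (X n - X k))\<^sup>2 + (norm (U n - U k))\<^sup>2
        \<le> 4 * V (X n) (U n) (Tt n) + 4 * V (X k) (U k) (Tt k) - 8 * m"
      by argo
    also have "\<dots> \<le> 4 * (m + 1 / Suc n) + 4 * (m + 1 / Suc k) - 8 * m"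
      using V[of n] V[of k] by argo
    finally show ?thesis by simp
  qed
  have Cauchy: "Cauchy Z" if Z: "\<And>n k. (norm (Z n - Z k))\<^sup>2 \<le> 4 / Suc n + 4 / Suc k" for Z :: "nat \<Rightarrow> 'h"
  proof (rule metric_CauchyI)
    fix e :: real assume "e > 0"
    then obtain N where N: "1 / Suc N < e\<^sup>2 / 8"
      using nat_approx_posE[of "e\<^sup>2 / 8"] by auto
    have "dist (Z n) (Z k) < e" if "n \<ge> N" "k \<ge> N" for n k
    proof -
      have "1 / Suc n \<le> 1 / Suc N" "1 / Suc k \<le> 1 / Suc N"
        using that by (auto simp: field_simps)
      then have "(norm (Z n - Z k))\<^sup>2 < e\<^sup>2"
        using Z[of n k] N by simp
      then show ?thesis
        using \<open>e > 0\<close> unfolding dist_norm by (meson less_imp_le power_less_imp_less_base)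
    qed
    then show "\<exists>M. \<forall>m\<ge>M. \<forall>n\<ge>M. dist (Z m) (Z n) < e" by blast
  qed
  have "Cauchy X" "Cauchy U"
    using close by (smt (verit, best) Cauchy zero_le_power2)+
  then obtain x u where X: "X \<longlonglongrightarrow> x" and U: "U \<longlonglongrightarrow> u"
    by (meson Cauchy_convergent convergent_def)
  have T0: "(\<lambda>n. V (X n) (U n) (Tt n)) \<longlonglongrightarrow> m"
  proof (rule tendsto_sandwich)
    show "(\<lambda>n. m) \<longlonglongrightarrow> m" by simp
    show "(\<lambda>n. m + 1 / Suc n) \<longlonglongrightarrow> m"
      using tendsto_add[OF tendsto_const[of m] LIMSEQ_inverse_real_of_nat]
      by (simp add: inverse_eq_divide)
  qed (auto intro!: always_eventually m_le[OF E] less_imp_le[OF V] simp del: of_nat_Suc)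
  define t where "t = m - inner x x / 2 - inner u u / 2"
  have "(\<lambda>n. V (X n) (U n) (Tt n) - inner (X n) (X n) / 2 - inner (U n) (U n) / 2) \<longlonglongrightarrow> t"
    unfolding t_def by (intro tendsto_intros T0 X U) auto
  then have T: "Tt \<longlonglongrightarrow> t" by (simp add: V_def)
  have "E x u t"
    unfolding E_def
  proof (intro allI ballI)
    fix y v assume v: "v \<in> A y"
    show "inner x v + inner y u - inner y v \<le> t"
    proof (rule LIMSEQ_le[OF _ T])
      show "(\<lambda>n. inner (X n) v + inner y (U n) - inner y v) \<longlonglongrightarrow> inner x v + inner y u - inner y v"
        by (intro tendsto_intros X U)
    qed (use E v in \<open>auto simp: E_def\<close>)
  qed
  moreover have "V x u t = m" by (simp add: V_def t_def)
  ultimately show thesis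
    using m_le E_graph E_ge that by metis
qed

text \<open>
  For the minimiser \<open>(x, u)\<close> of the previous lemma the optimality condition reads
  \<open>\<langle>y + u, v + x\<rangle> \<ge> \<bar>x + u\<bar>\<^sup>2\<close> on the graph of \<open>A\<close>.
\<close>

lemma Minty_0:
  fixes A :: "'h::{real_inner, complete_space} \<Rightarrow> 'h set"
  assumes A: "maximal_monotone_op A"
  shows "\<exists>x. - x \<in> A x"
proof -
  obtain x u t where E: "\<forall>y. \<forall>v\<in>A y. inner x v + inner y u - inner y v \<le> t"
    and min: "\<And>x' u' t'. \<forall>y. \<forall>v\<in>A y. inner x' v + inner y u' - inner y v \<le> t' \<Longrightarrow>
        t + inner x x / 2 + inner u u / 2 \<le> t' + inner x' x' / 2 + inner u' u' / 2"
    and ge: "inner x u \<le> t"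
    and graph: "\<And>y v. v \<in> A y \<Longrightarrow> \<forall>z. \<forall>w\<in>A z. inner y w + inner z v - inner z w \<le> inner y v"
    by (rule Fitzpatrick_minimizer[OF A]) (blast intro: that)
  have key: "inner (y + u) (v + x) \<ge> inner (x + u) (x + u)" if v: "v \<in> A y" for y v
  proof -
    \<comment> \<open>First-order condition along the segment from (x, u, t) to (y, v, inner y v),
      which stays in the epigraph by convexity. The minimality inequality is divided by s; s * K is
      the quadratic remainder.\<close>
    have opt: "t + inner x x + inner u u \<le> inner y v + inner x y + inner u v + s * K"
      if s: "0 < s" "s \<le> 1" and K: "K = (inner (y - x) (y - x) + inner (v - u) (v - u)) / 2" for s K
    proof -
      let ?x = "x + s *\<^sub>R (y - x)" and ?u = "u + s *\<^sub>R (v - u)" and ?t = "t + s * (inner y v - t)"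
      have "\<forall>z. \<forall>w\<in>A z. inner ?x w + inner z ?u - inner z w \<le> ?t"
      proof (intro allI ballI)
        fix z w assume w: "w \<in> A z"
        have "inner ?x w + inner z ?u - inner z w
          = (1 - s) * (inner x w + inner z u - inner z w) + s * (inner y w + inner z v - inner z w)"
          by (simp add: algebra_simps)
        also have "\<dots> \<le> (1 - s) * t + s * inner y v"
          using E graph[OF v] w s by (intro add_mono mult_left_mono) auto
        finally show "inner ?x w + inner z ?u - inner z w \<le> ?t" by (simp add: algebra_simps)
      qed
      from min[OF this] have "0 \<le> s * (inner y v + inner x y + inner u v + s * K - (t + inner x x + inner u u))"
        unfolding K by (simp add: algebra_simps inner_commute power2_eq_square add_divide_distrib diff_divide_distrib)
      then show ?thesis using s by (simp add: zero_le_mult_iff)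
    qed
    define K where "K = (inner (y - x) (y - x) + inner (v - u) (v - u)) / 2"
    have "t + inner x x + inner u u \<le> inner y v + inner x y + inner u v"
    proof (rule tendsto_lowerbound)
      show "((\<lambda>s. inner y v + inner x y + inner u v + s * K) \<longlongrightarrow> inner y v + inner x y + inner u v) (at_right 0)"
        by (auto intro!: tendsto_eq_intros)
      show "\<forall>\<^sub>F s in at_right 0. t + inner x x + inner u u \<le> inner y v + inner x y + inner u v + s * K"
        using opt[OF _ _ K_def] eventually_at_right[of 0 1] by (auto intro!: eventually_at_rightI[of 0 1])
    qed simp
    then show ?thesis using ge by (simp add: algebra_simps inner_commute)
  qed
  have mem: "- x \<in> A (- u)"
  proof (rule maximal_monotone_opD[OF A])
    fix y v assume "v \<in> A y"
    from key[OF this] have "0 \<le> inner (y + u) (v + x)"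
      using inner_ge_zero order_trans by blast
    then show "0 \<le> inner (- u - y) (- x - v)"
      by (simp add: algebra_simps)
  qed
  \<comment> \<open>At the graph point (-u, -x) the left side of \<open>key\<close>
    vanishes.\<close>
  from key[OF this] have "x + u = 0"
    by (metis add.left_inverse inner_eq_zero_iff inner_ge_zero inner_zero_left order_antisym)
  then show ?thesis using mem by (metis add_eq_0_iff neg_equal_iff_equal minus_minus)
qed

section \<open>Yosida approximation\<close>

text \<open>The operator z |-> \<kappa> A (z + x) is again maximal monotone. \<open>Minty_0\<close>
  finds z with - z among its values at z, and v = - z / \<kappa> puts x - \<kappa> v at x +
  z.\<close>

lemma Minty:
  fixes A :: "'h::{real_inner, complete_space} \<Rightarrow> 'h set"
  assumes A: "maximal_monotone_op A" and "\<kappa> > 0"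
  shows "\<exists>v. v \<in> A (x - \<kappa> *\<^sub>R v)"
proof -
  define A' where "A' z = {w. w /\<^sub>R \<kappa> \<in> A (z + x)}" for z
  have "maximal_monotone_op A'"
    unfolding maximal_monotone_op_iff
  proof (intro conjI allI impI)
    show "monotone_op A'"
      unfolding monotone_op_def
    proof (intro allI ballI)
      fix y z u v assume "u \<in> A' y" "v \<in> A' z"
      then have "0 \<le> inner ((y + x) - (z + x)) (u /\<^sub>R \<kappa> - v /\<^sub>R \<kappa>)"
        using A unfolding A'_def maximal_monotone_op_def by (intro monotone_opD) auto
      also have "\<dots> = inner (y - z) (u - v) / \<kappa>"
        by (simp add: scaleR_right_diff_distrib[symmetric] divide_inverse mult.commute)
      finally show "0 \<le> inner (y - z) (u - v)"
        using \<open>\<kappa> > 0\<close> by (simp add: zero_le_divide_iff)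
    qed
  next
    fix z u assume *: "\<forall>y. \<forall>v\<in>A' y. 0 \<le> inner (z - y) (u - v)"
    have "u /\<^sub>R \<kappa> \<in> A (z + x)"
    proof (rule maximal_monotone_opD[OF A])
      fix y v assume "v \<in> A y"
      then have "\<kappa> *\<^sub>R v \<in> A' (y - x)" using \<open>\<kappa> > 0\<close> by (simp add: A'_def)
      with * have "0 \<le> inner (z - (y - x)) (u - \<kappa> *\<^sub>R v)" by blast
      also have "\<dots> = \<kappa> * inner (z + x - y) (u /\<^sub>R \<kappa> - v)"
      proof -
        have "\<kappa> *\<^sub>R (u /\<^sub>R \<kappa> - v) = u - \<kappa> *\<^sub>R v"
          using \<open>\<kappa> > 0\<close> by (simp add: scaleR_right_diff_distrib)
        then show ?thesis by (metis inner_scaleR_right diff_diff_eq2)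
      qed
      finally show "0 \<le> inner (z + x - y) (u /\<^sub>R \<kappa> - v)"
        using \<open>\<kappa> > 0\<close> by (simp add: zero_le_mult_iff)
    qed
    then show "u \<in> A' z" by (simp add: A'_def)
  qed
  from Minty_0[OF this] obtain z where "(- z) /\<^sub>R \<kappa> \<in> A (z + x)"
    unfolding A'_def by auto
  then show ?thesis
    using \<open>\<kappa> > 0\<close> by (intro exI[of _ "(- z) /\<^sub>R \<kappa>"]) (simp add: add.commute)
qed

text \<open>With the resolvent J = (I + \<kappa> A)^-1 this is (x - J x) / \<kappa>: the condition
  on v says that J x = x - \<kappa> v. For monotone A and \<kappa> > 0 at most one such v
  exists.\<close>

definition yosida :: "('h::real_inner \<Rightarrow> 'h set) \<Rightarrow> real \<Rightarrow> 'h \<Rightarrow> 'h" where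
  "yosida A \<kappa> x = (SOME v. v \<in> A (x - \<kappa> *\<^sub>R v))"

context
  fixes A :: "'h::{real_inner, complete_space} \<Rightarrow> 'h set"
  assumes A: "maximal_monotone_op A"
begin

lemma graph_monotone: "u \<in> A x \<Longrightarrow> v \<in> A y \<Longrightarrow> inner (x - y) (u - v) \<ge> 0"
  using A unfolding maximal_monotone_op_def by (blast intro: monotone_opD)

lemma yosida_mem: "\<kappa> > 0 \<Longrightarrow> yosida A \<kappa> x \<in> A (x - \<kappa> *\<^sub>R yosida A \<kappa> x)"
  unfolding yosida_def by (rule someI_ex) (rule Minty[OF A])

text \<open>Monotonicity of A between the two resolvent points; the source of the monotonicity and
  the Lipschitz bound of the Yosida map and of the nonexpansiveness of the resolvent.\<close>

lemma yosida_cocoercive: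
  assumes "\<kappa> > 0"
  shows "\<kappa> * (norm (yosida A \<kappa> x - yosida A \<kappa> y))\<^sup>2
    \<le> inner (x - y) (yosida A \<kappa> x - yosida A \<kappa> y)"
  using graph_monotone[OF yosida_mem[OF assms, of x] yosida_mem[OF assms, of y]]
  by (simp add: power2_norm_eq_inner algebra_simps)

lemma yosida_monotone:
  assumes "\<kappa> > 0"
  shows "0 \<le> inner (x - y) (yosida A \<kappa> x - yosida A \<kappa> y)"
  using yosida_cocoercive[OF assms, of x y] assms
  by (meson order_trans less_imp_le mult_nonneg_nonneg zero_le_power2)

lemma yosida_lipschitz:
  assumes "\<kappa> > 0"
  shows "(1 / \<kappa>)-lipschitz_on UNIV (yosida A \<kappa>)"
proof (rule lipschitz_onI)
  fix x y
  let ?d = "yosida A \<kappa> x - yosida A \<kappa> y"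
  have "\<kappa> * (norm ?d)\<^sup>2 \<le> norm (x - y) * norm ?d"
    using yosida_cocoercive[OF assms, of x y] norm_cauchy_schwarz[of "x - y" ?d] by linarith
  then have "norm ?d * (\<kappa> * norm ?d) \<le> norm ?d * norm (x - y)"
    by (simp add: power2_eq_square mult_ac)
  then have "\<kappa> * norm ?d \<le> norm (x - y)"
    by (cases "?d = 0") auto
  then show "dist (yosida A \<kappa> x) (yosida A \<kappa> y) \<le> 1 / \<kappa> * dist x y"
    using assms by (simp add: dist_norm field_simps)
qed (use assms in auto)

lemma yosida_continuous: "\<kappa> > 0 \<Longrightarrow> continuous_on UNIV (yosida A \<kappa>)"
  using yosida_lipschitz lipschitz_on_continuous_on by blast

lemma resolvent_nonexpansive:
  assumes "\<kappa> > 0"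
  shows "norm ((x - \<kappa> *\<^sub>R yosida A \<kappa> x) - (y - \<kappa> *\<^sub>R yosida A \<kappa> y)) \<le> norm (x - y)"
proof -
  let ?d = "yosida A \<kappa> x - yosida A \<kappa> y"
  have "(norm ((x - y) - \<kappa> *\<^sub>R ?d))\<^sup>2 =
      (norm (x - y))\<^sup>2 - 2 * \<kappa> * (inner (x - y) ?d - \<kappa> * (norm ?d)\<^sup>2) - \<kappa>\<^sup>2 * (norm ?d)\<^sup>2"
    unfolding power2_norm_eq_inner by (simp add: algebra_simps inner_commute power2_eq_square)
  also have "\<dots> \<le> (norm (x - y))\<^sup>2"
    using yosida_cocoercive[OF assms, of x y] assms by (smt (verit) mult_nonneg_nonneg zero_le_power2)
  finally show ?thesis
    by (simp add: algebra_simps)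
qed

lemma norm_yosida_le:
  assumes "\<kappa> > 0" "v \<in> A x"
  shows "norm (yosida A \<kappa> x) \<le> norm v"
proof -
  let ?y = "yosida A \<kappa> x"
  have "0 \<le> \<kappa> * (inner ?y v - inner ?y ?y)"
    using graph_monotone[OF assms(2) yosida_mem[OF assms(1), of x]] by (simp add: algebra_simps)
  then have "norm ?y * norm ?y \<le> norm ?y * norm v"
    using assms norm_cauchy_schwarz[of ?y v]
    by (simp add: zero_le_mult_iff power2_norm_eq_inner[symmetric] power2_eq_square)
  then show ?thesis by (cases "?y = 0") auto
qed

text \<open>With a and b the values for \<kappa> and \<mu>, monotonicity between the two resolvent
  points of the same x gives inner a a <= inner b a. So the norms grow as the parameter shrinks and
  their growth controls the distance: a mere bound yields strong convergence.\<close>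

lemma yosida_dist_le:
  assumes "0 < \<mu>" "\<mu> \<le> \<kappa>"
  shows "(norm (yosida A \<kappa> x - yosida A \<mu> x))\<^sup>2 \<le> (norm (yosida A \<mu> x))\<^sup>2 - (norm (yosida A \<kappa> x))\<^sup>2"
proof (cases "\<mu> = \<kappa>")
  case False
  let ?a = "yosida A \<kappa> x" and ?b = "yosida A \<mu> x"
  have "0 \<le> inner (?a - ?b) (\<mu> *\<^sub>R ?b - \<kappa> *\<^sub>R ?a)"
    using graph_monotone[OF yosida_mem[of \<kappa> x] yosida_mem[of \<mu> x]] assms by (simp add: inner_commute)
  also have "\<dots> = (\<kappa> - \<mu>) * (inner ?b ?a - inner ?a ?a) - \<mu> * inner (?a - ?b) (?a - ?b)"
    by (simp add: algebra_simps inner_commute)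
  also have "\<dots> \<le> (\<kappa> - \<mu>) * (inner ?b ?a - inner ?a ?a)"
    using assms by simp
  finally have "inner ?a ?a \<le> inner ?b ?a"
    using assms False by (simp add: zero_le_mult_iff)
  then show ?thesis
    unfolding power2_norm_eq_inner by (simp add: algebra_simps inner_commute)
qed simp

lemma graph_closed:
  assumes "X \<longlonglongrightarrow> x" "V \<longlonglongrightarrow> v" "\<And>n. V n \<in> A (X n)"
  shows "v \<in> A x"
proof (rule maximal_monotone_opD[OF A])
  fix y w assume w: "w \<in> A y"
  have "(\<lambda>n. inner (X n - y) (V n - w)) \<longlonglongrightarrow> inner (x - y) (v - w)"
    by (intro tendsto_intros assms)
  then show "0 \<le> inner (x - y) (v - w)"
    by (rule tendsto_lowerbound) (auto intro!: always_eventually graph_monotone assms w)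
qed

lemma yosida_limit:
  assumes bdd: "\<And>n. norm (yosida A (1 / Suc n) x) \<le> c"
  obtains g where "(\<lambda>n. yosida A (1 / Suc n) x) \<longlonglongrightarrow> g" "g \<in> A x" "norm g \<le> c"
proof -
  define Y where "Y n = yosida A (1 / Suc n) x" for n
  have d: "(norm (Y n - Y k))\<^sup>2 \<le> (norm (Y k))\<^sup>2 - (norm (Y n))\<^sup>2" if "n \<le> k" for n k
    unfolding Y_def using that by (intro yosida_dist_le) (auto simp: field_simps)
  have inc: "incseq (\<lambda>n. (norm (Y n))\<^sup>2)"
    unfolding incseq_def using d by (smt (verit) zero_le_power2)
  have "(norm (Y n))\<^sup>2 \<le> c\<^sup>2" for n
    using bdd[of n] unfolding Y_def by (intro power_mono) auto
  then have "Bseq (\<lambda>n. (norm (Y n))\<^sup>2)"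
    by (intro BseqI'[of _ "c\<^sup>2"]) auto
  then have "Cauchy (\<lambda>n. (norm (Y n))\<^sup>2)"
    using inc by (intro convergent_Cauchy Bseq_monoseq_convergent incseq_imp_monoseq)
  have "Cauchy Y"
  proof (rule CauchyI')
    fix e :: real assume "e > 0"
    then obtain N where N: "\<And>m n. m \<ge> N \<Longrightarrow> n \<ge> N \<Longrightarrow> dist ((norm (Y m))\<^sup>2) ((norm (Y n))\<^sup>2) < e\<^sup>2"
      using \<open>Cauchy (\<lambda>n. (norm (Y n))\<^sup>2)\<close> unfolding Cauchy_def by (meson zero_less_power)
    have "norm (Y m - Y n) < e" if "N \<le> m" "m < n" for m n
    proof -
      have "(norm (Y m - Y n))\<^sup>2 < e\<^sup>2"
        using d[of m n] N[of m n] that by (simp add: dist_real_def)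
      then show ?thesis using \<open>e > 0\<close> by (meson less_imp_le power_less_imp_less_base)
    qed
    then show "\<exists>M. \<forall>m\<ge>M. \<forall>n>m. dist (Y m) (Y n) < e"
      unfolding dist_norm by blast
  qed
  then obtain g where g: "Y \<longlonglongrightarrow> g"
    by (meson Cauchy_convergent convergent_def)
  have "(\<lambda>n. x - (1 / Suc n) *\<^sub>R Y n) \<longlonglongrightarrow> x - 0 *\<^sub>R g"
    by (intro tendsto_intros g LIMSEQ_inverse_real_of_nat[unfolded inverse_eq_divide])
  then have "g \<in> A x"
    using yosida_mem unfolding Y_def by (intro graph_closed[OF _ g[unfolded Y_def]]) auto
  moreover have "norm g \<le> c"
    using bdd by (intro LIMSEQ_le_const2[OF tendsto_norm[OF g]]) (auto simp: Y_def)
  ultimately show thesis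
    using that g unfolding Y_def by blast
qed

text \<open>Takes the place of a weak limit of V. For a fixed parameter the Yosida map is continuous
  and bounded by c at each X n, hence also at x; \<open>yosida_limit\<close> then lets the parameter
  tend to 0.\<close>

lemma graph_demiclosed:
  assumes X: "X \<longlonglongrightarrow> x" and V: "\<And>n. V n \<in> A (X n)" "\<And>n. norm (V n) \<le> c"
  shows "\<exists>v\<in>A x. norm v \<le> c"
proof -
  have "norm (yosida A (1 / Suc k) x) \<le> c" for k
  proof (rule LIMSEQ_le_const2)
    show "(\<lambda>n. norm (yosida A (1 / Suc k) (X n))) \<longlonglongrightarrow> norm (yosida A (1 / Suc k) x)"
      by (intro tendsto_norm continuous_on_tendsto_compose[OF yosida_continuous X]) auto
    show "\<exists>N. \<forall>n\<ge>N. norm (yosida A (1 / Suc k) (X n)) \<le> c"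
      using norm_yosida_le[OF _ V(1)] V(2) by (metis order_trans of_nat_0_less_iff zero_less_Suc zero_less_divide_1_iff)
  qed
  then show ?thesis by (rule yosida_limit) blast
qed

lemma minimal_selection:
  assumes "x \<in> op_dom A"
  obtains g where "g \<in> A x" "\<And>v. v \<in> A x \<Longrightarrow> norm g \<le> norm v"
    "(\<lambda>n. yosida A (1 / Suc n) x) \<longlonglongrightarrow> g"
proof -
  from assms obtain w where w: "w \<in> A x" by (auto simp: op_dom_def)
  obtain g where g: "(\<lambda>n. yosida A (1 / Suc n) x) \<longlonglongrightarrow> g" "g \<in> A x"
    using norm_yosida_le[OF _ w] by (rule yosida_limit) auto
  have "norm g \<le> norm v" if "v \<in> A x" for v
    using norm_yosida_le[OF _ that] by (intro LIMSEQ_le_const2[OF tendsto_norm[OF g(1)]]) auto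
  with g that show thesis by blast
qed

text \<open>
  Testing the second hypothesis with the Yosida points of \<open>x\<close> gives
  \<open>liminf \<langle>w, g\<rangle> \<ge> \<bar>g\<bar>\<^sup>2\<close>; this replaces extracting a weak limit of \<open>w\<close>.
\<close>

lemma tendsto_minimal_selection:
  assumes g: "g \<in> A x" "\<And>v. v \<in> A x \<Longrightarrow> norm g \<le> norm v"
    and le: "\<And>e. e > 0 \<Longrightarrow> \<forall>\<^sub>F h in F. norm (w h) \<le> norm g + e"
    and ge: "\<And>y v e. v \<in> A y \<Longrightarrow> e > 0 \<Longrightarrow> \<forall>\<^sub>F h in F. inner (w h - v) (x - y) \<ge> - e"
  shows "(w \<longlongrightarrow> g) F"
proof -
  have "x \<in> op_dom A" using g by (auto simp: op_dom_def)
  then obtain g' where g': "g' \<in> A x" "\<And>v. v \<in> A x \<Longrightarrow> norm g' \<le> norm v"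
    "(\<lambda>n. yosida A (1 / Suc n) x) \<longlonglongrightarrow> g'"
    using minimal_selection by blast
  \<comment> \<open>The minimal element is unique: by maximality A x contains midpoints, and the
    parallelogram law forces g = g'.\<close>
  have lim: "(\<lambda>n. yosida A (1 / Suc n) x) \<longlonglongrightarrow> g"
  proof -
    have "norm g = norm g'" using g g' by (meson order_antisym)
    have "(g + g') /\<^sub>R 2 \<in> A x"
    proof (rule maximal_monotone_opD[OF A])
      fix y v assume "v \<in> A y"
      then have "0 \<le> inner (x - y) (g - v)" "0 \<le> inner (x - y) (g' - v)"
        using graph_monotone g(1) g'(1) by blast+
      moreover have "inner (x - y) ((g + g') /\<^sub>R 2 - v) = (inner (x - y) (g - v) + inner (x - y) (g' - v)) / 2"
        by (simp add: algebra_simps add_divide_distrib diff_divide_distrib)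
      ultimately show "0 \<le> inner (x - y) ((g + g') /\<^sub>R 2 - v)" by simp
    qed
    then have "2 * norm g \<le> norm (g + g')" using g(2) by fastforce
    then have "(2 * norm g)\<^sup>2 \<le> (norm (g + g'))\<^sup>2" by (intro power_mono) auto
    then have "(norm (g - g'))\<^sup>2 \<le> 2 * (norm g')\<^sup>2 - 2 * (norm g)\<^sup>2"
      unfolding power_mult_distrib power2_norm_eq_inner by (simp add: algebra_simps inner_commute)
    then have "g = g'" using \<open>norm g = norm g'\<close> by simp
    then show ?thesis using g'(3) by simp
  qed
  show ?thesis
  proof (rule tendstoI)
    fix \<epsilon> :: real assume "\<epsilon> > 0"
    \<comment> \<open>\<open>C\<close> bounds norm (w h - v) and norm g; the errors below add up to
      at most 5 * C * e + 2 * e, which e * K dominates.\<close>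
    define C where "C = 2 * norm g + 2"
    define K where "K = 6 * C + 8"
    define e where "e = min 1 (\<epsilon>\<^sup>2 / (4 * K))"
    have C: "C \<ge> 2" "norm g \<le> C" by (auto simp: C_def)
    have "K > 0" using C by (simp add: K_def)
    have e: "0 < e" "e \<le> 1" "e * K < \<epsilon>\<^sup>2"
    proof -
      show "0 < e" "e \<le> 1" using \<open>\<epsilon> > 0\<close> \<open>K > 0\<close> by (auto simp: e_def)
      have "e * K \<le> \<epsilon>\<^sup>2 / (4 * K) * K"
        using \<open>K > 0\<close> by (intro mult_right_mono) (auto simp: e_def)
      also have "\<dots> = \<epsilon>\<^sup>2 / 4" using \<open>K > 0\<close> by simp
      also have "\<dots> < \<epsilon>\<^sup>2" using \<open>\<epsilon> > 0\<close> by simp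
      finally show "e * K < \<epsilon>\<^sup>2" .
    qed
    obtain n where n: "norm (yosida A (1 / Suc n) x - g) < e"
      using LIMSEQ_D[OF lim \<open>0 < e\<close>] by blast
    define v where "v = yosida A (1 / Suc n) x"
    \<comment> \<open>Here x - y = v / Suc n, so testing \<open>ge\<close> with tolerance e / Suc n
      leaves inner (w h - v) v >= - e after cancelling.\<close>
    define y where "y = x - (1 / Suc n) *\<^sub>R v"
    have v: "v \<in> A y" unfolding v_def y_def by (rule yosida_mem) auto
    have "\<forall>\<^sub>F h in F. inner (w h - v) (x - y) \<ge> - (e / Suc n)"
      using \<open>0 < e\<close> by (intro ge v) auto
    then have "\<forall>\<^sub>F h in F. inner (w h - v) v \<ge> - e"
      by eventually_elim (simp add: y_def minus_divide_left divide_le_cancel del: of_nat_Suc minus_divide_left[symmetric])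
    then show "\<forall>\<^sub>F h in F. dist (w h) g < \<epsilon>"
      using le[OF \<open>0 < e\<close>]
    proof eventually_elim
      case (elim h)
      let ?w = "w h"
      have "norm ?w \<le> norm g + 1" using elim e by linarith
      have vg: "norm (v - g) \<le> e" using n by (simp add: v_def)
      have "inner (?w - v) (g - v) \<ge> - (norm (?w - v) * norm (g - v))"
        using Cauchy_Schwarz_ineq2[of "?w - v" "g - v"] by linarith
      moreover have "norm (?w - v) \<le> C"
        using norm_triangle_ineq4[of ?w v] norm_triangle_sub[of v g] vg elim e by (simp add: C_def)
      then have "norm (?w - v) * norm (g - v) \<le> C * e"
        using vg C by (intro mult_mono) (auto simp: norm_minus_commute)
      ultimately have 1: "inner ?w g \<ge> inner v g - e - C * e"
        using elim by (simp add: algebra_simps)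
      have "inner (v - g) g \<ge> - (norm (v - g) * norm g)"
        using Cauchy_Schwarz_ineq2[of "v - g" g] by linarith
      moreover have "norm (v - g) * norm g \<le> e * C"
        using vg C e by (intro mult_mono) auto
      ultimately have 2: "inner v g \<ge> (norm g)\<^sup>2 - C * e"
        by (simp add: algebra_simps power2_norm_eq_inner)
      have "(norm ?w)\<^sup>2 \<le> (norm g + e)\<^sup>2" using elim by (intro power_mono) auto
      also have "\<dots> = (norm g)\<^sup>2 + e * (2 * norm g + e)" by (simp add: power2_eq_square algebra_simps)
      also have "\<dots> \<le> (norm g)\<^sup>2 + e * C" using e by (intro add_left_mono mult_left_mono) (auto simp: C_def)
      finally have 3: "(norm ?w)\<^sup>2 \<le> (norm g)\<^sup>2 + e * C" .
      have "0 \<le> C * e" using C e by simp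
      have "(norm (?w - g))\<^sup>2 = (norm ?w)\<^sup>2 + (norm g)\<^sup>2 - 2 * inner ?w g"
        unfolding power2_norm_eq_inner by (simp add: algebra_simps inner_commute)
      also have "\<dots> \<le> e * K"
      proof -
        have "e * K = 6 * (C * e) + 8 * e" "e * C = C * e" by (auto simp: K_def algebra_simps)
        then show ?thesis using 1 2 3 e(1) \<open>0 \<le> C * e\<close> by linarith
      qed
      also have "\<dots> < \<epsilon>\<^sup>2" by (rule e)
      finally show "dist ?w g < \<epsilon>"
        using \<open>\<epsilon> > 0\<close> unfolding dist_norm by (meson less_imp_le power_less_imp_less_base)
    qed
  qed
qed

end

section \<open>Local boundedness and perturbation of maximal monotone operators\<close>

lemma interior_dom_locally_bounded:
  fixes A :: "'h::{real_inner, complete_space} \<Rightarrow> 'h set"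
  assumes A: "maximal_monotone_op A" and int: "interior (op_dom A) \<noteq> {}"
  obtains z r C where "r > 0" "\<And>y. y \<in> ball z r \<Longrightarrow> \<exists>w\<in>A y. norm w \<le> C"
proof -
  define S where "S n = {y. \<exists>w\<in>A y. norm w \<le> real n}" for n
  \<comment> \<open>Values of norm at most n along a convergent sequence leave such a value at the
    limit, by \<open>graph_demiclosed\<close>.\<close>
  have "closed (S n)" for n
    unfolding closed_sequential_limits
  proof (intro allI impI, elim conjE)
    fix X x assume X: "\<forall>k. X k \<in> S n" "X \<longlonglongrightarrow> x"
    then obtain V where "\<And>k. V k \<in> A (X k)" "\<And>k. norm (V k) \<le> real n"
      unfolding S_def by simp metis
    then show "x \<in> S n"
      using graph_demiclosed[OF A X(2)] unfolding S_def by blast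
  qed
  \<comment> \<open>The closed sets S n cover the domain; if none had interior, Baire would leave
    their union without interior, against \<open>int\<close>.\<close>
  have "\<exists>n. interior (S n) \<noteq> {}"
  proof (rule ccontr)
    assume "\<not> (\<exists>n. interior (S n) \<noteq> {})"
    then have "Met_TC.mtopology interior_of (\<Union> (range S)) = {}"
      using \<open>\<And>n. closed (S n)\<close> \<open>\<not> (\<exists>n. interior (S n) \<noteq> {})\<close>
      by (intro Met_TC.metric_Baire_category_alt)
         (auto simp: complete_UNIV euclidean_interior_of)
    then have "interior (\<Union> (range S)) = {}" by simp
    moreover have "op_dom A \<subseteq> \<Union> (range S)"
      unfolding op_dom_def S_def using real_arch_simple by fastforce
    ultimately show False using int interior_mono by blast
  qed
  then obtain n z where "z \<in> interior (S n)" by blast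
  then obtain r where "r > 0" "ball z r \<subseteq> S n"
    using mem_interior by metis
  then show thesis
    using that[of r z "real n"] unfolding S_def by blast
qed

text \<open>Near a time t the flow is compared with A - \<omega> u t, where the value u t is frozen;
  c stands for this frozen term.\<close>

lemma maximal_monotone_op_diff_const:
  assumes A: "maximal_monotone_op A"
  shows "maximal_monotone_op (\<lambda>x. (\<lambda>a. a - c) ` A x)"
  unfolding maximal_monotone_op_iff
proof (intro conjI allI impI)
  show "monotone_op (\<lambda>x. (\<lambda>a. a - c) ` A x)"
    using A unfolding monotone_op_def maximal_monotone_op_def by auto
  fix x u assume *: "\<forall>y. \<forall>v\<in>(\<lambda>a. a - c) ` A y. 0 \<le> inner (x - y) (u - v)"
  have "u + c \<in> A x"
  proof (rule maximal_monotone_opD[OF A])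
    fix y v assume "v \<in> A y"
    then have "0 \<le> inner (x - y) (u - (v - c))" using * by blast
    then show "0 \<le> inner (x - y) (u + c - v)" by (simp add: algebra_simps)
  qed
  then show "u \<in> (\<lambda>a. a - c) ` A x" by force
qed

text \<open>
  Surjectivity of \<open>I + k (A + D + \<omega> I)\<close> for small \<open>k > 0\<close>, obtained from the contraction
  principle, yields maximality.
\<close>

lemma maximal_monotone_op_lipschitz_perturbation:
  fixes A :: "'h::{real_inner, complete_space} \<Rightarrow> 'h set"
  assumes A: "maximal_monotone_op A" and D: "\<omega>-lipschitz_on UNIV D"
  shows "maximal_monotone_op (\<lambda>x. (\<lambda>a. a + D x + \<omega> *\<^sub>R x) ` A x)"
    (is "maximal_monotone_op ?G")
  unfolding maximal_monotone_op_iff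
proof (intro conjI allI impI)
  have \<omega>: "\<omega> \<ge> 0" using D by (rule lipschitz_on_nonneg)
  show "monotone_op ?G"
    unfolding monotone_op_def
  proof (intro allI ballI)
    fix x y u v assume "u \<in> ?G x" "v \<in> ?G y"
    then obtain a b where ab: "a \<in> A x" "b \<in> A y"
      and uv: "u = a + D x + \<omega> *\<^sub>R x" "v = b + D y + \<omega> *\<^sub>R y" by blast
    have "\<bar>inner (x - y) (D x - D y)\<bar> \<le> norm (x - y) * (\<omega> * norm (x - y))"
      using Cauchy_Schwarz_ineq2[of "x - y" "D x - D y"] lipschitz_onD[OF D, of x y]
      by (smt (verit) UNIV_I dist_norm mult_left_mono norm_ge_zero)
    then have "0 \<le> inner (x - y) (D x - D y) + \<omega> * inner (x - y) (x - y)"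
      unfolding power2_norm_eq_inner[symmetric] power2_eq_square by (simp add: mult_ac)
    moreover have "0 \<le> inner (x - y) (a - b)"
      using graph_monotone[OF A ab] .
    ultimately show "0 \<le> inner (x - y) (u - v)"
      unfolding uv by (simp add: algebra_simps)
  qed
  fix x u assume *: "\<forall>y. \<forall>v\<in>?G y. 0 \<le> inner (x - y) (u - v)"
  \<comment> \<open>D + \<omega> I has Lipschitz constant 2 * \<omega>, so this k makes H below a
    contraction with factor 1/2; the summand 1 covers \<omega> = 0.\<close>
  define k where "k = 1 / (4 * \<omega> + 1)"
  have k: "k > 0" "k * (2 * \<omega>) \<le> 1 / 2" using \<omega> by (auto simp: k_def field_simps)
  define z where "z = x + k *\<^sub>R u"
  define H where "H y = z - k *\<^sub>R (D y + \<omega> *\<^sub>R y)" for y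
  \<comment> \<open>J is the resolvent of A after H; a fixed point y solves y + k v = z for some v
    in \<open>?G y\<close>, and z is built from the given pair (x, u).\<close>
  define J where "J y = H y - k *\<^sub>R yosida A k (H y)" for y
  have H: "norm (H y - H y') \<le> 1 / 2 * norm (y - y')" for y y'
  proof -
    have "H y - H y' = k *\<^sub>R ((D y' - D y) + \<omega> *\<^sub>R (y' - y))"
      unfolding H_def by (simp add: algebra_simps)
    then have "norm (H y - H y') = k * norm ((D y' - D y) + \<omega> *\<^sub>R (y' - y))"
      using k by simp
    also have "\<dots> \<le> k * (\<omega> * norm (y - y') + \<omega> * norm (y - y'))"
      using k \<omega> lipschitz_onD[OF D, of y' y]
      by (intro mult_left_mono order_trans[OF norm_triangle_ineq] add_mono)
         (auto simp: dist_norm norm_minus_commute)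
    also have "\<dots> = k * (2 * \<omega>) * norm (y - y')" by simp
    also have "\<dots> \<le> 1 / 2 * norm (y - y')" using k by (intro mult_right_mono) auto
    finally show ?thesis .
  qed
  have "\<exists>!y. J y = y"
  proof (rule banach_fix_type[of "1 / 2"])
    have "dist (J y) (J y') \<le> 1 / 2 * dist y y'" for y y'
      using resolvent_nonexpansive[OF A k(1), of "H y" "H y'"] H[of y y']
      unfolding J_def dist_norm by linarith
    then show "\<forall>y y'. dist (J y) (J y') \<le> 1 / 2 * dist y y'" by blast
  qed auto
  then obtain y where y: "J y = y" by blast
  define a where "a = yosida A k (H y)"
  have "a \<in> A y"
    using yosida_mem[OF A k(1), of "H y"] y unfolding J_def a_def by simp
  define v where "v = a + D y + \<omega> *\<^sub>R y"
  have v: "v \<in> ?G y" using \<open>a \<in> A y\<close> by (auto simp: v_def)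
  have "y + k *\<^sub>R v = x + k *\<^sub>R u"
  proof -
    have "H y - k *\<^sub>R a = y" using y by (simp add: J_def a_def)
    then show ?thesis unfolding H_def z_def v_def by (simp add: algebra_simps)
  qed
  \<comment> \<open>Hence inner (x - y) (u - v) = - k |u - v|^2, and the assumed sign forces u = v,
    then x = y.\<close>
  then have xy: "x - y = k *\<^sub>R (v - u)" by (simp add: algebra_simps)
  have "0 \<le> inner (x - y) (u - v)" using * v by blast
  also have "\<dots> = - (k * inner (u - v) (u - v))"
    unfolding xy by (simp add: algebra_simps inner_commute)
  finally have "inner (u - v) (u - v) \<le> 0" using k by (simp add: mult_le_0_iff)
  then have "u = v" by (metis eq_iff_diff_eq_0 inner_eq_zero_iff inner_ge_zero order_antisym)
  moreover from this xy have "x = y" by simp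
  ultimately show "u \<in> ?G x" using v by simp
qed

section \<open>Expectations in nonseparable Hilbert spaces\<close>

text \<open>In a nonseparable range a difference of measurable functions need not be measurable.
  Here s takes finitely many values, so the space splits into finitely many measurable pieces on
  each of which a constant is subtracted.\<close>

lemma borel_measurable_norm_diff_simple:
  assumes f: "f \<in> borel_measurable M" and s: "simple_function M s"
  shows "(\<lambda>x. norm (f x - s x :: 'a::real_normed_vector)) \<in> borel_measurable M"
proof (rule measurable_compose_countable'[where I = "s ` space M" and g = s and f = "\<lambda>i x. norm (f x - i)"])
  fix i
  show "(\<lambda>x. norm (f x - i)) \<in> borel_measurable M"
    by (intro measurable_compose[OF f] borel_measurable_continuous_onI continuous_intros)
next
  show "s \<in> measurable M (count_space (s ` space M))"
    using s by (subst measurable_count_space_eq2) (auto simp: simple_function_def)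
  show "countable (s ` space M)"
    using s by (simp add: simple_function_def countable_finite)
qed

text \<open>Reduction to real integrals: inner e is linear and bounded, so it carries the simple
  functions approximating f to ones approximating inner e (f \<xi>), with the L1 error multiplied by
  at most norm e.\<close>

lemma has_expectation_inner:
  fixes f :: "'b \<Rightarrow> 'a::real_inner"
  assumes "has_expectation M f v"
  shows "has_bochner_integral M (\<lambda>\<xi>. inner e (f \<xi>)) (inner e v)"
  using assms
proof cases
  case (1 s)
  have s: "simple_function M (s i)" for i
    using 1(2)[of i] by (auto elim: simple_bochner_integrable.cases)
  show ?thesis
  proof (rule has_bochner_integral.intros)
    show "(\<lambda>\<xi>. inner e (f \<xi>)) \<in> borel_measurable M"
      by (intro measurable_compose[OF 1(1)] borel_measurable_continuous_onI continuous_intros)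
    show "Bochner_Integration.simple_bochner_integrable M (\<lambda>\<xi>. inner e (s i \<xi>))" for i
      using 1(2)[of i] by (rule simple_bochner_integrable_compose2[of "\<lambda>x y. inner e x", OF inner_zero_right])
        (use 1(2)[of i] in auto)
    show "(\<lambda>i. \<integral>\<^sup>+ \<xi>. norm (inner e (f \<xi>) - inner e (s i \<xi>)) \<partial>M) \<longlonglongrightarrow> 0"
    proof (rule tendsto_sandwich[OF _ _ tendsto_const])
      show "(\<lambda>i. ennreal (norm e) * (\<integral>\<^sup>+ \<xi>. norm (f \<xi> - s i \<xi>) \<partial>M)) \<longlonglongrightarrow> 0"
        using ennreal_tendsto_cmult[OF _ 1(3), of "norm e"] by simp
      show "\<forall>\<^sub>F i in sequentially. (\<integral>\<^sup>+ \<xi>. norm (inner e (f \<xi>) - inner e (s i \<xi>)) \<partial>M)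
          \<le> ennreal (norm e) * (\<integral>\<^sup>+ \<xi>. norm (f \<xi> - s i \<xi>) \<partial>M)"
      proof (intro always_eventually allI)
        fix i
        have "(\<integral>\<^sup>+ \<xi>. norm (inner e (f \<xi>) - inner e (s i \<xi>)) \<partial>M)
            \<le> (\<integral>\<^sup>+ \<xi>. ennreal (norm e) * norm (f \<xi> - s i \<xi>) \<partial>M)"
          by (intro nn_integral_mono)
             (auto simp: inner_diff_right[symmetric] ennreal_mult[symmetric] Cauchy_Schwarz_ineq2)
        also have "\<dots> = ennreal (norm e) * (\<integral>\<^sup>+ \<xi>. norm (f \<xi> - s i \<xi>) \<partial>M)"
          using borel_measurable_norm_diff_simple[OF 1(1) s[of i]] by (intro nn_integral_cmult) auto
        finally show "(\<integral>\<^sup>+ \<xi>. norm (inner e (f \<xi>) - inner e (s i \<xi>)) \<partial>M)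
          \<le> ennreal (norm e) * (\<integral>\<^sup>+ \<xi>. norm (f \<xi> - s i \<xi>) \<partial>M)" .
      qed
    qed simp
    have "linear (inner e)"
      by (rule bounded_linear.linear[OF bounded_linear_inner_right])
    then show "(\<lambda>i. Bochner_Integration.simple_bochner_integral M (\<lambda>\<xi>. inner e (s i \<xi>))) \<longlonglongrightarrow> inner e v"
      using simple_bochner_integral_linear[OF _ 1(2), of "inner e"] tendsto_inner[OF tendsto_const 1(4), of e]
      by simp
  qed
qed

lemma has_expectation_unique:
  fixes f :: "'b \<Rightarrow> 'a::real_inner"
  assumes "has_expectation M f v" "has_expectation M f w"
  shows "v = w"
proof -
  have "inner (v - w) v = inner (v - w) w"
    using has_bochner_integral_eq[OF has_expectation_inner has_expectation_inner] assms by blast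
  then have "inner (v - w) (v - w) = 0" by (simp add: inner_diff_right)
  then show ?thesis by simp
qed

lemma has_expectation_expect:
  fixes f :: "'b \<Rightarrow> 'a::real_inner"
  assumes "has_expectation M f v"
  shows "has_expectation M f (expect M f)"
  using assms has_expectation_unique[of M f] unfolding expect_def by (auto intro: theI)

text \<open>
  The simple functions \<open>f \<circ> F i\<close>, with \<open>F i\<close> simple maps converging to the identity of the
  separable space \<open>'b\<close>, approximate \<open>f\<close> even when its range space is not separable.
\<close>

lemma has_expectation_continuous:
  fixes f :: "'b::polish_space \<Rightarrow> 'h::{real_normed_vector, complete_space}"
  assumes M: "finite_measure M" "sets M = sets borel"
    and f: "continuous_on UNIV f"
    and bound: "\<And>\<xi>. norm (f \<xi>) \<le> a + b * dist \<xi> z" and ab: "a \<ge> 0" "b \<ge> 0"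
    and int: "integrable M (\<lambda>\<xi>. dist \<xi> z)"
  shows "\<exists>v. has_expectation M f v"
proof -
  interpret finite_measure M by fact
  note M(2)[measurable_cong]
  have [simp]: "space M = UNIV" using sets_eq_imp_space_eq[OF M(2)] by simp
  have "(\<lambda>\<xi>. \<xi>) \<in> borel_measurable M" by measurable
  from borel_measurable_implies_sequence_metric[OF this, of z]
  obtain F where F: "\<And>i. simple_function M (F i)" "\<And>\<xi>. (\<lambda>i. F i \<xi>) \<longlonglongrightarrow> \<xi>"
    "\<And>i \<xi>. dist (F i \<xi>) z \<le> 2 * dist \<xi> z"
    by auto
  have [measurable]: "F i \<in> borel_measurable M" for i
    using F(1) by (rule borel_measurable_simple_function)
  define s where "s i \<xi> = f (F i \<xi>)" for i \<xi>
  have s: "simple_function M (s i)" for i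
    unfolding s_def by (rule simple_function_compose1[OF F(1)])
  have sb: "Bochner_Integration.simple_bochner_integrable M (s i)" for i
    using s by (intro simple_bochner_integrable.intros) auto
  define d where "d i \<xi> = norm (f \<xi> - s i \<xi>)" for i \<xi>
  have fm: "f \<in> borel_measurable M"
    using borel_measurable_continuous_onI[OF f] M(2) measurable_cong_sets by blast
  have [measurable]: "d i \<in> borel_measurable M" for i
    unfolding d_def by (rule borel_measurable_norm_diff_simple[OF fm s])
  \<comment> \<open>Dominating function: as dist (F i \<xi>) z <= 2 * dist \<xi> z, the two terms f
    and f o F i together cost a + a and b + 2 * b.\<close>
  define w where "w \<xi> = 2 * a + 3 * b * dist \<xi> z" for \<xi>
  have w: "integrable M w" unfolding w_def using int by auto
  have dw: "d i \<xi> \<le> w \<xi>" for i \<xi>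
  proof -
    have "d i \<xi> \<le> norm (f \<xi>) + norm (f (F i \<xi>))" unfolding d_def s_def by (rule norm_triangle_ineq4)
    also have "\<dots> \<le> (a + b * dist \<xi> z) + (a + b * dist (F i \<xi>) z)" by (intro add_mono bound)
    also have "\<dots> \<le> (a + b * dist \<xi> z) + (a + b * (2 * dist \<xi> z))"
      using ab by (intro add_mono mult_left_mono F) auto
    finally show ?thesis by (simp add: w_def)
  qed
  have d0: "0 \<le> d i \<xi>" for i \<xi> by (simp add: d_def)
  have di: "integrable M (d i)" for i
    using dw d0 by (intro Bochner_Integration.integrable_bound[OF w]) (auto simp: d0 intro: order_trans[OF _ abs_ge_self])
  have "(\<lambda>i. integral\<^sup>L M (d i)) \<longlonglongrightarrow> integral\<^sup>L M (\<lambda>\<xi>. 0)"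
  proof (rule integral_dominated_convergence[OF _ _ w])
    have "(\<lambda>i. d i \<xi>) \<longlonglongrightarrow> 0" for \<xi>
    proof -
      have "(\<lambda>i. f (F i \<xi>)) \<longlonglongrightarrow> f \<xi>"
        by (rule continuous_on_tendsto_compose[OF f F(2)]) auto
      from tendsto_norm[OF tendsto_diff[OF tendsto_const[of "f \<xi>"] this]]
      show ?thesis unfolding d_def s_def by simp
    qed
    then show "AE \<xi> in M. (\<lambda>i. d i \<xi>) \<longlonglongrightarrow> 0" by simp
  qed (use d0 dw in auto)
  then have lim: "(\<lambda>i. integral\<^sup>L M (d i)) \<longlonglongrightarrow> 0" by simp
  have nn: "(\<integral>\<^sup>+ \<xi>. norm (f \<xi> - s i \<xi>) \<partial>M) = ennreal (integral\<^sup>L M (d i))" for i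
    using nn_integral_eq_integral[OF di[of i]] d0 unfolding d_def by simp
  \<comment> \<open>Through f, two simple integrals differ by at most the sum of the L1 distances to
    f, so they form a Cauchy sequence.\<close>
  have le: "norm (Bochner_Integration.simple_bochner_integral M (s n) - Bochner_Integration.simple_bochner_integral M (s k))
      \<le> integral\<^sup>L M (d n) + integral\<^sup>L M (d k)" for n k
  proof -
    have sd: "Bochner_Integration.simple_bochner_integrable M (\<lambda>x. norm (s n x - s k x))"
      using simple_bochner_integrable_compose2[of "\<lambda>x y. norm (x - y)" M "s n" "s k"] sb by auto
    have "norm (Bochner_Integration.simple_bochner_integral M (s n) - Bochner_Integration.simple_bochner_integral M (s k))
        = norm (Bochner_Integration.simple_bochner_integral M (\<lambda>x. s n x - s k x))"
      using sb by (subst simple_bochner_integral_diff) auto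
    also have "\<dots> \<le> Bochner_Integration.simple_bochner_integral M (\<lambda>x. norm (s n x - s k x))"
      using simple_bochner_integrable_compose2[of "(-)" M "s n" "s k"] sb
      by (auto intro!: simple_bochner_integral_norm_bound)
    finally have "ennreal (norm (Bochner_Integration.simple_bochner_integral M (s n) - Bochner_Integration.simple_bochner_integral M (s k)))
        \<le> (\<integral>\<^sup>+ \<xi>. norm (s n \<xi> - s k \<xi>) \<partial>M)"
      using simple_bochner_integral_eq_nn_integral[OF sd] ennreal_leI by (metis norm_ge_zero)
    also have "\<dots> \<le> (\<integral>\<^sup>+ \<xi>. ennreal (d n \<xi> + d k \<xi>) \<partial>M)"
      unfolding d_def
      by (intro nn_integral_mono ennreal_leI) (metis dist_norm dist_triangle2 dist_commute)
    also have "\<dots> = ennreal (integral\<^sup>L M (\<lambda>\<xi>. d n \<xi> + d k \<xi>))"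
      using di d0 by (intro nn_integral_eq_integral) auto
    also have "\<dots> = ennreal (integral\<^sup>L M (d n) + integral\<^sup>L M (d k))"
      using di by simp
    finally show ?thesis
      using d0 by (subst (asm) ennreal_le_iff) (auto intro!: add_nonneg_nonneg integral_nonneg_AE)
  qed
  have "Cauchy (\<lambda>i. Bochner_Integration.simple_bochner_integral M (s i))"
  proof (rule metric_CauchyI)
    fix e :: real assume "e > 0"
    then obtain N where N: "\<And>n. n \<ge> N \<Longrightarrow> norm (integral\<^sup>L M (d n) - 0) < e / 2"
      using LIMSEQ_D[OF lim, of "e / 2"] by auto
    have "dist (Bochner_Integration.simple_bochner_integral M (s n)) (Bochner_Integration.simple_bochner_integral M (s k)) < e"
      if "n \<ge> N" "k \<ge> N" for n k
      using le[of n k] N[OF that(1)] N[OF that(2)] unfolding dist_norm by simp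
    then show "\<exists>K. \<forall>m\<ge>K. \<forall>n\<ge>K. dist (Bochner_Integration.simple_bochner_integral M (s m)) (Bochner_Integration.simple_bochner_integral M (s n)) < e"
      by blast
  qed
  then obtain v where "(\<lambda>i. Bochner_Integration.simple_bochner_integral M (s i)) \<longlonglongrightarrow> v"
    by (meson Cauchy_convergent convergent_def)
  moreover have "(\<lambda>i. ennreal (integral\<^sup>L M (d i))) \<longlonglongrightarrow> ennreal 0"
    using lim by (rule tendsto_ennrealI)
  ultimately show ?thesis
    using sb fm nn by (intro exI[of _ v] has_expectation.intros[of _ _ s]) auto
qed

lemma expect_continuous_inner:
  fixes f :: "'b::polish_space \<Rightarrow> 'h::{real_inner, complete_space}"
  assumes "finite_measure M" "sets M = sets borel" "continuous_on UNIV f"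
    and "\<And>\<xi>. norm (f \<xi>) \<le> a + b * dist \<xi> z" "a \<ge> 0" "b \<ge> 0" "integrable M (\<lambda>\<xi>. dist \<xi> z)"
  shows "has_bochner_integral M (\<lambda>\<xi>. inner e (f \<xi>)) (inner e (expect M f))"
  using has_expectation_continuous[OF assms] has_expectation_expect has_expectation_inner by blast

text \<open>For the unit vector e along the difference of the expectations, inner e (f \<xi>) /
  \<beta> is an admissible 1-Lipschitz test function for \<open>W1\<close>, and its two integrals
  differ by the norm sought, divided by \<beta>.\<close>

lemma norm_expect_diff_le_W1:
  fixes f :: "'b::polish_space \<Rightarrow> 'h::{real_inner, complete_space}"
  assumes M: "prob_measure_finite_first_moment M" and N: "prob_measure_finite_first_moment N"
    and f: "\<beta>-lipschitz_on UNIV f" and "\<beta> > 0" and W: "W1 M N \<le> ereal K"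
  shows "norm (expect M f - expect N f) \<le> \<beta> * K"
proof (cases "expect M f = expect N f")
  case True
  \<comment> \<open>There is no direction e in this case; the claim reduces to K >= 0, read off from
    the test function 0.\<close>
  have "ereal 0 \<le> W1 M N"
    unfolding W1_def by (rule SUP_upper2[of "\<lambda>_. 0"]) (auto simp: lipschitz_on_def)
  with W have "0 \<le> K" by (metis ereal_less_eq(3) order_trans)
  then show ?thesis using True \<open>\<beta> > 0\<close> by simp
next
  case False
  define D where "D = expect M f - expect N f"
  define e where "e = D /\<^sub>R norm D"
  have e: "norm e = 1" using False by (simp add: e_def D_def)
  obtain z :: 'b where "z \<in> UNIV" by blast
  have bound: "norm (f \<xi>) \<le> norm (f z) + \<beta> * dist \<xi> z" for \<xi>
    using lipschitz_onD[OF f, of \<xi> z] norm_triangle_sub[of "f \<xi>" "f z"] by (simp add: dist_norm)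
  have *: "has_bochner_integral M' (\<lambda>\<xi>. inner e (f \<xi>)) (inner e (expect M' f))"
    if M': "prob_measure_finite_first_moment M'" for M' :: "'b measure"
    using M' bound \<open>\<beta> > 0\<close> lipschitz_on_continuous_on[OF f]
    unfolding prob_measure_finite_first_moment_def
    by (intro expect_continuous_inner[of _ _ "norm (f z)" \<beta> z]) (auto simp: prob_space_def)
  define h where "h \<xi> = inner e (f \<xi>) / \<beta>" for \<xi>
  have int: "integral\<^sup>L M' h = inner e (expect M' f) / \<beta>"
    if "prob_measure_finite_first_moment M'" for M' :: "'b measure"
    using has_bochner_integral_integral_eq[OF *[OF that]] unfolding h_def by simp
  have "1-lipschitz_on UNIV h"
  proof (rule lipschitz_onI)
    fix \<xi> \<zeta>
    have "\<bar>inner e (f \<xi> - f \<zeta>)\<bar> \<le> \<beta> * dist \<xi> \<zeta>"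
      using Cauchy_Schwarz_ineq2[of e "f \<xi> - f \<zeta>"] lipschitz_onD[OF f, of \<xi> \<zeta>] e by (simp add: dist_norm)
    then show "dist (h \<xi>) (h \<zeta>) \<le> 1 * dist \<xi> \<zeta>"
      using \<open>\<beta> > 0\<close>
      by (simp add: h_def dist_real_def inner_diff_right diff_divide_distrib[symmetric] pos_divide_le_eq mult.commute)
  qed simp
  then have "ereal \<bar>integral\<^sup>L M h - integral\<^sup>L N h\<bar> \<le> W1 M N"
    unfolding W1_def by (intro SUP_upper) simp
  then have "\<bar>integral\<^sup>L M h - integral\<^sup>L N h\<bar> \<le> K"
    using W by (meson ereal_less_eq(3) order_trans)
  moreover have "integral\<^sup>L M h - integral\<^sup>L N h = inner e D / \<beta>"
    using int M N by (simp add: D_def inner_diff_right diff_divide_distrib)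
  moreover have "inner e D = norm D"
    using False by (simp add: e_def D_def power2_norm_eq_inner[symmetric] power2_eq_square)
  ultimately show ?thesis
    using \<open>\<beta> > 0\<close> by (simp add: D_def[symmetric] divide_le_eq mult.commute)
qed

section \<open>Lipschitz differential equations\<close>

text \<open>
  The sort \<open>{real_inner, complete_space}\<close> is not below the class \<open>banach\<close>, so the library integral
  of vector-valued functions is not available; \<open>expect\<close> takes its place.
\<close>

lemma exists_weak_integral:
  fixes f :: "real \<Rightarrow> 'h::{real_inner, complete_space}"
  assumes f: "continuous_on {0..} f" and "t \<ge> 0"
  shows "\<exists>p. \<forall>e. inner e p = integral {0..t} (\<lambda>s. inner e (f s))"
proof -
  \<comment> \<open>Clamping s to [0, t] makes f bounded and continuous on the whole line without
    changing it on [0, t], where M is concentrated; the expectation under M is then the integral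
    over [0, t].\<close>
  define g where "g s = f (max 0 (min t s))" for s
  define M where "M = density lborel (\<lambda>s. ennreal (indicator {0..t} s))"
  have g: "continuous_on UNIV g"
    unfolding g_def using \<open>t \<ge> 0\<close>
    by (intro continuous_on_compose2[OF f] continuous_intros) auto
  have "bounded (f ` {0..t})"
    using f by (intro compact_imp_bounded compact_continuous_image continuous_on_subset[OF f]) auto
  then obtain a where a: "\<And>s. s \<in> {0..t} \<Longrightarrow> norm (f s) \<le> a" "a > 0"
    unfolding bounded_pos by blast
  have M: "finite_measure M"
    unfolding M_def by (rule finite_measureI) (use \<open>t \<ge> 0\<close> in \<open>simp add: ennreal_indicator emeasure_density\<close>)
  have "integrable M (\<lambda>s. dist s 0)"
    unfolding M_def
    using borel_integrable_compact[of "{0..t}" "\<lambda>s. \<bar>s\<bar>", OF _ continuous_on_rabs[OF continuous_on_id]]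
    by (subst integrable_density) auto
  then have *: "has_bochner_integral M (\<lambda>s. inner e (g s)) (inner e (expect M g))" for e
    using a \<open>t \<ge> 0\<close>
    by (intro expect_continuous_inner[OF M _ g, of a 0 0]) (auto simp: M_def g_def less_imp_le)
  have "inner e (expect M g) = integral {0..t} (\<lambda>s. inner e (f s))" for e
  proof -
    have int: "set_integrable lborel {0..t} (\<lambda>s. inner e (f s))"
      unfolding set_integrable_def
      by (intro borel_integrable_compact continuous_intros continuous_on_subset[OF f]) auto
    have "inner e (expect M g) = integral\<^sup>L M (\<lambda>s. inner e (g s))"
      using has_bochner_integral_integral_eq[OF *] by simp
    also have "\<dots> = integral\<^sup>L lborel (\<lambda>s. indicator {0..t} s *\<^sub>R inner e (g s))"
      unfolding M_def
    proof (subst integral_density[where g = "indicator {0..t}", symmetric])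
      show "(\<lambda>s. inner e (g s)) \<in> borel_measurable lborel"
        using g by (auto intro!: borel_measurable_continuous_onI continuous_intros)
    qed auto
    also have "\<dots> = (LBINT s:{0..t}. inner e (f s))"
      unfolding set_lebesgue_integral_def
      by (intro Bochner_Integration.integral_cong) (auto simp: indicator_def g_def)
    also have "\<dots> = integral {0..t} (\<lambda>s. inner e (f s))"
      by (rule set_borel_integral_eq_integral(2)[OF int])
    finally show ?thesis .
  qed
  then show ?thesis by blast
qed

text \<open>P t is known only through its inner products. Testing the error P b - P a - (b - a) y
  against itself turns them into a norm bound, and continuity of f then gives the
  derivative.\<close>

lemma exists_primitive:
  fixes f :: "real \<Rightarrow> 'h::{real_inner, complete_space}"
  assumes f: "continuous_on {0..} f"
  obtains P where "P 0 = 0" "\<And>t. t \<ge> 0 \<Longrightarrow> (P has_vector_derivative f t) (at t within {0..})"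
proof -
  obtain P where P: "\<And>t e. t \<ge> 0 \<Longrightarrow> inner e (P t) = integral {0..t} (\<lambda>s. inner e (f s))"
    using exists_weak_integral[OF f] by metis
  have int: "(\<lambda>s. inner e (f s)) integrable_on {a..b}" if "0 \<le> a" for a b e
    using that by (intro integrable_continuous_real continuous_intros continuous_on_subset[OF f]) auto
  have bound: "norm (P b - P a - (b - a) *\<^sub>R y) \<le> e * (b - a)"
    if "0 \<le> a" "a \<le> b" "\<And>s. s \<in> {a..b} \<Longrightarrow> norm (f s - y) \<le> e" for a b e y
  proof -
    let ?d = "P b - P a - (b - a) *\<^sub>R y"
    have "integral {0..b} (\<lambda>s. inner ?d (f s))
      = integral {0..a} (\<lambda>s. inner ?d (f s)) + integral {a..b} (\<lambda>s. inner ?d (f s))"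
      using that int[of 0 ?d b] by (simp add: Henstock_Kurzweil_Integration.integral_combine)
    then have "inner ?d ?d = integral {a..b} (\<lambda>s. inner ?d (f s)) - (b - a) * inner ?d y"
      using that by (simp add: inner_diff_right P)
    also have "\<dots> = integral {a..b} (\<lambda>s. inner ?d (f s - y))"
      unfolding inner_diff_right using int[OF that(1)] that
      by (subst Henstock_Kurzweil_Integration.integral_diff) auto
    also have "\<dots> \<le> (norm ?d * e) * (b - a)"
    proof -
      have "inner ?d (f s - y) \<le> norm ?d * e" if "s \<in> {a..b}" for s
        using norm_cauchy_schwarz[of ?d "f s - y"] \<open>\<And>s. s \<in> {a..b} \<Longrightarrow> norm (f s - y) \<le> e\<close>[OF that]
        by (meson mult_left_mono norm_ge_zero order_trans)
      moreover have "(\<lambda>s. inner ?d (f s - y)) integrable_on {a..b}"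
        unfolding inner_diff_right by (intro integrable_diff int that integrable_const_ivl)
      ultimately have "integral {a..b} (\<lambda>s. inner ?d (f s - y)) \<le> integral {a..b} (\<lambda>s. norm ?d * e)"
        by (intro integral_le) auto
      then show ?thesis using that by (simp add: mult_ac)
    qed
    finally have "norm ?d * norm ?d \<le> norm ?d * (e * (b - a))"
      by (simp add: power2_norm_eq_inner[symmetric] power2_eq_square mult_ac)
    moreover have "0 \<le> e" using order_trans[OF norm_ge_zero that(3)[of a]] that(2) by simp
    ultimately show ?thesis using that by (cases "?d = 0") auto
  qed
  have "(P has_vector_derivative f t) (at t within {0..})" if "t \<ge> 0" for t
    unfolding has_vector_derivative_def has_derivative_within_alt
  proof (intro conjI allI impI)
    fix e :: real assume "e > 0"
    obtain d where d: "d > 0" "\<And>s. s \<in> {0..} \<Longrightarrow> dist s t < d \<Longrightarrow> dist (f s) (f t) < e"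
      using f[unfolded continuous_on_iff, rule_format, of t e] \<open>e > 0\<close> \<open>t \<ge> 0\<close> by auto
    have "norm (P s - P t - (s - t) *\<^sub>R f t) \<le> e * norm (s - t)" if s: "s \<ge> 0" "norm (s - t) < d" for s
    proof (cases "t \<le> s")
      case True
      have "norm (P s - P t - (s - t) *\<^sub>R f t) \<le> e * (s - t)"
        using s True \<open>t \<ge> 0\<close> d(2) by (intro bound) (auto simp: dist_norm less_imp_le)
      then show ?thesis using True by simp
    next
      case False
      have "norm (P t - P s - (t - s) *\<^sub>R f t) \<le> e * (t - s)"
        using s False \<open>t \<ge> 0\<close> d(2) by (intro bound) (auto simp: dist_norm less_imp_le)
      moreover have "norm (P t - P s - (t - s) *\<^sub>R f t) = norm (P s - P t - (s - t) *\<^sub>R f t)"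
        by (subst norm_minus_cancel[symmetric]) (simp add: algebra_simps)
      ultimately show ?thesis using False by simp
    qed
    then show "\<exists>d>0. \<forall>s\<in>{0..}. norm (s - t) < d \<longrightarrow> norm (P s - P t - (s - t) *\<^sub>R f t) \<le> e * norm (s - t)"
      using \<open>d > 0\<close> by auto
  qed (rule bounded_linear_scaleR_left)
  moreover have "P 0 = 0" using P[of 0 "P 0"] by simp
  ultimately show thesis using that by blast
qed

text \<open>Integrating exp (K * s) gains the factor 1 / K, which makes the Picard map a contraction
  in the weighted norm.\<close>

lemma norm_diff_primitives_le_exp:
  fixes P Q :: "real \<Rightarrow> 'h::real_normed_vector"
  assumes P: "\<And>t. t \<ge> 0 \<Longrightarrow> (P has_vector_derivative p t) (at t within {0..})"
    and Q: "\<And>t. t \<ge> 0 \<Longrightarrow> (Q has_vector_derivative q t) (at t within {0..})"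
    and "P 0 = Q 0" and "K > 0" "C \<ge> 0"
    and le: "\<And>t. t \<ge> 0 \<Longrightarrow> norm (p t - q t) \<le> C * exp (K * t)" and "t \<ge> 0"
  shows "norm (P t - Q t) \<le> C / K * exp (K * t)"
proof (cases "t = 0")
  case True
  then show ?thesis using \<open>P 0 = Q 0\<close> \<open>K > 0\<close> \<open>C \<ge> 0\<close> by simp
next
  case False
  then have "0 < t" using \<open>t \<ge> 0\<close> by simp
  have at: "at x within {0..} = at x" if "0 < x" for x :: real
    using that by (intro at_within_interior) simp
  have "norm ((P t - Q t) - (P 0 - Q 0)) \<le> C / K * exp (K * t) - C / K * exp (K * 0)"
  proof (rule differentiable_bound_general[OF \<open>0 < t\<close>])
    have "((\<lambda>s. P s - Q s) has_vector_derivative p s - q s) (at s within {0..t})" if "s \<in> {0..t}" for s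
      using has_vector_derivative_within_subset[OF has_vector_derivative_diff[OF P[of s] Q[of s]], of "{0..t}"] that
      by auto
    then show "continuous_on {0..t} (\<lambda>s. P s - Q s)"
      by (rule continuous_on_vector_derivative)
    show "((\<lambda>s. P s - Q s) has_vector_derivative p s - q s) (at s)" if "0 < s" for s
      using has_vector_derivative_diff[OF P[of s] Q[of s]] that at[OF that] by simp
    show "((\<lambda>s. C / K * exp (K * s)) has_vector_derivative C * exp (K * s)) (at s)" for s
    proof -
      have "((\<lambda>s. C / K * exp (K * s)) has_real_derivative C * exp (K * s)) (at s)"
        using \<open>K > 0\<close> by (auto intro!: derivative_eq_intros)
      then show ?thesis by (simp add: has_real_derivative_iff_has_vector_derivative)
    qed
    show "norm (p s - q s) \<le> C * exp (K * s)" if "0 < s" for s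
      using le that by simp
  qed (use \<open>K > 0\<close> in \<open>auto intro!: continuous_intros\<close>)
  moreover have "0 \<le> C / K" using \<open>K > 0\<close> \<open>C \<ge> 0\<close> by simp
  ultimately show ?thesis using \<open>P 0 = Q 0\<close> by simp
qed

text \<open>
  Picard's fixed point argument in the norm \<open>sup\<^sub>t exp (- K t) \<bar>u t\<bar>\<close>: a bounded continuous
  \<open>v\<close> represents \<open>u t = exp (K t) v t\<close>.
\<close>

theorem Picard_Lindeloef_global:
  fixes f :: "'h \<Rightarrow> 'h::{real_inner, complete_space}"
  assumes f: "L-lipschitz_on UNIV f"
  obtains u where "u 0 = x0" "\<And>t. t \<ge> 0 \<Longrightarrow> (u has_vector_derivative f (u t)) (at t within {0..})"
proof -
  \<comment> \<open>Chosen so that the contraction factor L / K is at most 1/2, with K > 0 even if L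
    = 0.\<close>
  define K where "K = 2 * L + 1"
  have "L \<ge> 0" using f by (rule lipschitz_on_nonneg)
  then have K: "K > 0" "L / K \<le> 1 / 2" by (simp_all add: K_def pos_divide_le_eq)
  have fc: "continuous_on UNIV f" using f by (rule lipschitz_on_continuous_on)
  define U where "U v t = exp (K * t) *\<^sub>R apply_bcontfun v t" for v :: "real \<Rightarrow>\<^sub>C 'h" and t
  have Uc: "continuous_on {0..} (\<lambda>t. f (U v t))" for v
  proof (rule continuous_on_compose2[OF fc])
    have "continuous_on {0..} (apply_bcontfun v)"
      using continuous_on_apply_bcontfun continuous_on_subset by blast
    then show "continuous_on {0..} (U v)"
      unfolding U_def by (intro continuous_intros)
  qed simp
  have "\<exists>P. P 0 = 0 \<and> (\<forall>t\<ge>0. (P has_vector_derivative f (U v t)) (at t within {0..}))" for v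
    by (rule exists_primitive[OF Uc[of v]]) blast
  then obtain P where P0: "\<And>v. P v 0 = 0"
    and P: "\<And>v t. t \<ge> 0 \<Longrightarrow> (P v has_vector_derivative f (U v t)) (at t within {0..})"
    by metis
  \<comment> \<open>The Picard map written for v instead of u = exp (K t) v. Elements of the
    complete function space live on the whole line, hence the constant extension by max 0 t to
    negative times.\<close>
  define \<Phi> where "\<Phi> v t = exp (- K * max 0 t) *\<^sub>R (x0 + P v (max 0 t))" for v t
  have f_dist: "norm (f (U v t) - f (U w t)) \<le> L * dist v w * exp (K * t)" for v w t
  proof -
    have "norm (f (U v t) - f (U w t)) \<le> L * norm (U v t - U w t)"
      using lipschitz_onD[OF f] by (simp add: dist_norm)
    also have "U v t - U w t = exp (K * t) *\<^sub>R (apply_bcontfun v t - apply_bcontfun w t)"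
      by (simp add: U_def scaleR_diff_right)
    also have "norm \<dots> = exp (K * t) * dist (apply_bcontfun v t) (apply_bcontfun w t)"
      by (simp add: dist_norm)
    also have "L * \<dots> \<le> L * (exp (K * t) * dist v w)"
      using \<open>L \<ge> 0\<close> by (intro mult_left_mono dist_bounded) auto
    finally show ?thesis by (simp add: mult_ac)
  qed
  have P_dist: "norm (P v t - P w t) \<le> L * dist v w / K * exp (K * t)" if "t \<ge> 0" for v w t
  proof (rule norm_diff_primitives_le_exp[OF P P _ \<open>K > 0\<close> _ f_dist that])
    show "P v 0 = P w 0" by (simp add: P0)
    show "0 \<le> L * dist v w" using \<open>L \<ge> 0\<close> by simp
  qed
  have \<Phi>_dist: "dist (\<Phi> v t) (\<Phi> w t) \<le> L / K * dist v w" for v w t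
  proof -
    have "\<Phi> v t - \<Phi> w t = exp (- K * max 0 t) *\<^sub>R (P v (max 0 t) - P w (max 0 t))"
      by (simp add: \<Phi>_def scaleR_diff_right[symmetric])
    then have "dist (\<Phi> v t) (\<Phi> w t) = exp (- K * max 0 t) * norm (P v (max 0 t) - P w (max 0 t))"
      by (simp add: dist_norm)
    also have "\<dots> \<le> exp (- K * max 0 t) * (L * dist v w / K * exp (K * max 0 t))"
      by (intro mult_left_mono P_dist) auto
    also have "\<dots> = (exp (- K * max 0 t) * exp (K * max 0 t)) * (L / K * dist v w)"
      by (simp add: mult_ac)
    also have "exp (- K * max 0 t) * exp (K * max 0 t) = 1"
      by (simp add: mult_exp_exp)
    finally show ?thesis by simp
  qed
  have bc: "\<Phi> v \<in> bcontfun" for v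
  proof (rule bcontfun_normI)
    have Pc: "continuous_on {0..} (P v)"
      using P by (intro continuous_on_vector_derivative) auto
    show "continuous_on UNIV (\<Phi> v)"
      unfolding \<Phi>_def by (intro continuous_intros continuous_on_compose2[OF Pc]) auto
    fix t :: real
    let ?t = "max 0 t" and ?z = "0 :: real \<Rightarrow>\<^sub>C 'h"
    have bd: "norm (f (U v s) - 0) \<le> (norm (f 0) + L * norm v) * exp (K * s)" if "s \<ge> 0" for s
    proof -
      have "norm (f (U v s)) \<le> norm (f 0) + norm (f (U v s) - f (U ?z s))"
        using norm_triangle_sub[of "f (U v s)" "f 0"] by (simp add: U_def)
      also have "\<dots> \<le> norm (f 0) * exp (K * s) + L * norm v * exp (K * s)"
        using f_dist[of v s ?z] K that
        by (intro add_mono) (auto simp: mult_le_cancel_left1)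
      finally show ?thesis by (simp add: algebra_simps)
    qed
    have "norm (P v ?t - 0) \<le> (norm (f 0) + L * norm v) / K * exp (K * ?t)"
    proof (rule norm_diff_primitives_le_exp[OF P has_vector_derivative_const _ \<open>K > 0\<close> _ bd])
      show "P v 0 = 0" by (rule P0)
      show "0 \<le> norm (f 0) + L * norm v" using \<open>L \<ge> 0\<close> by simp
    qed simp_all
    then have "exp (- K * ?t) * norm (x0 + P v ?t)
        \<le> exp (- K * ?t) * (norm x0 * exp (K * ?t) + (norm (f 0) + L * norm v) / K * exp (K * ?t))"
      using K by (intro mult_left_mono order_trans[OF norm_triangle_ineq] add_mono)
        (auto simp: mult_le_cancel_left1)
    also have "\<dots> = (exp (- K * ?t) * exp (K * ?t)) * (norm x0 + (norm (f 0) + L * norm v) / K)"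
      by (simp only: distrib_left distrib_right mult_ac)
    also have "exp (- K * ?t) * exp (K * ?t) = 1"
      by (simp add: mult_exp_exp)
    finally show "norm (\<Phi> v t) \<le> norm x0 + (norm (f 0) + L * norm v) / K"
      unfolding \<Phi>_def by simp
  qed
  have "\<exists>!v. Bcontfun (\<Phi> v) = v"
  proof (rule banach_fix_type[of "1 / 2"])
    show "\<forall>v w. dist (Bcontfun (\<Phi> v)) (Bcontfun (\<Phi> w)) \<le> 1 / 2 * dist v w"
    proof (intro allI)
      fix v w
      have "dist (Bcontfun (\<Phi> v)) (Bcontfun (\<Phi> w)) \<le> L / K * dist v w"
        using \<Phi>_dist by (intro dist_bound) (simp add: Bcontfun_inverse bc)
      also have "\<dots> \<le> 1 / 2 * dist v w" using K by (intro mult_right_mono) auto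
      finally show "dist (Bcontfun (\<Phi> v)) (Bcontfun (\<Phi> w)) \<le> 1 / 2 * dist v w" .
    qed
  qed auto
  then obtain v where v: "Bcontfun (\<Phi> v) = v" by blast
  have U: "U v t = x0 + P v t" if "t \<ge> 0" for t
  proof -
    have "apply_bcontfun v = \<Phi> v" using Bcontfun_inverse[OF bc[of v]] unfolding v .
    then show ?thesis using that by (simp add: U_def \<Phi>_def mult_exp_exp)
  qed
  show thesis
  proof (rule that[of "U v"])
    show "U v 0 = x0" using U P0 by simp
    fix t :: real assume t: "t \<ge> 0"
    have D: "((\<lambda>s. x0 + P v s) has_vector_derivative f (U v t)) (at t within {0..})"
      using has_vector_derivative_add[OF has_vector_derivative_const P[OF t], of x0 v] by simp
    have "t \<in> {0..}" using t by simp
    then show "(U v has_vector_derivative f (U v t)) (at t within {0..})"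
      by (rule has_vector_derivative_transform[OF _ _ D]) (simp add: U)
  qed
qed

section \<open>The flow of a maximal monotone operator\<close>

lemma has_vector_derivative_iff_quotient:
  "(u has_vector_derivative v) (at t within S) \<longleftrightarrow>
     ((\<lambda>s. (u s - u t) /\<^sub>R (s - t)) \<longlongrightarrow> v) (at t within S)"
proof -
  have "(u has_vector_derivative v) (at t within S) \<longleftrightarrow>
      ((\<lambda>s. (1 / norm (s - t)) *\<^sub>R (u s - (u t + (s - t) *\<^sub>R v))) \<longlongrightarrow> 0) (at t within S)"
    unfolding has_vector_derivative_def has_derivative_within by (simp add: bounded_linear_scaleR_left)
  also have "\<dots> \<longleftrightarrow> ((\<lambda>s. norm ((1 / norm (s - t)) *\<^sub>R (u s - (u t + (s - t) *\<^sub>R v)))) \<longlongrightarrow> 0) (at t within S)"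
    by (rule tendsto_norm_zero_iff[symmetric])
  also have "\<dots> \<longleftrightarrow> ((\<lambda>s. norm ((u s - u t) /\<^sub>R (s - t) - v)) \<longlongrightarrow> 0) (at t within S)"
  proof (rule filterlim_cong[OF refl refl])
    have "norm ((1 / norm (s - t)) *\<^sub>R (u s - (u t + (s - t) *\<^sub>R v))) = norm ((u s - u t) /\<^sub>R (s - t) - v)"
      if "s \<noteq> t" for s
    proof -
      have "(u s - u t) /\<^sub>R (s - t) - v = (1 / (s - t)) *\<^sub>R (u s - (u t + (s - t) *\<^sub>R v))"
        using that by (simp add: scaleR_diff_right diff_diff_eq[symmetric] inverse_eq_divide)
      then show ?thesis by simp
    qed
    then show "\<forall>\<^sub>F s in at t within S. norm ((1 / norm (s - t)) *\<^sub>R (u s - (u t + (s - t) *\<^sub>R v)))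
        = norm ((u s - u t) /\<^sub>R (s - t) - v)"
      by (simp add: eventually_at_filter)
  qed
  also have "\<dots> \<longleftrightarrow> ((\<lambda>s. (u s - u t) /\<^sub>R (s - t) - v) \<longlongrightarrow> 0) (at t within S)"
    by (rule tendsto_norm_zero_iff)
  also have "\<dots> \<longleftrightarrow> ((\<lambda>s. (u s - u t) /\<^sub>R (s - t)) \<longlongrightarrow> v) (at t within S)"
    by (rule LIM_zero_iff)
  finally show ?thesis .
qed

lemma right_increment_tendsto:
  fixes u :: "real \<Rightarrow> 'h::real_normed_vector"
  assumes "(u has_vector_derivative v) (at t within {0..})" "t \<ge> 0"
  shows "((\<lambda>h. norm (u (t + h) - u t) / h) \<longlongrightarrow> norm v) (at_right 0)"
proof -
  have "filterlim (\<lambda>h. t + h) (at t within {0..}) (at_right 0)"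
    unfolding filterlim_at using \<open>t \<ge> 0\<close>
    by (auto intro!: tendsto_eq_intros eventually_at_rightI[of 0 1])
  from filterlim_compose[OF assms(1)[unfolded has_vector_derivative_iff_quotient] this]
  have "((\<lambda>h. norm ((u (t + h) - u t) /\<^sub>R h)) \<longlongrightarrow> norm v) (at_right 0)"
    by (intro tendsto_norm) simp
  then show ?thesis
    by (rule Lim_transform_eventually)
       (auto intro!: eventually_at_rightI[of 0 1] simp: divide_inverse_commute)
qed

lemma has_real_derivative_half_line_mono:
  fixes p :: "real \<Rightarrow> real"
  assumes p: "\<And>t. t \<in> {a..b} \<Longrightarrow> (p has_real_derivative p' t) (at t within {0..})"
    and le: "\<And>t. t \<in> {a..b} \<Longrightarrow> p' t \<le> K" and ab: "0 \<le> a" "a \<le> b"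
  shows "p b - p a \<le> K * (b - a)"
proof -
  have "p b - K * b \<le> p a - K * a"
  proof (rule DERIV_nonpos_imp_decreasing_open[OF ab(2)])
    fix t assume t: "a < t" "t < b"
    then have "at t within {0..} = at t" using ab by (intro at_within_interior) simp
    then have "(p has_real_derivative p' t) (at t)" using p[of t] t by simp
    then have "((\<lambda>t. p t - K * t) has_real_derivative p' t - K) (at t)"
      by (auto intro!: derivative_eq_intros)
    then show "\<exists>y. ((\<lambda>t. p t - K * t) has_real_derivative y) (at t) \<and> y \<le> 0"
      using le[of t] t by (intro exI[of _ "p' t - K"]) auto
  next
    have "continuous_on {a..b} p"
      using p ab by (intro DERIV_continuous_on[of _ p p'] DERIV_subset[OF p]) auto
    then show "continuous_on {a..b} (\<lambda>t. p t - K * t)" by (intro continuous_intros)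
  qed
  then show ?thesis by (simp add: algebra_simps)
qed

lemma gronwall_half_line:
  fixes p :: "real \<Rightarrow> real"
  assumes p: "\<And>t. t \<in> {a..b} \<Longrightarrow> (p has_real_derivative p' t) (at t within {0..})"
    and le: "\<And>t. t \<in> {a..b} \<Longrightarrow> p' t \<le> c * p t + K" and ab: "0 \<le> a" "a \<le> b" and "c \<ge> 0" "K \<ge> 0"
  shows "p b \<le> exp (c * (b - a)) * (p a + K * (b - a))"
proof -
  define r where "r t = exp (- c * (t - a)) * p t" for t
  have "r b - r a \<le> K * (b - a)"
  proof (rule has_real_derivative_half_line_mono[OF _ _ ab])
    fix t assume t: "t \<in> {a..b}"
    show "(r has_real_derivative exp (- c * (t - a)) * (p' t - c * p t)) (at t within {0..})"
      unfolding r_def using p[OF t] by (auto intro!: derivative_eq_intros simp: algebra_simps)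
    have "exp (- c * (t - a)) * (p' t - c * p t) \<le> exp (- c * (t - a)) * K"
      using le[OF t] by (intro mult_left_mono) auto
    also have "\<dots> \<le> 1 * K"
      using t \<open>c \<ge> 0\<close> \<open>K \<ge> 0\<close> by (intro mult_right_mono) auto
    finally show "exp (- c * (t - a)) * (p' t - c * p t) \<le> K" by simp
  qed
  then have *: "exp (- c * (b - a)) * p b \<le> p a + K * (b - a)" by (simp add: r_def)
  have "p b = exp (c * (b - a)) * (exp (- c * (b - a)) * p b)"
    by (simp add: mult.assoc[symmetric] mult_exp_exp)
  also have "\<dots> \<le> exp (c * (b - a)) * (p a + K * (b - a))"
    by (intro mult_left_mono *) auto
  finally show ?thesis .
qed

lemma has_real_derivative_inner_self:
  fixes u :: "real \<Rightarrow> 'h::real_inner"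
  assumes "(u has_vector_derivative u') (at t within S)"
  shows "((\<lambda>t. inner (u t) (u t)) has_real_derivative 2 * inner (u t) u') (at t within S)"
  using has_derivative_inner[OF assms[unfolded has_vector_derivative_def] assms[unfolded has_vector_derivative_def]]
  unfolding has_field_derivative_def
  by (rule has_derivative_eq_rhs) (auto simp: inner_commute fun_eq_iff)

lemma norm_le_of_inner_le_exp:
  assumes "inner x x \<le> exp (2 * c) * inner y y"
  shows "norm x \<le> exp c * norm y"
proof (rule power2_le_imp_le)
  have "exp (2 * c) = (exp c)\<^sup>2" by (simp add: power2_eq_square mult_exp_exp)
  then show "(norm x)\<^sup>2 \<le> (exp c * norm y)\<^sup>2"
    using assms by (simp add: power_mult_distrib power2_norm_eq_inner)
qed simp

text \<open>The regularised form of u' + A u \<ni> \<omega> u. No initial value is fixed, so that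
  forward time shifts of a flow are flows again.\<close>

definition yosida_flow :: "('h::real_inner \<Rightarrow> 'h set) \<Rightarrow> real \<Rightarrow> real \<Rightarrow> (real \<Rightarrow> 'h) \<Rightarrow> bool" where
  "yosida_flow A \<omega> \<kappa> u \<longleftrightarrow>
     (\<forall>t\<ge>0. (u has_vector_derivative (\<omega> *\<^sub>R u t - yosida A \<kappa> (u t))) (at t within {0..}))"

context
  fixes A :: "'h::{real_inner, complete_space} \<Rightarrow> 'h set" and \<omega> :: real
  assumes A: "maximal_monotone_op A" and \<omega>: "\<omega> \<ge> 0"
begin

lemma yosida_flow_exists:
  assumes "\<kappa> > 0"
  obtains u where "u 0 = x" "yosida_flow A \<omega> \<kappa> u"
proof -
  have "(\<omega> + 1 / \<kappa>)-lipschitz_on UNIV (\<lambda>z. \<omega> *\<^sub>R z - yosida A \<kappa> z)"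
  proof (rule lipschitz_onI)
    fix z z'
    have eq: "(\<omega> *\<^sub>R z - yosida A \<kappa> z) - (\<omega> *\<^sub>R z' - yosida A \<kappa> z')
        = \<omega> *\<^sub>R (z - z') - (yosida A \<kappa> z - yosida A \<kappa> z')"
      by (simp add: algebra_simps)
    have "norm ((\<omega> *\<^sub>R z - yosida A \<kappa> z) - (\<omega> *\<^sub>R z' - yosida A \<kappa> z'))
        \<le> \<omega> * norm (z - z') + norm (yosida A \<kappa> z - yosida A \<kappa> z')"
      unfolding eq using norm_triangle_ineq4[of "\<omega> *\<^sub>R (z - z')" "yosida A \<kappa> z - yosida A \<kappa> z'"] \<omega> by simp
    then show "dist (\<omega> *\<^sub>R z - yosida A \<kappa> z) (\<omega> *\<^sub>R z' - yosida A \<kappa> z') \<le> (\<omega> + 1 / \<kappa>) * dist z z'"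
      using lipschitz_onD[OF yosida_lipschitz[OF A assms], of z z'] by (simp add: dist_norm distrib_right)
  qed (use \<omega> assms in auto)
  then obtain u where "u 0 = x"
    "\<And>t. t \<ge> 0 \<Longrightarrow> (u has_vector_derivative (\<omega> *\<^sub>R u t - yosida A \<kappa> (u t))) (at t within {0..})"
    by (rule Picard_Lindeloef_global) (rule that)
  then show thesis using that unfolding yosida_flow_def by blast
qed

lemma yosida_flowD:
  "yosida_flow A \<omega> \<kappa> u \<Longrightarrow> t \<ge> 0 \<Longrightarrow>
    (u has_vector_derivative (\<omega> *\<^sub>R u t - yosida A \<kappa> (u t))) (at t within {0..})"
  by (simp add: yosida_flow_def)

lemma yosida_flow_continuous: "yosida_flow A \<omega> \<kappa> u \<Longrightarrow> continuous_on {0..} u"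
  by (rule continuous_on_vector_derivative) (auto dest: yosida_flowD)

lemma yosida_flow_shift:
  assumes u: "yosida_flow A \<omega> \<kappa> u" and "h \<ge> 0"
  shows "yosida_flow A \<omega> \<kappa> (\<lambda>t. u (t + h))"
  unfolding yosida_flow_def
proof (intro allI impI)
  fix t :: real assume "t \<ge> 0"
  have 1: "((\<lambda>t. t + h) has_vector_derivative 1) (at t within {0..})"
    by (auto intro!: derivative_eq_intros)
  have "(u has_vector_derivative (\<omega> *\<^sub>R u (t + h) - yosida A \<kappa> (u (t + h)))) (at (t + h) within (\<lambda>t. t + h) ` {0..})"
    using yosida_flowD[OF u, of "t + h"] \<open>t \<ge> 0\<close> \<open>h \<ge> 0\<close>
    by (auto intro: has_vector_derivative_within_subset)
  from vector_diff_chain_within[OF 1 this]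
  show "((\<lambda>t. u (t + h)) has_vector_derivative (\<omega> *\<^sub>R u (t + h) - yosida A \<kappa> (u (t + h)))) (at t within {0..})"
    by (simp add: o_def)
qed

text \<open>The Yosida part is monotone and can only decrease |u - w|^2; all growth comes from
  \<omega>, so the rate does not depend on \<kappa>.\<close>

lemma yosida_flow_contraction:
  assumes u: "yosida_flow A \<omega> \<kappa> u" and w: "yosida_flow A \<omega> \<kappa> w" and \<kappa>: "\<kappa> > 0" and st: "0 \<le> s" "s \<le> t"
  shows "norm (u t - w t) \<le> exp (\<omega> * (t - s)) * norm (u s - w s)"
proof (rule norm_le_of_inner_le_exp)
  define p where "p r = inner (u r - w r) (u r - w r)" for r
  have "p t \<le> exp ((2 * \<omega>) * (t - s)) * (p s + 0 * (t - s))"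
  proof (rule gronwall_half_line[OF _ _ st])
    fix r assume r: "r \<in> {s..t}"
    let ?d = "(\<omega> *\<^sub>R u r - yosida A \<kappa> (u r)) - (\<omega> *\<^sub>R w r - yosida A \<kappa> (w r))"
    show "(p has_real_derivative 2 * inner (u r - w r) ?d) (at r within {0..})"
      unfolding p_def using r st
      by (intro has_real_derivative_inner_self has_vector_derivative_diff yosida_flowD u w) auto
    have "2 * inner (u r - w r) ?d
        = 2 * \<omega> * p r - 2 * inner (u r - w r) (yosida A \<kappa> (u r) - yosida A \<kappa> (w r))"
      by (simp add: p_def algebra_simps inner_commute)
    then show "2 * inner (u r - w r) ?d \<le> 2 * \<omega> * p r + 0"
      using yosida_monotone[OF A \<kappa>, of "u r" "w r"] by simp
  qed (use \<omega> in auto)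
  then show "inner (u t - w t) (u t - w t) \<le> exp (2 * (\<omega> * (t - s))) * inner (u s - w s) (u s - w s)"
    by (simp add: p_def mult.assoc)
qed

text \<open>The contraction applied to u and its own shift; dividing by h and letting h tend to 0
  gives \<open>yosida_flow_speed\<close>.\<close>

lemma yosida_flow_increment:
  assumes u: "yosida_flow A \<omega> \<kappa> u" and \<kappa>: "\<kappa> > 0" and st: "0 \<le> s" "s \<le> t" and h: "h \<ge> 0"
  shows "norm (u (t + h) - u t) \<le> exp (\<omega> * (t - s)) * norm (u (s + h) - u s)"
  using yosida_flow_contraction[OF yosida_flow_shift[OF u h] u \<kappa> st] .

lemma yosida_flow_speed:
  assumes u: "yosida_flow A \<omega> \<kappa> u" and \<kappa>: "\<kappa> > 0" and st: "0 \<le> s" "s \<le> t"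
  shows "norm (\<omega> *\<^sub>R u t - yosida A \<kappa> (u t)) \<le> exp (\<omega> * (t - s)) * norm (\<omega> *\<^sub>R u s - yosida A \<kappa> (u s))"
proof (rule tendsto_le)
  show "((\<lambda>h. norm (u (t + h) - u t) / h) \<longlongrightarrow> norm (\<omega> *\<^sub>R u t - yosida A \<kappa> (u t))) (at_right 0)"
    using st by (intro right_increment_tendsto yosida_flowD u) auto
  show "((\<lambda>h. exp (\<omega> * (t - s)) * (norm (u (s + h) - u s) / h))
      \<longlongrightarrow> exp (\<omega> * (t - s)) * norm (\<omega> *\<^sub>R u s - yosida A \<kappa> (u s))) (at_right 0)"
    using st by (intro tendsto_mult tendsto_const right_increment_tendsto yosida_flowD u) auto
  show "\<forall>\<^sub>F h in at_right 0. norm (u (t + h) - u t) / h \<le> exp (\<omega> * (t - s)) * (norm (u (s + h) - u s) / h)"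
    using yosida_flow_increment[OF u \<kappa> st]
    by (auto intro!: eventually_at_rightI[of 0 1] divide_right_mono)
qed simp

text \<open>An initial point in the domain bounds the Yosida values along the flow uniformly in
  \<kappa>. Monotonicity taken at the resolvent points instead of at u and w then costs only an
  error of order \<kappa> + \<kappa>'.\<close>

lemma yosida_flow_Cauchy:
  assumes x: "x \<in> op_dom A" and "T \<ge> 0"
  obtains C where "C \<ge> 0" "\<And>\<kappa> \<kappa>' u w t. \<kappa> > 0 \<Longrightarrow> \<kappa>' > 0 \<Longrightarrow> yosida_flow A \<omega> \<kappa> u \<Longrightarrow> yosida_flow A \<omega> \<kappa>' w \<Longrightarrow>
      u 0 = x \<Longrightarrow> w 0 = x \<Longrightarrow> t \<in> {0..T} \<Longrightarrow> (norm (u t - w t))\<^sup>2 \<le> C * (\<kappa> + \<kappa>')"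
proof -
  from x obtain a where a: "a \<in> A x" by (auto simp: op_dom_def)
  \<comment> \<open>\<open>c\<close> bounds the speed on [0, T]: at time 0 it is at most \<omega>
    |x| + |a| by \<open>norm_yosida_le\<close>. \<open>C\<close> adds \<omega> |u|, with |u| <= |x|
    + c T, to bound the Yosida values.\<close>
  define c where "c = exp (\<omega> * T) * (\<omega> * norm x + norm a)"
  have c: "c \<ge> 0" using \<omega> by (simp add: c_def)
  define C where "C = c + \<omega> * (norm x + c * T)"
  have C: "C \<ge> 0" using c \<omega> \<open>T \<ge> 0\<close> by (simp add: C_def)
  have bound: "norm (yosida A \<kappa> (u t)) \<le> C"
    if \<kappa>: "\<kappa> > 0" and u: "yosida_flow A \<omega> \<kappa> u" "u 0 = x" and t: "t \<in> {0..T}" for \<kappa> u t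
  proof -
    have u': "norm (\<omega> *\<^sub>R u s - yosida A \<kappa> (u s)) \<le> c" if s: "s \<in> {0..T}" for s
    proof -
      have "norm (\<omega> *\<^sub>R u s - yosida A \<kappa> (u s)) \<le> exp (\<omega> * (s - 0)) * norm (\<omega> *\<^sub>R x - yosida A \<kappa> x)"
        using yosida_flow_speed[OF u(1) \<kappa>, of 0 s] s u(2) by simp
      also have "\<dots> \<le> exp (\<omega> * T) * (\<omega> * norm x + norm a)"
        using s \<omega> norm_yosida_le[OF A \<kappa> a] norm_triangle_ineq4[of "\<omega> *\<^sub>R x" "yosida A \<kappa> x"]
        by (intro mult_mono) (auto intro!: mult_left_mono)
      finally show ?thesis by (simp add: c_def)
    qed
    have "norm (u t - u 0) \<le> c * t"
    proof (cases "t = 0")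
      case False
      then have "0 < t" using t by simp
      have "norm (u t - u 0) \<le> c * t - c * 0"
      proof (rule differentiable_bound_general[OF \<open>0 < t\<close>])
        show "continuous_on {0..t} u"
          using yosida_flow_continuous[OF u(1)] by (rule continuous_on_subset) auto
        fix s assume s: "0 < s" "s < t"
        then have "at s within {0..} = at s" by (intro at_within_interior) simp
        then show "(u has_vector_derivative (\<omega> *\<^sub>R u s - yosida A \<kappa> (u s))) (at s)"
          using yosida_flowD[OF u(1), of s] s by simp
        show "((\<lambda>s. c * s) has_vector_derivative c) (at s)"
          by (auto intro!: derivative_eq_intros)
        show "norm (\<omega> *\<^sub>R u s - yosida A \<kappa> (u s)) \<le> c"
          using u'[of s] s t by simp
      qed (auto intro!: continuous_intros)
      then show ?thesis by simp
    qed simp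
    also have "\<dots> \<le> c * T" using t c by (intro mult_left_mono) auto
    finally have "norm (u t) \<le> norm x + c * T"
      using norm_triangle_sub[of "u t" x] u(2) by simp
    then have "\<omega> * norm (u t) \<le> \<omega> * (norm x + c * T)" using \<omega> by (intro mult_left_mono)
    moreover have "norm (yosida A \<kappa> (u t)) \<le> norm (\<omega> *\<^sub>R u t) + norm (\<omega> *\<^sub>R u t - yosida A \<kappa> (u t))"
      using norm_triangle_sub[of "yosida A \<kappa> (u t)" "\<omega> *\<^sub>R u t"] by (simp add: norm_minus_commute)
    ultimately show ?thesis using u'[OF t] \<omega> by (simp add: C_def)
  qed
  show thesis
  proof (rule that)
    show "0 \<le> exp (2 * \<omega> * T) * (2 * C\<^sup>2 * T)" using \<open>T \<ge> 0\<close> by simp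
    fix \<kappa> \<kappa>' u w t
    assume \<kappa>: "\<kappa> > 0" "\<kappa>' > 0" and u: "yosida_flow A \<omega> \<kappa> u" and w: "yosida_flow A \<omega> \<kappa>' w"
      and 0: "u 0 = x" "w 0 = x" and t: "t \<in> {0..T}"
    define p where "p r = inner (u r - w r) (u r - w r)" for r
    have "p t \<le> exp ((2 * \<omega>) * (t - 0)) * (p 0 + (2 * (\<kappa> + \<kappa>') * C\<^sup>2) * (t - 0))"
    proof (rule gronwall_half_line)
      fix r assume r: "r \<in> {0..t}"
      let ?y = "yosida A \<kappa> (u r)" and ?z = "yosida A \<kappa>' (w r)"
      let ?d = "(\<omega> *\<^sub>R u r - ?y) - (\<omega> *\<^sub>R w r - ?z)"
      show "(p has_real_derivative 2 * inner (u r - w r) ?d) (at r within {0..})"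
        unfolding p_def using r
        by (intro has_real_derivative_inner_self has_vector_derivative_diff yosida_flowD u w) auto
      have "0 \<le> inner ((u r - \<kappa> *\<^sub>R ?y) - (w r - \<kappa>' *\<^sub>R ?z)) (?y - ?z)"
        by (intro graph_monotone[OF A] yosida_mem[OF A] \<kappa>)
      also have "\<dots> = inner (u r - w r) (?y - ?z) - \<kappa> * inner ?y ?y - \<kappa>' * inner ?z ?z + (\<kappa> + \<kappa>') * inner ?y ?z"
        by (simp add: algebra_simps inner_commute)
      also have "\<dots> \<le> inner (u r - w r) (?y - ?z) + (\<kappa> + \<kappa>') * inner ?y ?z"
        using mult_nonneg_nonneg[OF less_imp_le[OF \<kappa>(1)] inner_ge_zero[of ?y]]
          mult_nonneg_nonneg[OF less_imp_le[OF \<kappa>(2)] inner_ge_zero[of ?z]] by linarith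
      also have "inner ?y ?z \<le> C\<^sup>2"
      proof -
        have "inner ?y ?z \<le> norm ?y * norm ?z" by (rule norm_cauchy_schwarz)
        also have "\<dots> \<le> C * C"
          using bound[OF \<kappa>(1) u 0(1), of r] bound[OF \<kappa>(2) w 0(2), of r] r t C by (intro mult_mono) auto
        finally show ?thesis by (simp add: power2_eq_square)
      qed
      finally have "- inner (u r - w r) (?y - ?z) \<le> (\<kappa> + \<kappa>') * C\<^sup>2"
        using \<kappa> by (simp add: mult_left_mono)
      moreover have "2 * inner (u r - w r) ?d = 2 * \<omega> * p r - 2 * inner (u r - w r) (?y - ?z)"
        by (simp add: p_def algebra_simps inner_commute)
      moreover have "2 * (\<kappa> + \<kappa>') * C\<^sup>2 = 2 * ((\<kappa> + \<kappa>') * C\<^sup>2)" by simp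
      ultimately show "2 * inner (u r - w r) ?d \<le> 2 * \<omega> * p r + 2 * (\<kappa> + \<kappa>') * C\<^sup>2" by linarith
    qed (use \<omega> t \<kappa> in auto)
    also have "p 0 = 0" by (simp add: p_def 0)
    also have "exp (2 * \<omega> * (t - 0)) * (0 + 2 * (\<kappa> + \<kappa>') * C\<^sup>2 * (t - 0))
        \<le> exp (2 * \<omega> * T) * (2 * (\<kappa> + \<kappa>') * C\<^sup>2 * T)"
      using t \<kappa> \<omega> by (intro mult_mono) (auto intro!: mult_left_mono)
    also have "\<dots> = exp (2 * \<omega> * T) * (2 * C\<^sup>2 * T) * (\<kappa> + \<kappa>')" by (simp only: mult_ac)
    finally show "(norm (u t - w t))\<^sup>2 \<le> exp (2 * \<omega> * T) * (2 * C\<^sup>2 * T) * (\<kappa> + \<kappa>')"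
      by (simp only: p_def power2_norm_eq_inner)
  qed
qed

text \<open>Passing from z to its resolvent point produces the error \<kappa> (inner v a - |a|^2)
  with a the Yosida value; completing the square bounds it by \<kappa> |v|^2 / 4 whatever the size
  of a, so it vanishes with \<kappa>.\<close>

lemma yosida_graph_ineq:
  assumes "\<kappa> > 0" and v: "v \<in> A y"
  shows "inner (z - y) (\<omega> *\<^sub>R z - yosida A \<kappa> z) \<le> inner (\<omega> *\<^sub>R z - v) (z - y) + \<kappa> * (norm v)\<^sup>2 / 4"
proof -
  let ?a = "yosida A \<kappa> z"
  have "0 \<le> inner (z - \<kappa> *\<^sub>R ?a - y) (?a - v)"
    by (rule graph_monotone[OF A yosida_mem[OF A assms(1)] v])
  then have 1: "\<kappa> * (inner ?a ?a - inner v ?a) \<le> inner (z - y) (?a - v)"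
    by (simp add: algebra_simps inner_commute)
  have "0 \<le> inner (?a - v /\<^sub>R 2) (?a - v /\<^sub>R 2)" by (rule inner_ge_zero)
  also have "\<dots> = inner ?a ?a - inner v ?a + (norm v)\<^sup>2 / 4"
    unfolding power2_norm_eq_inner by (simp add: algebra_simps inner_commute)
  finally have "\<kappa> * (- ((norm v)\<^sup>2 / 4)) \<le> \<kappa> * (inner ?a ?a - inner v ?a)"
    using \<open>\<kappa> > 0\<close> by (intro mult_left_mono) auto
  with 1 have "- (\<kappa> * (norm v)\<^sup>2 / 4) \<le> inner (z - y) (?a - v)" by simp
  then show ?thesis by (simp add: algebra_simps inner_commute)
qed

text \<open>Integrated form of \<open>yosida_graph_ineq\<close>, in the spirit of Benilan's integral
  solutions: it mentions no derivative and so survives the limit \<kappa> \<rightarrow> 0.\<close>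

lemma yosida_flow_integral_ineq:
  assumes u: "yosida_flow A \<omega> \<kappa> u" and \<kappa>: "\<kappa> > 0" and v: "v \<in> A y" and st: "0 \<le> s" "s \<le> t"
    and K: "\<And>r. r \<in> {s..t} \<Longrightarrow> inner (\<omega> *\<^sub>R u r - v) (u r - y) \<le> K"
  shows "inner (u t - y) (u t - y) / 2 - inner (u s - y) (u s - y) / 2 \<le> (K + \<kappa> * (norm v)\<^sup>2 / 4) * (t - s)"
proof (rule has_real_derivative_half_line_mono[OF _ _ st])
  fix r assume r: "r \<in> {s..t}"
  have "((\<lambda>r. u r - y) has_vector_derivative (\<omega> *\<^sub>R u r - yosida A \<kappa> (u r)) - 0) (at r within {0..})"
    using r st by (intro has_vector_derivative_diff has_vector_derivative_const yosida_flowD u) auto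
  from DERIV_cdivide[OF has_real_derivative_inner_self[OF this], of 2]
  show "((\<lambda>r. inner (u r - y) (u r - y) / 2) has_real_derivative
      inner (u r - y) (\<omega> *\<^sub>R u r - yosida A \<kappa> (u r))) (at r within {0..})" by simp
  show "inner (u r - y) (\<omega> *\<^sub>R u r - yosida A \<kappa> (u r)) \<le> K + \<kappa> * (norm v)\<^sup>2 / 4"
    using yosida_graph_ineq[OF \<kappa> v, of "u r"] K[OF r] by simp
qed

text \<open>A linear estimate needs the norm of u - y instead of its square, but the norm is not
  differentiable at 0; sqrt (|u - y|^2 + \<epsilon>) is, at the price of a term with \<kappa> / sqrt
  \<epsilon>.\<close>

lemma yosida_flow_dist:
  assumes u: "yosida_flow A \<omega> \<kappa> u" and \<kappa>: "\<kappa> > 0" and v: "v \<in> A y" and st: "0 \<le> s" "s \<le> t" and "\<epsilon> > 0"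
  shows "sqrt (inner (u t - y) (u t - y) + \<epsilon>) \<le> exp (\<omega> * (t - s)) *
    (sqrt (inner (u s - y) (u s - y) + \<epsilon>) + (norm (v - \<omega> *\<^sub>R y) + \<kappa> * (norm v)\<^sup>2 / (4 * sqrt \<epsilon>)) * (t - s))"
proof (rule gronwall_half_line[OF _ _ st])
  fix r assume r: "r \<in> {s..t}"
  let ?p = "inner (u r - y) (u r - y)"
  let ?q = "sqrt (?p + \<epsilon>)" and ?u' = "\<omega> *\<^sub>R u r - yosida A \<kappa> (u r)"
  have pos: "?p + \<epsilon> > 0" using \<open>\<epsilon> > 0\<close> by (simp add: add_nonneg_pos)
  then have q: "?q > 0" "?q * ?q = ?p + \<epsilon>" by auto
  have "((\<lambda>r. u r - y) has_vector_derivative ?u' - 0) (at r within {0..})"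
    using r st by (intro has_vector_derivative_diff has_vector_derivative_const yosida_flowD u) auto
  note has_real_derivative_inner_self[OF this]
  from DERIV_add[OF this DERIV_const[of \<epsilon>]]
  have "((\<lambda>r. inner (u r - y) (u r - y) + \<epsilon>) has_real_derivative 2 * inner (u r - y) ?u') (at r within {0..})"
    by simp
  from DERIV_chain2[where g = "\<lambda>r. inner (u r - y) (u r - y) + \<epsilon>", OF DERIV_real_sqrt[OF pos] this]
  have D: "((\<lambda>r. sqrt (inner (u r - y) (u r - y) + \<epsilon>)) has_real_derivative
      inverse ?q / 2 * (2 * inner (u r - y) ?u')) (at r within {0..})" .
  have "inverse a / 2 * (2 * b) = b / a" for a b :: real by (simp add: inverse_eq_divide)
  from D[unfolded this]
  show "((\<lambda>r. sqrt (inner (u r - y) (u r - y) + \<epsilon>)) has_real_derivative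
      inner (u r - y) ?u' / ?q) (at r within {0..})" .
  have nq: "norm (u r - y) \<le> ?q"
    using \<open>\<epsilon> > 0\<close> by (simp add: norm_eq_sqrt_inner)
  have sq: "sqrt \<epsilon> \<le> ?q" by simp
  have "inner (u r - y) ?u' \<le> inner (\<omega> *\<^sub>R u r - v) (u r - y) + \<kappa> * (norm v)\<^sup>2 / 4"
    by (rule yosida_graph_ineq[OF \<kappa> v])
  also have "inner (\<omega> *\<^sub>R u r - v) (u r - y) = \<omega> * ?p - inner (v - \<omega> *\<^sub>R y) (u r - y)"
    by (simp add: algebra_simps)
  also have "\<dots> \<le> \<omega> * (?q * ?q) + norm (v - \<omega> *\<^sub>R y) * ?q"
  proof -
    have "- inner (v - \<omega> *\<^sub>R y) (u r - y) \<le> norm (v - \<omega> *\<^sub>R y) * norm (u r - y)"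
      using Cauchy_Schwarz_ineq2[of "v - \<omega> *\<^sub>R y" "u r - y"] by linarith
    also have "\<dots> \<le> norm (v - \<omega> *\<^sub>R y) * ?q" using nq by (intro mult_left_mono) auto
    finally have "- inner (v - \<omega> *\<^sub>R y) (u r - y) \<le> norm (v - \<omega> *\<^sub>R y) * ?q" .
    moreover have "\<omega> * ?p \<le> \<omega> * (?q * ?q)" unfolding q(2) using \<omega> \<open>\<epsilon> > 0\<close> by (intro mult_left_mono) auto
    ultimately show ?thesis by linarith
  qed
  also have "\<kappa> * (norm v)\<^sup>2 / 4 \<le> (\<kappa> * (norm v)\<^sup>2 / (4 * sqrt \<epsilon>)) * ?q"
  proof -
    have "\<kappa> * (norm v)\<^sup>2 / 4 = (\<kappa> * (norm v)\<^sup>2 / (4 * sqrt \<epsilon>)) * sqrt \<epsilon>"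
      using \<open>\<epsilon> > 0\<close> by simp
    also have "\<dots> \<le> (\<kappa> * (norm v)\<^sup>2 / (4 * sqrt \<epsilon>)) * ?q"
      using \<kappa> \<open>\<epsilon> > 0\<close> by (intro mult_left_mono sq) auto
    finally show ?thesis .
  qed
  finally have "inner (u r - y) ?u' \<le> (\<omega> * ?q + (norm (v - \<omega> *\<^sub>R y) + \<kappa> * (norm v)\<^sup>2 / (4 * sqrt \<epsilon>))) * ?q"
    by (simp add: algebra_simps)
  then show "inner (u r - y) ?u' / ?q \<le> \<omega> * ?q + (norm (v - \<omega> *\<^sub>R y) + \<kappa> * (norm v)\<^sup>2 / (4 * sqrt \<epsilon>))"
    using q(1) by (simp only: pos_divide_le_eq)
qed (use \<omega> \<kappa> \<open>\<epsilon> > 0\<close> in auto)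

end

section \<open>The limit of the Yosida flows\<close>

lemma inverse_Suc_tendsto_0: "(\<lambda>n. 1 / real (Suc n)) \<longlonglongrightarrow> 0"
  using LIMSEQ_inverse_real_of_nat by (simp add: inverse_eq_divide)

context
  fixes A :: "'h::{real_inner, complete_space} \<Rightarrow> 'h set" and \<omega> :: real
  assumes A: "maximal_monotone_op A" and \<omega>: "\<omega> \<ge> 0"
begin

text \<open>The Cauchy estimate needs an initial point in the domain. A point x0 of the closure is
  approximated by such an x, and the contraction carries the error over [0, T] uniformly in
  n.\<close>

lemma yosida_flow_limit:
  assumes x0: "x0 \<in> closure (op_dom A)"
  obtains U u where "\<And>n. yosida_flow A \<omega> (1 / Suc n) (U n)" "\<And>n. U n 0 = x0"
    "\<And>T. uniform_limit {0..T} U u sequentially"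
proof -
  have ex: "\<exists>u. u 0 = x \<and> yosida_flow A \<omega> (1 / Suc n) u" for n x
  proof -
    obtain u where "u 0 = x" "yosida_flow A \<omega> (1 / Suc n) u"
      by (rule yosida_flow_exists[OF A \<omega>, of "1 / Suc n" x]) auto
    then show ?thesis by blast
  qed
  define S where "S n x = (SOME u. u 0 = x \<and> yosida_flow A \<omega> (1 / Suc n) u)" for n x
  have S0: "S n x 0 = x" and S: "yosida_flow A \<omega> (1 / Suc n) (S n x)" for n x
    using someI_ex[OF ex[of x n]] unfolding S_def by blast+
  have "uniformly_Cauchy_on {0..T} (\<lambda>n. S n x0)" if "T \<ge> 0" for T
  proof (rule uniformly_Cauchy_onI)
    fix e :: real assume "e > 0"
    \<comment> \<open>The contraction multiplies d by at most exp (\<omega> * T), which leaves e / 3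
      for each of the two outer terms.\<close>
    define d where "d = e / (3 * exp (\<omega> * T))"
    have "d > 0" using \<open>e > 0\<close> by (simp add: d_def)
    with x0 obtain x where x: "x \<in> op_dom A" "norm (x0 - x) < d"
      unfolding closure_approachable dist_norm by (metis norm_minus_commute)
    obtain C where C: "C \<ge> 0" "\<And>\<kappa> \<kappa>' u w t. \<kappa> > 0 \<Longrightarrow> \<kappa>' > 0 \<Longrightarrow> yosida_flow A \<omega> \<kappa> u \<Longrightarrow> yosida_flow A \<omega> \<kappa>' w \<Longrightarrow>
      u 0 = x \<Longrightarrow> w 0 = x \<Longrightarrow> t \<in> {0..T} \<Longrightarrow> (norm (u t - w t))\<^sup>2 \<le> C * (\<kappa> + \<kappa>')"
      by (rule yosida_flow_Cauchy[OF A \<omega> x(1) \<open>T \<ge> 0\<close>]) (rule that)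
    have near: "norm (S n x0 t - S n x t) < e / 3" if t: "t \<in> {0..T}" for n t
    proof -
      have "norm (S n x0 t - S n x t) \<le> exp (\<omega> * (t - 0)) * norm (S n x0 0 - S n x 0)"
        using t by (intro yosida_flow_contraction[OF A \<omega> S S]) auto
      also have "\<dots> \<le> exp (\<omega> * T) * norm (x0 - x)"
        using t \<omega> by (simp add: S0 mult_right_mono mult_left_mono)
      also have "\<dots> < exp (\<omega> * T) * d" using x(2) by simp
      finally show ?thesis by (simp add: d_def)
    qed
    have "(\<lambda>n. 2 * C * (1 / real (Suc n))) \<longlonglongrightarrow> 2 * C * 0"
      by (intro tendsto_mult tendsto_const inverse_Suc_tendsto_0)
    moreover have "(e / 3)\<^sup>2 > 0" using \<open>e > 0\<close> by simp
    ultimately have "\<forall>\<^sub>F n in sequentially. 2 * C * (1 / real (Suc n)) < (e / 3)\<^sup>2"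
      by (intro order_tendstoD(2)) auto
    then obtain N where N: "2 * C * (1 / real (Suc N)) < (e / 3)\<^sup>2"
      unfolding eventually_sequentially by blast
    have mid: "norm (S n x t - S k x t) < e / 3" if "n \<ge> N" "k \<ge> N" "t \<in> {0..T}" for n k t
    proof -
      have "(norm (S n x t - S k x t))\<^sup>2 \<le> C * (1 / Suc n + 1 / Suc k)"
        using that S S0 by (intro C(2)) auto
      also have "\<dots> \<le> C * (1 / Suc N + 1 / Suc N)"
        using that C(1) by (intro mult_left_mono add_mono) (auto simp: field_simps)
      also have "\<dots> < (e / 3)\<^sup>2" using N by (simp add: mult.commute)
      finally show ?thesis using \<open>e > 0\<close> by (intro power_less_imp_less_base[of _ 2 "e / 3"]) auto
    qed
    show "\<exists>M. \<forall>t\<in>{0..T}. \<forall>m\<ge>M. \<forall>n\<ge>M. dist (S m x0 t) (S n x0 t) < e"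
    proof (intro exI[of _ N] ballI allI impI)
      fix t m n assume t: "t \<in> {0..T}" and mn: "m \<ge> N" "n \<ge> N"
      have "dist (S m x0 t) (S n x0 t) \<le> dist (S m x0 t) (S m x t) + dist (S m x t) (S n x t) + dist (S n x0 t) (S n x t)"
        by (metis dist_commute dist_triangle_le add.assoc add_left_mono dist_triangle)
      then show "dist (S m x0 t) (S n x0 t) < e"
        using near[OF t, of m] near[OF t, of n] mid[OF mn t] by (simp add: dist_norm)
    qed
  qed
  then have lim: "uniform_limit {0..T} (\<lambda>n. S n x0) (\<lambda>t. lim (\<lambda>n. S n x0 t)) sequentially" if "T \<ge> 0" for T
    using that uniformly_convergent_eq_Cauchy uniformly_convergent_uniform_limit_iff by blast
  show thesis
  proof (rule that[of "\<lambda>n. S n x0" "\<lambda>t. lim (\<lambda>n. S n x0 t)"])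
    show "uniform_limit {0..T} (\<lambda>n. S n x0) (\<lambda>t. lim (\<lambda>n. S n x0 t)) sequentially" for T
    proof (cases "T \<ge> 0")
      case False
      then show ?thesis by (simp add: uniform_limit_iff)
    qed (rule lim)
  qed (use S S0 in auto)
qed

context
  fixes U u x0
  assumes flow: "\<And>n. yosida_flow A \<omega> (1 / real (Suc n)) (U n)" and init: "\<And>n. U n 0 = x0"
    and lim: "\<And>T. uniform_limit {0..T} U u sequentially"
begin

lemma flow_tendsto: "t \<ge> 0 \<Longrightarrow> (\<lambda>n. U n t) \<longlonglongrightarrow> u t"
  by (rule tendsto_uniform_limitI[OF lim[of t]]) simp

lemma flow_init: "u 0 = x0"
  using flow_tendsto[of 0] LIMSEQ_unique tendsto_const unfolding init by blast

lemma flow_continuous: "continuous_on {0..T} u"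
  by (rule uniform_limit_theorem[OF _ lim])
     (auto intro!: always_eventually continuous_on_subset[OF yosida_flow_continuous[OF A \<omega> flow]])

lemma flow_isCont: "t > 0 \<Longrightarrow> isCont u t"
  using continuous_on_interior[OF flow_continuous[of "t + 1"], of t] by simp

lemma flow_increment:
  assumes "0 \<le> s" "s \<le> t" "h \<ge> 0"
  shows "norm (u (t + h) - u t) \<le> exp (\<omega> * (t - s)) * norm (u (s + h) - u s)"
proof (rule LIMSEQ_le)
  show "(\<lambda>n. norm (U n (t + h) - U n t)) \<longlonglongrightarrow> norm (u (t + h) - u t)"
    using assms by (intro tendsto_intros flow_tendsto) auto
  show "(\<lambda>n. exp (\<omega> * (t - s)) * norm (U n (s + h) - U n s)) \<longlonglongrightarrow> exp (\<omega> * (t - s)) * norm (u (s + h) - u s)"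
    using assms by (intro tendsto_intros flow_tendsto) auto
  show "\<exists>N. \<forall>n\<ge>N. norm (U n (t + h) - U n t) \<le> exp (\<omega> * (t - s)) * norm (U n (s + h) - U n s)"
    using yosida_flow_increment[OF A \<omega> flow _ assms] by simp
qed

text \<open>The order of limits matters: the error in \<open>yosida_flow_dist\<close> contains
  \<kappa> / sqrt \<epsilon>, so n \<rightarrow> \<infinity> is taken with \<epsilon> fixed, and
  only then \<epsilon> \<rightarrow> 0.\<close>

lemma flow_dist:
  assumes v: "v \<in> A y" and st: "0 \<le> s" "s \<le> t"
  shows "norm (u t - y) \<le> exp (\<omega> * (t - s)) * (norm (u s - y) + norm (v - \<omega> *\<^sub>R y) * (t - s))"
proof -
  let ?a = "norm (v - \<omega> *\<^sub>R y)"
  have le: "sqrt (inner (u t - y) (u t - y) + \<epsilon>)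
      \<le> exp (\<omega> * (t - s)) * (sqrt (inner (u s - y) (u s - y) + \<epsilon>) + ?a * (t - s))" if "\<epsilon> > 0" for \<epsilon>
  proof (rule LIMSEQ_le)
    show "(\<lambda>n. sqrt (inner (U n t - y) (U n t - y) + \<epsilon>)) \<longlonglongrightarrow> sqrt (inner (u t - y) (u t - y) + \<epsilon>)"
      using st by (intro tendsto_intros flow_tendsto) auto
    have "(\<lambda>n. exp (\<omega> * (t - s)) * (sqrt (inner (U n s - y) (U n s - y) + \<epsilon>)
          + (?a + 1 / real (Suc n) * (norm v)\<^sup>2 / (4 * sqrt \<epsilon>)) * (t - s)))
      \<longlonglongrightarrow> exp (\<omega> * (t - s)) * (sqrt (inner (u s - y) (u s - y) + \<epsilon>)
          + (?a + 0 * (norm v)\<^sup>2 / (4 * sqrt \<epsilon>)) * (t - s))"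
      using st \<open>\<epsilon> > 0\<close> by (intro tendsto_intros flow_tendsto inverse_Suc_tendsto_0) auto
    then show "(\<lambda>n. exp (\<omega> * (t - s)) * (sqrt (inner (U n s - y) (U n s - y) + \<epsilon>)
          + (?a + 1 / real (Suc n) * (norm v)\<^sup>2 / (4 * sqrt \<epsilon>)) * (t - s)))
      \<longlonglongrightarrow> exp (\<omega> * (t - s)) * (sqrt (inner (u s - y) (u s - y) + \<epsilon>) + ?a * (t - s))"
      by simp
    show "\<exists>N. \<forall>n\<ge>N. sqrt (inner (U n t - y) (U n t - y) + \<epsilon>)
      \<le> exp (\<omega> * (t - s)) * (sqrt (inner (U n s - y) (U n s - y) + \<epsilon>)
          + (?a + 1 / real (Suc n) * (norm v)\<^sup>2 / (4 * sqrt \<epsilon>)) * (t - s))"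
      using yosida_flow_dist[OF A \<omega> flow _ v st that] by simp
  qed
  have "sqrt (inner (u t - y) (u t - y)) \<le> exp (\<omega> * (t - s)) * (sqrt (inner (u s - y) (u s - y)) + ?a * (t - s))"
  proof (rule tendsto_le)
    have "((\<lambda>\<epsilon>. sqrt (inner (u t - y) (u t - y) + \<epsilon>)) \<longlongrightarrow> sqrt (inner (u t - y) (u t - y) + 0)) (at_right 0)"
      by (intro tendsto_intros)
    then show "((\<lambda>\<epsilon>. sqrt (inner (u t - y) (u t - y) + \<epsilon>)) \<longlongrightarrow> sqrt (inner (u t - y) (u t - y))) (at_right 0)"
      by simp
    have "((\<lambda>\<epsilon>. exp (\<omega> * (t - s)) * (sqrt (inner (u s - y) (u s - y) + \<epsilon>) + ?a * (t - s)))
      \<longlongrightarrow> exp (\<omega> * (t - s)) * (sqrt (inner (u s - y) (u s - y) + 0) + ?a * (t - s))) (at_right 0)"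
      by (intro tendsto_intros)
    then show "((\<lambda>\<epsilon>. exp (\<omega> * (t - s)) * (sqrt (inner (u s - y) (u s - y) + \<epsilon>) + ?a * (t - s)))
      \<longlongrightarrow> exp (\<omega> * (t - s)) * (sqrt (inner (u s - y) (u s - y)) + ?a * (t - s))) (at_right 0)"
      by simp
  qed (use le in \<open>auto intro!: eventually_at_rightI[of 0 1]\<close>)
  then show ?thesis by (simp only: norm_eq_sqrt_inner)
qed

lemma flow_bound:
  assumes "T \<ge> 0"
  obtains R N where "R > 0" "\<And>t. t \<in> {0..T} \<Longrightarrow> norm (u t) \<le> R" "\<And>n t. n \<ge> N \<Longrightarrow> t \<in> {0..T} \<Longrightarrow> norm (U n t) \<le> R"
proof -
  have "bounded (u ` {0..T})"
    by (intro compact_imp_bounded compact_continuous_image flow_continuous) simp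
  then obtain r where r: "r > 0" "\<And>t. t \<in> {0..T} \<Longrightarrow> norm (u t) \<le> r"
    unfolding bounded_pos by blast
  obtain N where N: "\<And>n t. n \<ge> N \<Longrightarrow> t \<in> {0..T} \<Longrightarrow> dist (U n t) (u t) < 1"
    using lim[of T] unfolding uniform_limit_sequentially_iff by (meson zero_less_one)
  have "norm (U n t) \<le> r + 1" if "n \<ge> N" "t \<in> {0..T}" for n t
    using N[OF that] r(2)[OF that(2)] norm_triangle_sub[of "U n t" "u t"] by (simp add: dist_norm)
  moreover have "norm (u t) \<le> r + 1" if "t \<in> {0..T}" for t using r(2)[OF that] by simp
  ultimately show thesis using that[of "r + 1" N] r(1) by simp
qed

lemma flow_integral_ineq:
  assumes v: "v \<in> A y" and st: "0 \<le> s" "s \<le> t"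
    and K: "\<And>r. r \<in> {s..t} \<Longrightarrow> inner (\<omega> *\<^sub>R u r - v) (u r - y) \<le> K"
  shows "inner (u t - y) (u t - y) / 2 - inner (u s - y) (u s - y) / 2 \<le> K * (t - s)"
proof (rule field_le_epsilon)
  fix e :: real assume "e > 0"
  define \<epsilon> where "\<epsilon> = e / (t - s + 1)"
  have \<epsilon>: "\<epsilon> > 0" "\<epsilon> * (t - s) \<le> e"
  proof -
    show "\<epsilon> > 0" using \<open>e > 0\<close> st by (simp add: \<epsilon>_def)
    then have "\<epsilon> * (t - s) \<le> \<epsilon> * (t - s + 1)" by simp
    also have "\<dots> = e" using st by (simp add: \<epsilon>_def)
    finally show "\<epsilon> * (t - s) \<le> e" .
  qed
  have "t \<ge> 0" using st by simp
  then obtain R N where R: "R > 0" "\<And>r. r \<in> {0..t} \<Longrightarrow> norm (u r) \<le> R"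
    "\<And>n r. n \<ge> N \<Longrightarrow> r \<in> {0..t} \<Longrightarrow> norm (U n r) \<le> R"
    by (rule flow_bound) (rule that)
  \<comment> \<open>A Lipschitz constant on the ball of radius R for z |-> inner (\<omega> z - v) (z
    - y), plus 1 to make it positive; uniform convergence thus transfers the bound K from u to
    \<open>U n\<close> with loss \<epsilon>.\<close>
  define Q where "Q = \<omega> * (R + norm y) + (\<omega> * R + norm v) + 1"
  have Q: "Q > 0" using R \<omega> by (simp add: Q_def add_nonneg_pos)
  obtain N' where N': "\<And>n r. n \<ge> N' \<Longrightarrow> r \<in> {0..t} \<Longrightarrow> dist (U n r) (u r) < \<epsilon> / Q"
    using lim[of t] \<epsilon>(1) Q unfolding uniform_limit_sequentially_iff by (meson divide_pos_pos)
  have step: "inner (U n t - y) (U n t - y) / 2 - inner (U n s - y) (U n s - y) / 2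
      \<le> (K + \<epsilon> + 1 / real (Suc n) * (norm v)\<^sup>2 / 4) * (t - s)" if n: "n \<ge> max N N'" for n
  proof (rule yosida_flow_integral_ineq[OF A \<omega> flow _ v st])
    fix r assume r: "r \<in> {s..t}"
    then have r': "r \<in> {0..t}" using st by simp
    let ?d = "U n r - u r"
    have d: "norm ?d \<le> \<epsilon> / Q" using N'[of n r] n r' by (simp add: dist_norm less_imp_le)
    have "inner (\<omega> *\<^sub>R U n r - v) (U n r - y)
        = inner (\<omega> *\<^sub>R u r - v) (u r - y) + (\<omega> * inner ?d (U n r - y) + inner (\<omega> *\<^sub>R u r - v) ?d)"
      by (simp add: algebra_simps inner_commute)
    also have "\<omega> * inner ?d (U n r - y) \<le> \<omega> * (norm ?d * (R + norm y))"
    proof -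
      have "inner ?d (U n r - y) \<le> norm ?d * norm (U n r - y)" by (rule norm_cauchy_schwarz)
      also have "\<dots> \<le> norm ?d * (R + norm y)"
        using R(3)[of n r] n r' norm_triangle_ineq4[of "U n r" y] by (intro mult_left_mono) auto
      finally show ?thesis using \<omega> by (rule mult_left_mono)
    qed
    also have "inner (\<omega> *\<^sub>R u r - v) ?d \<le> (\<omega> * R + norm v) * norm ?d"
    proof -
      have "inner (\<omega> *\<^sub>R u r - v) ?d \<le> norm (\<omega> *\<^sub>R u r - v) * norm ?d" by (rule norm_cauchy_schwarz)
      also have "\<dots> \<le> (\<omega> * R + norm v) * norm ?d"
        using mult_left_mono[OF R(2)[OF r'] \<omega>] norm_triangle_ineq4[of "\<omega> *\<^sub>R u r" v] \<omega>
        by (intro mult_right_mono) auto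
      finally show ?thesis .
    qed
    also have "\<omega> * (norm ?d * (R + norm y)) + (\<omega> * R + norm v) * norm ?d = (Q - 1) * norm ?d"
      by (simp add: Q_def algebra_simps)
    also have "\<dots> \<le> Q * norm ?d" by (intro mult_right_mono) auto
    also have "\<dots> \<le> Q * (\<epsilon> / Q)" using d Q by (intro mult_left_mono) auto
    also have "\<dots> = \<epsilon>" using Q by simp
    finally show "inner (\<omega> *\<^sub>R U n r - v) (U n r - y) \<le> K + \<epsilon>" using K[OF r] by simp
  qed simp
  have "inner (u t - y) (u t - y) / 2 - inner (u s - y) (u s - y) / 2 \<le> (K + \<epsilon>) * (t - s)"
  proof (rule LIMSEQ_le)
    show "(\<lambda>n. inner (U n t - y) (U n t - y) / 2 - inner (U n s - y) (U n s - y) / 2)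
      \<longlonglongrightarrow> inner (u t - y) (u t - y) / 2 - inner (u s - y) (u s - y) / 2"
      using st by (intro tendsto_intros flow_tendsto) auto
    have "(\<lambda>n. (K + \<epsilon> + 1 / real (Suc n) * (norm v)\<^sup>2 / 4) * (t - s)) \<longlonglongrightarrow> (K + \<epsilon> + 0 * (norm v)\<^sup>2 / 4) * (t - s)"
      by (intro tendsto_intros inverse_Suc_tendsto_0) auto
    then show "(\<lambda>n. (K + \<epsilon> + 1 / real (Suc n) * (norm v)\<^sup>2 / 4) * (t - s)) \<longlonglongrightarrow> (K + \<epsilon>) * (t - s)" by simp
  qed (use step in blast)
  also have "\<dots> \<le> K * (t - s) + e" using \<epsilon>(2) by (simp add: distrib_right)
  finally show "inner (u t - y) (u t - y) / 2 - inner (u s - y) (u s - y) / 2 \<le> K * (t - s) + e" .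
qed

text \<open>
  Smoothing effect.  If \<open>A\<close> is bounded by \<open>M\<close> on \<open>ball z r\<close>, testing monotonicity with
  \<open>z + \<rho> v / \<bar>v\<bar>\<close> bounds \<open>\<rho> \<bar>v\<bar>\<close> for \<open>v = yosida A \<kappa> (U n s)\<close> by \<open>- (\<bar>U n s - z\<bar>\<^sup>2 / 2)'\<close> up to a
  constant.  As the speed \<open>\<bar>(U n)'\<bar>\<close> is nonincreasing up to a factor \<open>exp (\<omega> T)\<close>, its value at
  \<open>t\<close> is controlled by \<open>1 / t\<close> times the integral over \<open>[0, t]\<close>.
\<close>

lemma flow_smoothing:
  assumes int: "interior (op_dom A) \<noteq> {}" and "T > 0"
  obtains C N where "C \<ge> 0"
    "\<And>n t. n \<ge> N \<Longrightarrow> t \<in> {0<..T} \<Longrightarrow> norm (\<omega> *\<^sub>R U n t - yosida A (1 / real (Suc n)) (U n t)) \<le> C / t"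
proof -
  obtain z r M where zr: "r > 0" "\<And>y. y \<in> ball z r \<Longrightarrow> \<exists>w\<in>A y. norm w \<le> M"
    by (rule interior_dom_locally_bounded[OF A int]) (rule that)
  obtain a where a: "a \<in> A z" "norm a \<le> M" using zr(2)[of z] zr(1) by auto
  have "M \<ge> 0" using a(2) norm_ge_zero order_trans by blast
  obtain R N where R: "R > 0" "\<And>n t. n \<ge> N \<Longrightarrow> t \<in> {0..T} \<Longrightarrow> norm (U n t) \<le> R"
    using \<open>T > 0\<close> by (rule flow_bound[OF less_imp_le]) (rule that)
  define R' where "R' = R + norm z"
  have R': "R' \<ge> 0" "\<And>n t. n \<ge> N \<Longrightarrow> t \<in> {0..T} \<Longrightarrow> norm (U n t - z) \<le> R'"
    using R norm_triangle_ineq4 unfolding R'_def by (auto intro: order_trans[OF norm_triangle_ineq4])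
  define \<rho> where "\<rho> = r / 2"
  have \<rho>: "\<rho> > 0" "\<rho> < r" using zr(1) by (auto simp: \<rho>_def)
  \<comment> \<open>The summands come, in this order, from the term \<omega> u of the equation, from
    \<open>key\<close>, and from the passage between Yosida value and speed in
    \<open>speed\<close>.\<close>
  define Q where "Q = R' * (\<omega> * R) + M * (R' + M + \<rho>) + \<rho> * (\<omega> * R)"
  have Q: "Q \<ge> 0" using R' R \<omega> \<open>M \<ge> 0\<close> \<rho> by (simp add: Q_def)
  define C where "C = exp (\<omega> * T) * (R' * R' / 2 + Q * T) / \<rho>"
  show thesis
  proof (rule that[of C N])
    show "C \<ge> 0" using Q R' \<rho> \<open>T > 0\<close> by (simp add: C_def)
    fix n t assume n: "n \<ge> N" and t: "t \<in> {0<..T}"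
    define \<kappa> where "\<kappa> = 1 / real (Suc n)"
    have \<kappa>: "0 < \<kappa>" "\<kappa> \<le> 1" by (auto simp: \<kappa>_def)
    let ?Y = "\<lambda>s. yosida A \<kappa> (U n s)"
    define V where "V = norm (\<omega> *\<^sub>R U n t - ?Y t)"
    have UR: "norm (U n s) \<le> R" "norm (U n s - z) \<le> R'" if "s \<in> {0..t}" for s
      using R(2)[OF n, of s] R'(2)[OF n, of s] that t by auto
    have speed: "exp (- (\<omega> * T)) * V \<le> norm (?Y s) + \<omega> * R" if s: "s \<in> {0..t}" for s
    proof -
      have "V \<le> exp (\<omega> * (t - s)) * norm (\<omega> *\<^sub>R U n s - ?Y s)"
        unfolding V_def using yosida_flow_speed[OF A \<omega> flow[of n, folded \<kappa>_def] \<kappa>(1), of s t] s by simp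
      also have "\<dots> \<le> exp (\<omega> * T) * norm (\<omega> *\<^sub>R U n s - ?Y s)"
        using s t \<omega> by (intro mult_right_mono) (auto intro!: mult_left_mono)
      finally have "exp (- (\<omega> * T)) * V \<le> exp (- (\<omega> * T)) * (exp (\<omega> * T) * norm (\<omega> *\<^sub>R U n s - ?Y s))"
        by (intro mult_left_mono) auto
      also have "\<dots> = norm (\<omega> *\<^sub>R U n s - ?Y s)"
        by (simp add: mult.assoc[symmetric] mult_exp_exp)
      also have "\<dots> \<le> norm (\<omega> *\<^sub>R U n s) + norm (?Y s)" by (rule norm_triangle_ineq4)
      also have "norm (\<omega> *\<^sub>R U n s) \<le> \<omega> * R" using UR[OF s] \<omega> by (simp add: mult_left_mono)
      finally show ?thesis by simp
    qed
    have key: "\<rho> * norm (?Y s) \<le> inner (?Y s) (U n s - z) + M * (R' + M + \<rho>)" if s: "s \<in> {0..t}" for s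
    proof (cases "?Y s = 0")
      case True
      then show ?thesis using \<open>M \<ge> 0\<close> R' \<rho> by simp
    next
      case False
      let ?v = "?Y s" and ?J = "U n s - \<kappa> *\<^sub>R ?Y s"
      define e where "e = ?v /\<^sub>R norm ?v"
      have e: "norm e = 1" "inner ?v e = norm ?v"
        using False by (auto simp: e_def power2_norm_eq_inner[symmetric] power2_eq_square)
      have "z + \<rho> *\<^sub>R e \<in> ball z r" using \<rho> e by (simp add: dist_norm)
      then obtain w where w: "w \<in> A (z + \<rho> *\<^sub>R e)" "norm w \<le> M" using zr(2) by blast
      have "0 \<le> inner (?J - (z + \<rho> *\<^sub>R e)) (?v - w)"
        by (rule graph_monotone[OF A yosida_mem[OF A \<kappa>(1)] w(1)])
      also have "\<dots> = inner ?v (U n s - z) - \<kappa> * inner ?v ?v - \<rho> * inner ?v e - inner w (?J - (z + \<rho> *\<^sub>R e))"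
        by (simp add: algebra_simps inner_commute)
      also have "\<dots> \<le> inner ?v (U n s - z) - \<rho> * norm ?v + norm w * norm (?J - (z + \<rho> *\<^sub>R e))"
        unfolding e(2) using mult_nonneg_nonneg[OF less_imp_le[OF \<kappa>(1)] inner_ge_zero[of ?v]]
          abs_le_D2[OF Cauchy_Schwarz_ineq2[of w "?J - (z + \<rho> *\<^sub>R e)"]] by linarith
      also have "norm w * norm (?J - (z + \<rho> *\<^sub>R e)) \<le> M * (R' + M + \<rho>)"
      proof (rule mult_mono[OF w(2)])
        \<comment> \<open>The resolvent points of \<open>U n s\<close> and z are at most R' apart,
          and that of z is within M of z because \<kappa> <= 1; so ?J - z is bounded whatever the
          Yosida value at \<open>U n s\<close>.\<close>
        have "norm (?J - (z - \<kappa> *\<^sub>R yosida A \<kappa> z)) \<le> R'"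
          using resolvent_nonexpansive[OF A \<kappa>(1), of "U n s" z] UR[OF s] by simp
        moreover have "norm (\<kappa> *\<^sub>R yosida A \<kappa> z) \<le> 1 * M"
          using norm_yosida_le[OF A \<kappa>(1) a(1)] a(2) \<kappa> \<open>M \<ge> 0\<close> unfolding norm_scaleR by (intro mult_mono) auto
        moreover have "norm (\<rho> *\<^sub>R e) = \<rho>" using e \<rho> by simp
        moreover have "?J - (z + \<rho> *\<^sub>R e) = (?J - (z - \<kappa> *\<^sub>R yosida A \<kappa> z)) - \<kappa> *\<^sub>R yosida A \<kappa> z - \<rho> *\<^sub>R e"
          by simp
        ultimately show "norm (?J - (z + \<rho> *\<^sub>R e)) \<le> R' + M + \<rho>"
          by (smt (verit, best) norm_triangle_ineq4)
      qed (use \<open>M \<ge> 0\<close> in auto)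
      finally show ?thesis by simp
    qed
    define p where "p s = inner (U n s - z) (U n s - z) / 2" for s
    \<comment> \<open>V does not depend on s: by \<open>speed\<close> the final speed bounds the
      Yosida value from below, up to \<omega> * R, at every earlier time.\<close>
    have "p t - p 0 \<le> (Q - \<rho> * (exp (- (\<omega> * T)) * V)) * (t - 0)"
    proof (rule has_real_derivative_half_line_mono)
      fix s assume s: "s \<in> {0..t}"
      have "((\<lambda>s. U n s - z) has_vector_derivative (\<omega> *\<^sub>R U n s - ?Y s) - 0) (at s within {0..})"
        using s by (intro has_vector_derivative_diff has_vector_derivative_const
          yosida_flowD[OF A \<omega> flow[of n, folded \<kappa>_def]]) auto
      from DERIV_cdivide[OF has_real_derivative_inner_self[OF this], of 2]
      show "(p has_real_derivative inner (U n s - z) (\<omega> *\<^sub>R U n s - ?Y s)) (at s within {0..})"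
        by (simp add: p_def[abs_def])
      have "inner (U n s - z) (\<omega> *\<^sub>R U n s - ?Y s) = \<omega> * inner (U n s - z) (U n s) - inner (?Y s) (U n s - z)"
        by (simp add: inner_diff_right inner_commute)
      moreover have "\<omega> * inner (U n s - z) (U n s) \<le> \<omega> * (R' * R)"
        using UR[OF s] R' \<omega>
        by (intro mult_left_mono order_trans[OF norm_cauchy_schwarz] mult_mono) auto
      moreover have "\<rho> * (exp (- (\<omega> * T)) * V) \<le> \<rho> * norm (?Y s) + \<rho> * (\<omega> * R)"
        using mult_left_mono[OF speed[OF s] less_imp_le[OF \<rho>(1)]] by (simp only: distrib_left)
      moreover have "\<omega> * (R' * R) = R' * (\<omega> * R)" by simp
      ultimately show "inner (U n s - z) (\<omega> *\<^sub>R U n s - ?Y s) \<le> Q - \<rho> * (exp (- (\<omega> * T)) * V)"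
        using key[OF s] unfolding Q_def by linarith
    qed (use t in auto)
    moreover have "0 \<le> p t" by (simp add: p_def)
    moreover have "p 0 \<le> R' * R' / 2"
      using UR(2)[of 0] t R' unfolding p_def power2_norm_eq_inner[symmetric] power2_eq_square
      by (simp add: mult_mono)
    ultimately have "\<rho> * (exp (- (\<omega> * T)) * V) * t \<le> R' * R' / 2 + Q * t" by (simp add: algebra_simps)
    also have "\<dots> \<le> R' * R' / 2 + Q * T" using t Q by (simp add: mult_left_mono)
    finally have "exp (\<omega> * T) * (exp (- (\<omega> * T)) * (\<rho> * V * t)) \<le> exp (\<omega> * T) * (R' * R' / 2 + Q * T)"
      by (intro mult_left_mono) (auto simp: mult_ac)
    also have "exp (\<omega> * T) * (exp (- (\<omega> * T)) * (\<rho> * V * t)) = \<rho> * V * t"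
      by (simp only: mult.assoc[symmetric] mult_exp_exp) simp
    finally have "V * t \<le> C" using \<rho> by (simp add: C_def pos_le_divide_eq mult_ac)
    then show "norm (\<omega> *\<^sub>R U n t - yosida A (1 / real (Suc n)) (U n t)) \<le> C / t"
      using t by (simp add: V_def \<kappa>_def pos_le_divide_eq)
  qed
qed

text \<open>On [a, b] the smoothing bound C / t is at most C / a for all large n, so the approximate
  solutions are equi-Lipschitz there and the constant passes to the limit.\<close>

lemma flow_lipschitz:
  assumes int: "interior (op_dom A) \<noteq> {}" and "0 < a" "a \<le> b"
  obtains L where "L-lipschitz_on {a..b} u"
proof -
  have "b > 0" using assms by simp
  obtain C N where C: "C \<ge> 0"
    "\<And>n t. n \<ge> N \<Longrightarrow> t \<in> {0<..b} \<Longrightarrow> norm (\<omega> *\<^sub>R U n t - yosida A (1 / real (Suc n)) (U n t)) \<le> C / t"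
    by (rule flow_smoothing[OF int \<open>b > 0\<close>]) (rule that)
  have le: "norm (U n t - U n s) \<le> C / a * t - C / a * s" if n: "n \<ge> N" and st: "a \<le> s" "s < t" "t \<le> b" for n s t
  proof (rule differentiable_bound_general[OF st(2)])
    show "continuous_on {s..t} (U n)"
      using st \<open>0 < a\<close> by (intro continuous_on_subset[OF yosida_flow_continuous[OF A \<omega> flow]]) auto
    fix r assume r: "s < r" "r < t"
    then have "at r within {0..} = at r" using st \<open>0 < a\<close> by (intro at_within_interior) simp
    then show "(U n has_vector_derivative (\<omega> *\<^sub>R U n r - yosida A (1 / real (Suc n)) (U n r))) (at r)"
      using yosida_flowD[OF A \<omega> flow, of r n] r st \<open>0 < a\<close> by simp
    show "((\<lambda>s. C / a * s) has_vector_derivative C / a) (at r)"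
      by (auto intro!: derivative_eq_intros)
    have "norm (\<omega> *\<^sub>R U n r - yosida A (1 / real (Suc n)) (U n r)) \<le> C / r"
      using r st \<open>0 < a\<close> by (intro C(2) n) auto
    also have "\<dots> \<le> C / a" using r st \<open>0 < a\<close> C(1) by (intro divide_left_mono) auto
    finally show "norm (\<omega> *\<^sub>R U n r - yosida A (1 / real (Suc n)) (U n r)) \<le> C / a" .
  qed (use \<open>0 < a\<close> in \<open>auto intro!: continuous_intros\<close>)
  have le': "norm (u t - u s) \<le> C / a * (t - s)" if st: "a \<le> s" "s < t" "t \<le> b" for s t
  proof (rule LIMSEQ_le_const2)
    show "(\<lambda>n. norm (U n t - U n s)) \<longlonglongrightarrow> norm (u t - u s)"
      using st \<open>0 < a\<close> by (intro tendsto_intros flow_tendsto) auto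
    show "\<exists>N. \<forall>n\<ge>N. norm (U n t - U n s) \<le> C / a * (t - s)"
      using le[OF _ st] by (intro exI[of _ N]) (simp add: right_diff_distrib)
  qed
  have "(C / a)-lipschitz_on {a..b} u"
  proof (rule lipschitz_onI)
    fix s t assume "s \<in> {a..b}" "t \<in> {a..b}"
    then show "dist (u s) (u t) \<le> C / a * dist s t"
      using le'[of s t] le'[of t s]
      by (cases s t rule: linorder_cases) (auto simp: dist_norm norm_minus_commute)
  qed (use C \<open>0 < a\<close> in simp)
  then show thesis by (rule that)
qed

text \<open>Smoothing bounds the Yosida values of \<open>U n t\<close> for large n, so the resolvent
  points converge to u t and \<open>graph_demiclosed\<close> applies.\<close>

lemma flow_in_dom:
  assumes int: "interior (op_dom A) \<noteq> {}" and "t > 0"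
  shows "u t \<in> op_dom A"
proof -
  obtain C N where C: "C \<ge> 0"
    "\<And>n s. n \<ge> N \<Longrightarrow> s \<in> {0<..t} \<Longrightarrow> norm (\<omega> *\<^sub>R U n s - yosida A (1 / real (Suc n)) (U n s)) \<le> C / s"
    by (rule flow_smoothing[OF int \<open>t > 0\<close>]) (rule that)
  have "t \<ge> 0" using \<open>t > 0\<close> by simp
  then obtain R N' where R: "\<And>n r. n \<ge> N' \<Longrightarrow> r \<in> {0..t} \<Longrightarrow> norm (U n r) \<le> R"
    by (rule flow_bound) (rule that)
  define k where "k n = n + max N N'" for n
  let ?Y = "\<lambda>n. yosida A (1 / real (Suc n)) (U n t)"
  have Y: "norm (?Y (k n)) \<le> C / t + \<omega> * R" for n
  proof -
    have "k n \<ge> N" "k n \<ge> N'" by (auto simp: k_def)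
    then have "norm (\<omega> *\<^sub>R U (k n) t - ?Y (k n)) \<le> C / t" "norm (U (k n) t) \<le> R"
      using \<open>t > 0\<close> by (auto intro!: C(2) R simp del: of_nat_Suc)
    moreover from this(2) have "norm (\<omega> *\<^sub>R U (k n) t) \<le> \<omega> * R" using \<omega> by (simp add: mult_left_mono)
    moreover have "norm (?Y (k n)) \<le> norm (\<omega> *\<^sub>R U (k n) t) + norm (\<omega> *\<^sub>R U (k n) t - ?Y (k n))"
      using norm_triangle_sub[of "?Y (k n)" "\<omega> *\<^sub>R U (k n) t"] by (simp only: norm_minus_commute)
    ultimately show ?thesis by linarith
  qed
  have kk: "filterlim k sequentially sequentially"
    unfolding k_def by (rule filterlim_add_const_nat_at_top)
  have "(\<lambda>n. (1 / real (Suc (k n))) *\<^sub>R ?Y (k n)) \<longlonglongrightarrow> 0"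
  proof (rule Lim_null_comparison)
    show "(\<lambda>n. 1 / real (Suc (k n)) * (C / t + \<omega> * R)) \<longlonglongrightarrow> 0"
      using tendsto_mult_left_zero[OF filterlim_compose[OF inverse_Suc_tendsto_0 kk]] .
    show "\<forall>\<^sub>F n in sequentially. norm ((1 / real (Suc (k n))) *\<^sub>R ?Y (k n)) \<le> 1 / real (Suc (k n)) * (C / t + \<omega> * R)"
      using Y by (intro always_eventually allI) (simp add: divide_right_mono)
  qed
  then have "(\<lambda>n. U (k n) t - (1 / real (Suc (k n))) *\<^sub>R ?Y (k n)) \<longlonglongrightarrow> u t - 0"
    by (intro tendsto_diff filterlim_compose[OF flow_tendsto[OF \<open>t \<ge> 0\<close>] kk])
  then have "(\<lambda>n. U (k n) t - (1 / real (Suc (k n))) *\<^sub>R ?Y (k n)) \<longlonglongrightarrow> u t" by simp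
  from graph_demiclosed[OF A this, of "\<lambda>n. ?Y (k n)", OF yosida_mem[OF A] Y]
  show ?thesis unfolding op_dom_def by auto
qed

text \<open>Dividing \<open>flow_integral_ineq\<close> by h verifies the second hypothesis of
  \<open>tendsto_minimal_selection\<close>. The norm bound stays a hypothesis on F: from the right
  it holds at every t > 0, from the left it will be obtained where the norm of the minimal selection
  is continuous.\<close>

lemma flow_quotient_tendsto:
  assumes int: "interior (op_dom A) \<noteq> {}" and t: "t > 0"
    and g: "g \<in> (\<lambda>a. a - \<omega> *\<^sub>R u t) ` A (u t)"
      "\<And>v. v \<in> (\<lambda>a. a - \<omega> *\<^sub>R u t) ` A (u t) \<Longrightarrow> norm g \<le> norm v"
    and F: "F \<le> at 0"
    and le: "\<And>e. e > 0 \<Longrightarrow> \<forall>\<^sub>F h in F. norm ((u t - u (t + h)) /\<^sub>R h) \<le> norm g + e"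
  shows "((\<lambda>h. (u t - u (t + h)) /\<^sub>R h) \<longlongrightarrow> g) F"
proof (rule tendsto_minimal_selection[OF maximal_monotone_op_diff_const[OF A] g])
  fix y v' and e :: real assume v': "v' \<in> (\<lambda>a. a - \<omega> *\<^sub>R u t) ` A y" and "e > 0"
  then obtain v where v: "v \<in> A y" "v' = v - \<omega> *\<^sub>R u t" by blast
  define \<psi> where "\<psi> r = inner (\<omega> *\<^sub>R u r - v) (u r - y)" for r
  define K where "K = \<psi> t + e / 2"
  have "isCont \<psi> t"
    unfolding \<psi>_def using flow_isCont[OF t] by (intro continuous_intros)
  then have "\<forall>\<^sub>F r in at t. \<psi> r < K"
    unfolding isCont_def K_def using \<open>e > 0\<close> by (intro order_tendstoD(2)) auto
  then obtain d1 where d1: "d1 > 0" "\<And>r. r \<noteq> t \<Longrightarrow> dist r t < d1 \<Longrightarrow> \<psi> r < K"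
    unfolding eventually_at by auto
  then have \<psi>: "\<psi> r \<le> K" if "dist r t < d1" for r
    using that \<open>e > 0\<close> by (cases "r = t") (auto simp: K_def less_imp_le)
  obtain L where L: "L-lipschitz_on {t / 2..t + 1} u"
    by (rule flow_lipschitz[OF int, of "t / 2" "t + 1"]) (use t in auto)
  \<comment> \<open>d1 controls \<psi>, t / 2 and 1 keep t + h in the interval of L, and e / (L^2 +
    1) makes the quadratic term at most e / 2.\<close>
  define d where "d = min (min d1 (t / 2)) (min 1 (e / (L\<^sup>2 + 1)))"
  have d: "d > 0" using d1 t \<open>e > 0\<close> by (simp add: d_def add_nonneg_pos)
  have main: "inner ((u t - u (t + h)) /\<^sub>R h - v') (u t - y) \<ge> - e" if h: "h \<noteq> 0" "\<bar>h\<bar> < d" for h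
  proof -
    define w where "w = (u t - u (t + h)) /\<^sub>R h"
    have w: "u t - u (t + h) = h *\<^sub>R w" using h by (simp add: w_def)
    then have ut: "u (t + h) - y = (u t - y) - h *\<^sub>R w" by (simp add: algebra_simps)
    define c where "c = inner w (u t - y)"
    define P where "P = inner (u t - y) (u t - y)"
    have "inner (z - h *\<^sub>R w) (z - h *\<^sub>R w) = inner z z - 2 * (h * inner w z) + h * (h * (norm w)\<^sup>2)" for z
      by (simp add: inner_diff_left inner_diff_right inner_commute power2_norm_eq_inner)
    then have sq: "inner (u (t + h) - y) (u (t + h) - y) = P - 2 * (h * c) + h * (h * (norm w)\<^sup>2)"
      unfolding ut P_def c_def by blast
    have "- K - e / 2 \<le> c"
    proof (cases "h > 0")
      case True
      have "inner (u (t + h) - y) (u (t + h) - y) / 2 - P / 2 \<le> K * (t + h - t)"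
        using True t h \<psi> unfolding \<psi>_def P_def
        by (intro flow_integral_ineq[OF v(1)]) (auto simp: dist_real_def d_def)
      then have "h * (- c) + h * (h * (norm w)\<^sup>2) / 2 \<le> h * K"
        unfolding sq by (simp add: algebra_simps)
      moreover have "0 \<le> h * (h * (norm w)\<^sup>2) / 2" using True by simp
      ultimately have "h * (- c) \<le> h * K" by linarith
      then have "- c \<le> K" using True by (simp only: mult_le_cancel_left_pos)
      then show ?thesis using \<open>e > 0\<close> by simp
    next
      \<comment> \<open>For h < 0 the square term changes side and cannot be dropped; the Lipschitz
        bound on u gives |w| <= L and makes it small.\<close>
      case False
      then have "h < 0" using h by simp
      have "P / 2 - inner (u (t + h) - y) (u (t + h) - y) / 2 \<le> K * (t - (t + h))"
        using \<open>h < 0\<close> t h \<psi> unfolding \<psi>_def P_def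
        by (intro flow_integral_ineq[OF v(1)]) (auto simp: dist_real_def d_def)
      then have "(- h) * (- c) \<le> (- h) * (K + (- h) * (norm w)\<^sup>2 / 2)"
        unfolding sq by (simp add: algebra_simps)
      then have 1: "- c \<le> K + (- h) * (norm w)\<^sup>2 / 2"
        using \<open>h < 0\<close> by (simp only: mult_le_cancel_left_pos neg_0_less_iff_less)
      have "dist (u t) (u (t + h)) \<le> L * dist t (t + h)"
        using h t by (intro lipschitz_onD[OF L]) (auto simp: d_def)
      then have "\<bar>h\<bar> * norm w \<le> \<bar>h\<bar> * L"
        unfolding dist_norm w by (simp add: mult.commute)
      then have "norm w \<le> L" using h by simp
      then have "(norm w)\<^sup>2 \<le> L\<^sup>2" by (intro power_mono) auto
      then have "(- h) * (norm w)\<^sup>2 \<le> (- h) * (L\<^sup>2 + 1)" using \<open>h < 0\<close> by (intro mult_left_mono) auto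
      also have "\<dots> \<le> e / (L\<^sup>2 + 1) * (L\<^sup>2 + 1)"
        using h \<open>h < 0\<close> by (intro mult_right_mono) (auto simp: d_def)
      also have "\<dots> = e"
        by (metis add_nonneg_pos less_irrefl nonzero_eq_divide_eq zero_le_power2 zero_less_one)
      finally show ?thesis using 1 by linarith
    qed
    moreover have "inner (w - v') (u t - y) = c + \<psi> t"
      unfolding v(2) \<psi>_def c_def by (simp add: inner_diff_left)
    ultimately show ?thesis unfolding w_def[symmetric] K_def by linarith
  qed
  have "\<forall>\<^sub>F h in at 0. inner ((u t - u (t + h)) /\<^sub>R h - v') (u t - y) \<ge> - e"
    unfolding eventually_at using main d by (intro exI[of _ d]) auto
  then show "\<forall>\<^sub>F h in F. inner ((u t - u (t + h)) /\<^sub>R h - v') (u t - y) \<ge> - e"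
    using F by (rule filter_leD[rotated])
qed (erule le | assumption)+

lemma flow_quotient_le:
  assumes "t > 0" "h > 0" and g: "g \<in> (\<lambda>a. a - \<omega> *\<^sub>R u t) ` A (u t)"
  shows "norm (u (t + h) - u t) / h \<le> exp (\<omega> * h) * norm g"
proof -
  obtain v where v: "v \<in> A (u t)" "g = v - \<omega> *\<^sub>R u t" using g by blast
  have "norm (u (t + h) - u t) \<le> exp (\<omega> * h) * (norm g * h)"
    using flow_dist[OF v(1), of t "t + h"] assms v(2) by simp
  then show ?thesis using \<open>h > 0\<close> by (simp add: pos_divide_le_eq mult.assoc)
qed

text \<open>From the right, \<open>flow_quotient_le\<close> bounds the quotient by the norm of g at
  the same time t, so the limit exists at every t > 0. This turns \<open>flow_increment\<close> into
  a statement about norms of minimal selections.\<close>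

lemma flow_right_derivative:
  assumes int: "interior (op_dom A) \<noteq> {}" and t: "t > 0"
    and g: "g \<in> (\<lambda>a. a - \<omega> *\<^sub>R u t) ` A (u t)"
      "\<And>v. v \<in> (\<lambda>a. a - \<omega> *\<^sub>R u t) ` A (u t) \<Longrightarrow> norm g \<le> norm v"
  shows "((\<lambda>h. norm (u (t + h) - u t) / h) \<longlongrightarrow> norm g) (at_right 0)"
proof -
  have "((\<lambda>h. (u t - u (t + h)) /\<^sub>R h) \<longlongrightarrow> g) (at_right 0)"
  proof (rule flow_quotient_tendsto[OF int t g])
    show "at_right 0 \<le> at (0 :: real)" by (simp add: at_le)
    fix e :: real assume "e > 0"
    have "((\<lambda>h. exp (\<omega> * h) * norm g) \<longlongrightarrow> exp (\<omega> * 0) * norm g) (at_right 0)"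
      by (intro tendsto_intros)
    then have "\<forall>\<^sub>F h in at_right 0. exp (\<omega> * h) * norm g < norm g + e"
      using \<open>e > 0\<close> by (intro order_tendstoD(2)) auto
    moreover have "\<forall>\<^sub>F h in at_right (0 :: real). h > 0"
      by (rule eventually_at_right_less)
    ultimately show "\<forall>\<^sub>F h in at_right 0. norm ((u t - u (t + h)) /\<^sub>R h) \<le> norm g + e"
    proof eventually_elim
      case (elim h)
      then show ?case
        using flow_quotient_le[OF t elim(2) g(1)] by (simp add: norm_minus_commute inverse_eq_divide)
    qed
  qed
  from tendsto_norm[OF this] show ?thesis
    by (rule Lim_transform_eventually)
       (auto intro!: eventually_at_rightI[of 0 1] simp: norm_minus_commute inverse_eq_divide)
qed

text \<open>
  The norm of the minimal selection \<open>g t\<close> of \<open>A (u t) - \<omega> u t\<close> decreases up to a factor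
  \<open>exp (\<omega> t)\<close>, hence is continuous off a countable set; at its continuity points the left and
  right difference quotients both converge to \<open>- g t\<close>.
\<close>

lemma flow_has_derivative:
  assumes int: "interior (op_dom A) \<noteq> {}"
  obtains N where "countable N"
    "\<And>t. t > 0 \<Longrightarrow> t \<notin> N \<Longrightarrow> \<exists>v. (u has_vector_derivative v) (at t) \<and> \<omega> *\<^sub>R u t - v \<in> A (u t)"
proof -
  have "\<exists>g. g \<in> (\<lambda>a. a - \<omega> *\<^sub>R u t) ` A (u t) \<and>
      (\<forall>v\<in>(\<lambda>a. a - \<omega> *\<^sub>R u t) ` A (u t). norm g \<le> norm v)" if "t > 0" for t
  proof -
    have "u t \<in> op_dom (\<lambda>x. (\<lambda>a. a - \<omega> *\<^sub>R u t) ` A x)"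
      using flow_in_dom[OF int that] by (auto simp: op_dom_def)
    then show ?thesis
      by (rule minimal_selection[OF maximal_monotone_op_diff_const[OF A]]) blast
  qed
  then obtain g where g: "\<And>t. t > 0 \<Longrightarrow> g t \<in> (\<lambda>a. a - \<omega> *\<^sub>R u t) ` A (u t)"
    "\<And>t v. t > 0 \<Longrightarrow> v \<in> (\<lambda>a. a - \<omega> *\<^sub>R u t) ` A (u t) \<Longrightarrow> norm (g t) \<le> norm v"
    by metis
  \<comment> \<open>The sign makes \<theta> nondecreasing, hence discontinuous at countably many
    points only; the exponential absorbs the growth factor of \<open>flow_increment\<close>.\<close>
  define \<theta> where "\<theta> t = - (exp (- (\<omega> * t)) * norm (g t))" for t
  have "mono_on {0<..} \<theta>"
  proof (rule mono_onI)
    fix s t :: real assume st: "s \<in> {0<..}" "t \<in> {0<..}" "s \<le> t"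
    have "norm (g t) \<le> exp (\<omega> * (t - s)) * norm (g s)"
    proof (rule tendsto_le)
      show "((\<lambda>h. norm (u (t + h) - u t) / h) \<longlongrightarrow> norm (g t)) (at_right 0)"
        using st by (intro flow_right_derivative[OF int] g) auto
      show "((\<lambda>h. exp (\<omega> * (t - s)) * (norm (u (s + h) - u s) / h)) \<longlongrightarrow> exp (\<omega> * (t - s)) * norm (g s)) (at_right 0)"
        using st by (intro tendsto_mult tendsto_const flow_right_derivative[OF int] g) auto
      show "\<forall>\<^sub>F h in at_right 0. norm (u (t + h) - u t) / h \<le> exp (\<omega> * (t - s)) * (norm (u (s + h) - u s) / h)"
        using st flow_increment[of s t]
        by (auto intro!: eventually_at_rightI[of 0 1] divide_right_mono)
    qed simp
    then have "exp (- (\<omega> * t)) * norm (g t) \<le> exp (- (\<omega> * t)) * (exp (\<omega> * (t - s)) * norm (g s))"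
      by (intro mult_left_mono) auto
    also have "\<dots> = exp (- (\<omega> * s)) * norm (g s)"
    proof -
      have "exp (- (\<omega> * t)) * exp (\<omega> * (t - s)) = exp (- (\<omega> * s))"
        by (simp add: mult_exp_exp right_diff_distrib)
      then show ?thesis by (simp only: mult.assoc[symmetric])
    qed
    finally show "\<theta> s \<le> \<theta> t" by (simp add: \<theta>_def)
  qed
  then have N: "countable {t \<in> {0<..}. \<not> isCont \<theta> t}"
    by (intro mono_on_ctble_discont_open) auto
  have "\<exists>v. (u has_vector_derivative v) (at t) \<and> \<omega> *\<^sub>R u t - v \<in> A (u t)"
    if t: "t > 0" and cont: "isCont \<theta> t" for t
  proof -
    have "((\<lambda>h. (u t - u (t + h)) /\<^sub>R h) \<longlongrightarrow> g t) (at 0)"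
    proof (rule flow_quotient_tendsto[OF int t g(1)[OF t] g(2)[OF t] order_refl])
      fix e :: real assume "e > 0"
      \<comment> \<open>For h < 0 the quotient is bounded from the earlier time t + h, by the
        selection there; m covers both signs and is continuous at 0 because \<theta> is continuous
        at t.\<close>
      define m where "m h = exp (\<omega> * \<bar>h\<bar>) * max (norm (g t)) (exp (\<omega> * (t + h)) * - \<theta> (t + h))" for h
      have "exp (\<omega> * s) * - \<theta> s = norm (g s)" for s
        by (simp add: \<theta>_def mult.assoc[symmetric] mult_exp_exp)
      then have m: "m h = exp (\<omega> * \<bar>h\<bar>) * max (norm (g t)) (norm (g (t + h)))" for h
        by (simp add: m_def)
      have "isCont (\<lambda>h. \<theta> (t + h)) 0"
        by (rule isCont_o2[where g = \<theta>]) (use cont in \<open>auto intro!: continuous_intros\<close>)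
      then have "isCont m 0" unfolding m_def by (intro continuous_intros)
      then have "(m \<longlongrightarrow> norm (g t)) (at 0)" unfolding isCont_def m by simp
      then have "\<forall>\<^sub>F h in at 0. m h < norm (g t) + e"
        using \<open>e > 0\<close> by (intro order_tendstoD(2)) auto
      moreover have "\<forall>\<^sub>F h in at 0. h \<noteq> 0 \<and> \<bar>h\<bar> < t"
        unfolding eventually_at using t by (intro exI[of _ t]) auto
      ultimately show "\<forall>\<^sub>F h in at 0. norm ((u t - u (t + h)) /\<^sub>R h) \<le> norm (g t) + e"
      proof eventually_elim
        case (elim h)
        have "norm ((u t - u (t + h)) /\<^sub>R h) \<le> m h"
        proof (cases "h > 0")
          case True
          have "norm (u (t + h) - u t) / h \<le> exp (\<omega> * h) * norm (g t)"
            by (rule flow_quotient_le[OF t True g(1)[OF t]])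
          also have "\<dots> \<le> m h" unfolding m using True by (intro mult_mono) auto
          finally show ?thesis using True by (simp add: norm_minus_commute inverse_eq_divide)
        next
          case False
          then have h: "h < 0" "t + h > 0" using elim by auto
          have "norm (u (t + h + - h) - u (t + h)) / - h \<le> exp (\<omega> * - h) * norm (g (t + h))"
            using h by (intro flow_quotient_le g(1)) auto
          also have "\<dots> \<le> m h" unfolding m using h by (intro mult_mono) auto
          finally show ?thesis using h by (simp add: inverse_eq_divide)
        qed
        then show ?case using elim by simp
      qed
    qed
    moreover have "filterlim (\<lambda>s. s - t) (at 0) (at t)"
      unfolding filterlim_at by (auto intro!: tendsto_eq_intros simp: eventually_at_filter)
    ultimately have "((\<lambda>s. (u t - u (t + (s - t))) /\<^sub>R (s - t)) \<longlongrightarrow> g t) (at t)"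
      by (rule filterlim_compose)
    then have "((\<lambda>s. - ((u t - u s) /\<^sub>R (s - t))) \<longlongrightarrow> - g t) (at t)"
      by (intro tendsto_minus) simp
    then have "(u has_vector_derivative - g t) (at t)"
      unfolding has_vector_derivative_iff_quotient scaleR_minus_right[symmetric] minus_diff_eq .
    moreover have "\<omega> *\<^sub>R u t - (- g t) \<in> A (u t)"
      using g(1)[OF t] by auto
    ultimately show ?thesis by blast
  qed
  then show thesis using that[OF N] by blast
qed

end

end

section \<open>Absolutely continuous functions\<close>

lemma abs_continuous_onE:
  assumes "abs_continuous_on S f" and "\<epsilon> > 0"
  obtains \<delta> where "\<delta> > 0" "\<And>(n::nat) a b.
        (\<forall>i<n. a i \<in> S \<and> b i \<in> S \<and> a i \<le> b i) \<Longrightarrow>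
        (\<forall>i<n. \<forall>j<n. i \<noteq> j \<longrightarrow> {a i<..<b i} \<inter> {a j<..<b j} = {}) \<Longrightarrow>
        (\<Sum>i<n. b i - a i) < \<delta> \<Longrightarrow> (\<Sum>i<n. dist (f (a i)) (f (b i))) < \<epsilon>"
proof -
  have "\<exists>\<delta>>0. \<forall>(n::nat) a b.
        (\<forall>i<n. a i \<in> S \<and> b i \<in> S \<and> a i \<le> b i) \<and>
        (\<forall>i<n. \<forall>j<n. i \<noteq> j \<longrightarrow> {a i<..<b i} \<inter> {a j<..<b j} = {}) \<and>
        (\<Sum>i<n. b i - a i) < \<delta>
        \<longrightarrow> (\<Sum>i<n. dist (f (a i)) (f (b i))) < \<epsilon>" (is "\<exists>\<delta>>0. ?P \<delta>")
    using assms(1)[unfolded abs_continuous_on_def, THEN spec, THEN mp, OF assms(2)] .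
  then obtain \<delta> where "\<delta> > 0" "?P \<delta>" by (elim exE conjE)
  show thesis
    by (rule that[OF \<open>\<delta> > 0\<close>], rule \<open>?P \<delta>\<close>[THEN spec, THEN spec, THEN spec, THEN mp]) (intro conjI)
qed

text \<open>
  Sum \<open>f (Sup k) - f (Inf k)\<close> over a fine tagged division: intervals tagged at good points
  contribute at most \<open>\<epsilon> (b - a)\<close>; those tagged at exceptional points lie in an open set of small
  measure and are controlled by absolute continuity.
\<close>

lemma abs_continuous_nonincreasing:
  fixes f :: "real \<Rightarrow> real"
  assumes "a \<le> b" and f: "abs_continuous_on {a..b} f"
    and deriv: "AE t in lborel. t \<in> {a<..<b} \<longrightarrow> (\<exists>d\<le>0. (f has_real_derivative d) (at t))"
  shows "f b \<le> f a"
proof -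
  have main: "f b - f a \<le> e * (b - a) + e" if "e > 0" for e
  proof -
    obtain \<delta> where \<delta>: "\<delta> > 0" "\<And>(n::nat) u v.
        (\<forall>i<n. u i \<in> {a..b} \<and> v i \<in> {a..b} \<and> u i \<le> v i) \<Longrightarrow>
        (\<forall>i<n. \<forall>j<n. i \<noteq> j \<longrightarrow> {u i<..<v i} \<inter> {u j<..<v j} = {}) \<Longrightarrow>
        (\<Sum>i<n. v i - u i) < \<delta> \<Longrightarrow> (\<Sum>i<n. dist (f (u i)) (f (v i))) < e"
      by (rule abs_continuous_onE[OF f \<open>e > 0\<close>]) (rule that)
    obtain N0 where N0: "N0 \<in> null_sets lborel"
      "{t. \<not> (t \<in> {a<..<b} \<longrightarrow> (\<exists>d\<le>0. (f has_real_derivative d) (at t)))} \<subseteq> N0"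
      using deriv unfolding eventually_ae_filter by auto
    \<comment> \<open>With the end points in N, every tag outside N is interior, where the
      derivative hypothesis speaks.\<close>
    define N where "N = N0 \<union> {a, b}"
    have N: "N \<in> null_sets lborel"
      unfolding N_def using null_sets.Un[OF N0(1) finite_imp_null_set_lborel[of "{a, b}"]] by simp
    obtain U where U: "open U" "N \<subseteq> U" "emeasure lborel (U - N) < ennreal \<delta>"
    proof (rule outer_regular_lborel[OF _ \<open>\<delta> > 0\<close>])
      show "N \<in> sets borel" using null_setsD2[OF N] by simp
    qed (rule that)
    have mU: "emeasure lborel U < ennreal \<delta>"
      using U N emeasure_Diff_null_set[OF N, of U] by (auto simp: borel_open)
    \<comment> \<open>One estimate for each side of t: a tagged interval has its tag between its end
      points, and the two estimates add up.\<close>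
    have "\<exists>r>0. \<forall>y. \<bar>y - t\<bar> < r \<longrightarrow> (y \<ge> t \<longrightarrow> f y - f t \<le> e * (y - t)) \<and> (y \<le> t \<longrightarrow> f t - f y \<le> e * (t - y))"
      if "t \<in> {a..b} - N" for t
    proof -
      have "t \<in> {a..b}" "t \<noteq> a" "t \<noteq> b" "t \<notin> N0" using that unfolding N_def by simp_all
      then have t: "t \<in> {a<..<b}" by simp
      then obtain d where d: "d \<le> 0" "(f has_real_derivative d) (at t)"
        using subsetD[OF N0(2), of t] \<open>t \<notin> N0\<close> by auto
      then have "\<exists>r>0. \<forall>y. norm (y - t) < r \<longrightarrow> norm (f y - f t - d * (y - t)) \<le> e * norm (y - t)"
        using \<open>e > 0\<close> unfolding has_field_derivative_def has_derivative_at_alt by blast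
      then obtain r where r: "r > 0" "\<And>y. norm (y - t) < r \<Longrightarrow> norm (f y - f t - d * (y - t)) \<le> e * norm (y - t)"
        by blast
      show ?thesis
      proof (intro exI[of _ r] conjI allI impI)
        fix y assume y: "\<bar>y - t\<bar> < r" "y \<ge> t"
        then have "f y - f t \<le> d * (y - t) + e * (y - t)" using r(2)[of y] by simp
        also have "d * (y - t) \<le> 0" using d y by (simp add: mult_nonpos_nonneg)
        finally show "f y - f t \<le> e * (y - t)" by simp
      next
        fix y assume y: "\<bar>y - t\<bar> < r" "y \<le> t"
        then have "f t - f y \<le> d * (t - y) + e * (t - y)" using r(2)[of y] by (simp add: algebra_simps)
        also have "d * (t - y) \<le> 0" using d y by (simp add: mult_nonpos_nonneg)
        finally show "f t - f y \<le> e * (t - y)" by simp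
      qed (use r in auto)
    qed
    then obtain r where r: "\<And>t. t \<in> {a..b} - N \<Longrightarrow> r t > 0"
      "\<And>t y. t \<in> {a..b} - N \<Longrightarrow> \<bar>y - t\<bar> < r t \<Longrightarrow> y \<ge> t \<Longrightarrow> f y - f t \<le> e * (y - t)"
      "\<And>t y. t \<in> {a..b} - N \<Longrightarrow> \<bar>y - t\<bar> < r t \<Longrightarrow> y \<le> t \<Longrightarrow> f t - f y \<le> e * (t - y)"
      by metis
    define \<gamma> where "\<gamma> t = (if t \<in> N then U else if t \<in> {a..b} then ball t (r t) else UNIV)" for t
    have "gauge \<gamma>"
      unfolding gauge_def \<gamma>_def using U r(1) by auto
    then obtain p where p: "p tagged_division_of {a..b}" "\<gamma> fine p"
      using fine_division_exists_real by blast
    have fin: "finite p" using p(1) by (rule tagged_division_of_finite)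
    have k: "k = {Inf k..Sup k} \<and> Inf k \<in> k \<and> Sup k \<in> k \<and> measure lborel k = Sup k - Inf k \<and> Inf k \<le> t \<and> t \<le> Sup k \<and> a \<le> Inf k \<and> Sup k \<le> b \<and> k \<subseteq> \<gamma> t"
      if tk: "(t, k) \<in> p" for t k
    proof -
      obtain u v where "k = cbox u v" using tagged_division_ofD(4)[OF p(1) tk] by blast
      moreover have "t \<in> k" "k \<subseteq> {a..b}"
        using tagged_division_ofD(2,3)[OF p(1) tk] by blast+
      moreover have "k \<subseteq> \<gamma> t" using p(2) tk unfolding fine_def by blast
      ultimately show ?thesis by (auto simp: cbox_interval)
    qed
    define q where "q = {(t, k) \<in> p. t \<in> N}"
    have "q \<subseteq> p" unfolding q_def by blast
    then have finq: "finite q" using fin finite_subset by blast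
    have good: "(\<Sum>(t, k)\<in>p - q. f (Sup k) - f (Inf k)) \<le> e * (b - a)"
    proof -
      have le: "f (Sup k) - f (Inf k) \<le> e * measure lborel k" if "(t, k) \<in> p - q" for t k
      proof -
        have kk: "Inf k \<in> k" "Sup k \<in> k" "measure lborel k = Sup k - Inf k" "Inf k \<le> t" "t \<le> Sup k" "a \<le> Inf k" "Sup k \<le> b" "k \<subseteq> \<gamma> t"
          using k that by blast+
        have t: "t \<in> {a..b} - N" using that kk unfolding q_def by auto
        have "Inf k \<in> ball t (r t)" "Sup k \<in> ball t (r t)"
          using subsetD[OF kk(8)] kk(1,2) t unfolding \<gamma>_def by auto
        then have "f (Sup k) - f t \<le> e * (Sup k - t)" "f t - f (Inf k) \<le> e * (t - Inf k)"
          using r(2,3)[OF t] kk by (auto simp: dist_real_def abs_minus_commute)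
        then show ?thesis unfolding kk(3) by (simp add: algebra_simps)
      qed
      have "(\<Sum>(t, k)\<in>p - q. f (Sup k) - f (Inf k)) \<le> (\<Sum>(t, k)\<in>p - q. e * measure lborel k)"
        using le by (intro sum_mono) auto
      also have "\<dots> \<le> (\<Sum>(t, k)\<in>p. e * measure lborel k)"
        using fin \<open>e > 0\<close> by (intro sum_mono2) auto
      also have "\<dots> = e * (\<Sum>(t, k)\<in>p. measure lborel k)"
        by (simp add: sum_distrib_left case_prod_unfold)
      also have "(\<Sum>(t, k)\<in>p. measure lborel k) = b - a"
        using additive_content_tagged_division[of p a b] p(1) \<open>a \<le> b\<close> by (simp add: cbox_interval)
      finally show ?thesis .
    qed
    have bad: "(\<Sum>(t, k)\<in>q. f (Sup k) - f (Inf k)) \<le> e"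
    proof -
      \<comment> \<open>\<open>abs_continuous_on\<close> speaks of families indexed by i < n, so the
        intervals tagged in N are enumerated.\<close>
      obtain h where h: "bij_betw h {..<card q} q"
        using ex_bij_betw_nat_finite[OF finq] by (auto simp: atLeast0LessThan)
      define u where "u i = Inf (snd (h i))" for i
      define v where "v i = Sup (snd (h i))" for i
      have hq: "h i \<in> q" if "i < card q" for i
        using bij_betwE[OF h] that by blast
      have uv: "snd (h i) = {u i..v i}" "u i \<le> v i" "a \<le> u i" "v i \<le> b" "snd (h i) \<subseteq> U" if "i < card q" for i
      proof -
        have "(fst (h i), snd (h i)) \<in> p" "fst (h i) \<in> N" using hq[OF that] unfolding q_def by auto
        with k[OF this(1)] show "snd (h i) = {u i..v i}" "u i \<le> v i" "a \<le> u i" "v i \<le> b" "snd (h i) \<subseteq> U"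
          unfolding u_def v_def \<gamma>_def by auto
      qed
      have disj: "{u i<..<v i} \<inter> {u j<..<v j} = {}" if "i < card q" "j < card q" "i \<noteq> j" for i j
      proof -
        have "h i \<noteq> h j" using h that unfolding bij_betw_def inj_on_def by blast
        moreover have "(fst (h i), snd (h i)) \<in> p" "(fst (h j), snd (h j)) \<in> p"
          using hq[OF that(1)] hq[OF that(2)] unfolding q_def by auto
        ultimately have "interior (snd (h i)) \<inter> interior (snd (h j)) = {}"
          using tagged_division_ofD(5)[OF p(1)] by (metis prod.collapse)
        then show ?thesis using uv(1)[OF that(1)] uv(1)[OF that(2)] by simp
      qed
      have "ennreal (\<Sum>i<card q. v i - u i) = (\<Sum>i<card q. emeasure lborel {u i<..<v i})"
        using uv(2) by (subst sum_ennreal[symmetric]) auto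
      also have "\<dots> = emeasure lborel (\<Union>i<card q. {u i<..<v i})"
        using disj by (intro sum_emeasure) (auto simp: disjoint_family_on_def)
      also have "\<dots> \<le> emeasure lborel U"
      proof (rule emeasure_mono)
        show "(\<Union>i<card q. {u i<..<v i}) \<subseteq> U"
          using uv(1,5) by fastforce
      qed (use U in auto)
      also have "\<dots> < ennreal \<delta>" by (rule mU)
      finally have "(\<Sum>i<card q. v i - u i) < \<delta>"
        using uv(2) by (subst (asm) ennreal_less_iff) (auto intro!: sum_nonneg)
      then have "(\<Sum>i<card q. dist (f (u i)) (f (v i))) < e"
      proof (intro \<delta>)
        show "\<forall>i<card q. u i \<in> {a..b} \<and> v i \<in> {a..b} \<and> u i \<le> v i"
          using uv(2,3,4) by (meson atLeastAtMost_iff order_trans)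
      qed (use disj in blast)+
      moreover have "(\<Sum>(t, k)\<in>q. f (Sup k) - f (Inf k)) = (\<Sum>i<card q. f (v i) - f (u i))"
        using sum.reindex_bij_betw[OF h, of "\<lambda>(t, k). f (Sup k) - f (Inf k)"]
        by (simp add: u_def v_def case_prod_unfold)
      moreover have "(\<Sum>i<card q. f (v i) - f (u i)) \<le> (\<Sum>i<card q. dist (f (u i)) (f (v i)))"
        by (intro sum_mono) (simp add: dist_real_def)
      ultimately show ?thesis by linarith
    qed
    have "f b - f a = (\<Sum>(t, k)\<in>p. f (Sup k) - f (Inf k))"
      using additive_tagged_division_1[OF \<open>a \<le> b\<close> p(1), of f] by simp
    also have "\<dots> = (\<Sum>(t, k)\<in>p - q. f (Sup k) - f (Inf k)) + (\<Sum>(t, k)\<in>q. f (Sup k) - f (Inf k))"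
      using sum.subset_diff[OF \<open>q \<subseteq> p\<close> fin] .
    finally show ?thesis using good bad by linarith
  qed
  show ?thesis
  proof (rule field_le_epsilon)
    fix e :: real assume "e > 0"
    have "f b - f a \<le> e / (b - a + 1) * (b - a) + e / (b - a + 1)"
      using \<open>e > 0\<close> \<open>a \<le> b\<close> by (intro main) simp
    also have "\<dots> = e / (b - a + 1) * (b - a + 1)" by (simp only: distrib_left mult_1_right)
    also have "\<dots> = e" using \<open>a \<le> b\<close> by simp
    finally show "f b \<le> f a + e" by simp
  qed
qed

text \<open>Takes the place of product and composition rules for absolute continuity: increments of
  f are charged to those of the time, of x and of y.\<close>

lemma abs_continuous_on_dominated:
  fixes f :: "real \<Rightarrow> 'c::metric_space" and x :: "real \<Rightarrow> 'a::metric_space" and y :: "real \<Rightarrow> 'b::metric_space"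
  assumes x: "abs_continuous_on S x" and y: "abs_continuous_on S y" and "C \<ge> 0"
    and le: "\<And>s t. s \<in> S \<Longrightarrow> t \<in> S \<Longrightarrow> dist (f s) (f t) \<le> C * (dist s t + dist (x s) (x t) + dist (y s) (y t))"
  shows "abs_continuous_on S f"
  unfolding abs_continuous_on_def
proof (intro allI impI)
  fix e :: real assume "e > 0"
  \<comment> \<open>Each of the three sums stays below e'; C + 1 instead of C keeps the denominator
    positive and the final inequality strict when C = 0.\<close>
  define e' where "e' = e / (3 * (C + 1))"
  have e': "e' > 0" using \<open>e > 0\<close> \<open>C \<ge> 0\<close> by (simp add: e'_def)
  obtain dx where dx: "dx > 0" "\<And>(n::nat) a b.
        (\<forall>i<n. a i \<in> S \<and> b i \<in> S \<and> a i \<le> b i) \<Longrightarrow>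
        (\<forall>i<n. \<forall>j<n. i \<noteq> j \<longrightarrow> {a i<..<b i} \<inter> {a j<..<b j} = {}) \<Longrightarrow>
        (\<Sum>i<n. b i - a i) < dx \<Longrightarrow> (\<Sum>i<n. dist (x (a i)) (x (b i))) < e'"
    by (rule abs_continuous_onE[OF x e']) (rule that)
  obtain dy where dy: "dy > 0" "\<And>(n::nat) a b.
        (\<forall>i<n. a i \<in> S \<and> b i \<in> S \<and> a i \<le> b i) \<Longrightarrow>
        (\<forall>i<n. \<forall>j<n. i \<noteq> j \<longrightarrow> {a i<..<b i} \<inter> {a j<..<b j} = {}) \<Longrightarrow>
        (\<Sum>i<n. b i - a i) < dy \<Longrightarrow> (\<Sum>i<n. dist (y (a i)) (y (b i))) < e'"
    by (rule abs_continuous_onE[OF y e']) (rule that)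
  have "(\<Sum>i<n. dist (f (a i)) (f (b i))) < e"
    if ab: "\<forall>i<n. a i \<in> S \<and> b i \<in> S \<and> a i \<le> b i"
      and disj: "\<forall>i<n. \<forall>j<n. i \<noteq> j \<longrightarrow> {a i<..<b i} \<inter> {a j<..<b j} = {}"
      and small: "(\<Sum>i<n. b i - a i) < min e' (min dx dy)" for n :: nat and a b
  proof -
    have "(\<Sum>i<n. dist (f (a i)) (f (b i)))
      \<le> (\<Sum>i<n. C * (dist (a i) (b i) + dist (x (a i)) (x (b i)) + dist (y (a i)) (y (b i))))"
      using ab by (intro sum_mono le) auto
    also have "\<dots> = C * ((\<Sum>i<n. dist (a i) (b i)) + (\<Sum>i<n. dist (x (a i)) (x (b i))) + (\<Sum>i<n. dist (y (a i)) (y (b i))))"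
      by (simp add: sum_distrib_left sum.distrib algebra_simps)
    also have "(\<Sum>i<n. dist (a i) (b i)) = (\<Sum>i<n. b i - a i)"
      using ab by (intro sum.cong) (auto simp: dist_real_def)
    also have "C * ((\<Sum>i<n. b i - a i) + (\<Sum>i<n. dist (x (a i)) (x (b i))) + (\<Sum>i<n. dist (y (a i)) (y (b i))))
      \<le> C * (e' + e' + e')"
      using small dx(2)[OF ab disj] dy(2)[OF ab disj] \<open>C \<ge> 0\<close> by (intro mult_left_mono add_mono) auto
    also have "\<dots> < 3 * (C + 1) * e'" using e' \<open>C \<ge> 0\<close> by (simp add: algebra_simps)
    also have "\<dots> = e" using \<open>C \<ge> 0\<close> by (simp add: e'_def)
    finally show ?thesis .
  qed
  then show "\<exists>\<delta>>0. \<forall>(n::nat) a b.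
        (\<forall>i<n. a i \<in> S \<and> b i \<in> S \<and> a i \<le> b i) \<and>
        (\<forall>i<n. \<forall>j<n. i \<noteq> j \<longrightarrow> {a i<..<b i} \<inter> {a j<..<b j} = {}) \<and>
        (\<Sum>i<n. b i - a i) < \<delta>
        \<longrightarrow> (\<Sum>i<n. dist (f (a i)) (f (b i))) < e"
    using e' dx(1) dy(1) by (intro exI[of _ "min e' (min dx dy)"]) auto
qed

lemma lipschitz_on_imp_abs_continuous_on:
  fixes f :: "real \<Rightarrow> 'a::metric_space"
  assumes "C-lipschitz_on S f"
  shows "abs_continuous_on S f"
proof -
  have const: "abs_continuous_on S (\<lambda>_. 0 :: real)"
    unfolding abs_continuous_on_def by (auto intro: exI[of _ 1])
  show ?thesis
    using lipschitz_onD[OF assms] lipschitz_on_nonneg[OF assms]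
    by (intro abs_continuous_on_dominated[OF const const, of C]) auto
qed

section \<open>Strong solutions\<close>

lemma abs_exp_minus_diff_le:
  fixes a b :: real
  assumes "a \<ge> 0" "b \<ge> 0"
  shows "\<bar>exp (- a) - exp (- b)\<bar> \<le> \<bar>a - b\<bar>"
proof -
  have le: "exp (- a) - exp (- b) \<le> b - a" "exp (- b) \<le> exp (- a)" if "0 \<le> a" "a \<le> b" for a b :: real
  proof -
    have "exp (- a) - exp (- b) = exp (- a) * (1 - exp (- (b - a)))"
      by (simp add: right_diff_distrib mult_exp_exp)
    also have "\<dots> \<le> 1 * (b - a)"
    proof (intro mult_mono)
      show "1 - exp (- (b - a)) \<le> b - a"
        using exp_ge_add_one_self[of "- (b - a)"] by linarith
    qed (use that in auto)
    finally show "exp (- a) - exp (- b) \<le> b - a" by simp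
  qed (use that in simp)
  show ?thesis
    using le[of a b] le[of b a] assms by (cases "a \<le> b") auto
qed

text \<open>Absolute continuity is available only on compact subsets of the open interval, so p
  decreases there first; continuity carries this to t0, where p vanishes, and to T.\<close>

lemma strong_solution_unique:
  fixes A :: "'h::real_inner \<Rightarrow> 'h set" and D :: "'h \<Rightarrow> 'h"
  assumes A: "monotone_op A" and D: "\<omega>-lipschitz_on UNIV D"
    and x: "strong_solution A (\<lambda>z. (\<lambda>a. a + D z) ` A z) t0 T x0 x"
    and y: "strong_solution A (\<lambda>z. (\<lambda>a. a + D z) ` A z) t0 T x0 y"
    and t: "t \<in> {t0..T}" and "t0 < T"
  shows "y t = x t"
proof -
  have \<omega>: "\<omega> \<ge> 0" using D by (rule lipschitz_on_nonneg)
  define c where "c = 2 * \<omega>"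
  define q where "q s = inner (x s - y s) (x s - y s)" for s
  define E where "E s = exp (- (c * (s - t0)))" for s
  define p where "p s = E s * q s" for s
  have cx: "continuous_on {t0..T} x" and cy: "continuous_on {t0..T} y"
    using x y by (auto simp: strong_solution_def)
  then have cp: "continuous_on {t0..T} p"
    unfolding p_def q_def E_def by (intro continuous_intros)
  have dec: "p b \<le> p a" if ab: "t0 < a" "a \<le> b" "b < T" for a b
  proof (rule abs_continuous_nonincreasing[OF ab(2)])
    have acx: "abs_continuous_on {a..b} x" and acy: "abs_continuous_on {a..b} y"
    proof -
      have "compact {a..b} \<and> {a..b} \<subseteq> {t0<..<T}" using ab by auto
      then show "abs_continuous_on {a..b} x" "abs_continuous_on {a..b} y"
        using x y unfolding strong_solution_def by blast+
    qed
    have "compact ((\<lambda>s. x s - y s) ` {a..b})"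
      using ab by (intro compact_continuous_image continuous_intros continuous_on_subset[OF cx] continuous_on_subset[OF cy]) auto
    then have "bounded ((\<lambda>s. x s - y s) ` {a..b})" by (rule compact_imp_bounded)
    then obtain M where M: "M > 0" "\<forall>z\<in>(\<lambda>s. x s - y s) ` {a..b}. norm z \<le> M"
      unfolding bounded_pos by (elim exE conjE)
    have M': "norm (x s - y s) \<le> M" if "s \<in> {a..b}" for s
      using M(2) that by simp
    show "abs_continuous_on {a..b} p"
    \<comment> \<open>The part c * M^2 comes from the increment of E times q <= M^2, and 2 * M from
      the increment of q times E <= 1.\<close>
    proof (rule abs_continuous_on_dominated[OF acx acy, of "c * M\<^sup>2 + 2 * M"])
      fix s r assume s: "s \<in> {a..b}" and r: "r \<in> {a..b}"
      let ?N = "\<lambda>s. norm (x s - y s)"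
      have q: "q s = (?N s)\<^sup>2" for s by (simp add: q_def power2_norm_eq_inner)
      have E1: "\<bar>E s - E r\<bar> \<le> c * dist s r"
      proof -
        have "\<bar>E s - E r\<bar> \<le> \<bar>c * (s - t0) - c * (r - t0)\<bar>"
          unfolding E_def using s r ab \<omega> by (intro abs_exp_minus_diff_le) (auto simp: c_def)
        also have "c * (s - t0) - c * (r - t0) = c * (s - r)" by (simp add: algebra_simps)
        finally show ?thesis using \<omega> by (simp add: abs_mult dist_real_def c_def)
      qed
      have E2: "0 \<le> E r" "E r \<le> 1" using r ab \<omega> by (auto simp: E_def c_def)
      have q1: "0 \<le> q s" "q s \<le> M\<^sup>2" using M'[OF s] unfolding q by (auto intro: power_mono)
      have q2: "\<bar>q s - q r\<bar> \<le> 2 * M * (dist (x s) (x r) + dist (y s) (y r))"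
      proof -
        have "q s - q r = (?N s + ?N r) * (?N s - ?N r)" unfolding q by (simp add: power2_eq_square algebra_simps)
        then have "\<bar>q s - q r\<bar> = (?N s + ?N r) * \<bar>?N s - ?N r\<bar>" by (simp add: abs_mult)
        also have "\<dots> \<le> (2 * M) * norm ((x s - y s) - (x r - y r))"
          using M(1) M'[OF s] M'[OF r] by (intro mult_mono norm_triangle_ineq3) auto
        also have "norm ((x s - y s) - (x r - y r)) = norm ((x s - x r) - (y s - y r))"
          by (simp add: algebra_simps)
        also have "(2 * M) * \<dots> \<le> (2 * M) * (dist (x s) (x r) + dist (y s) (y r))"
          unfolding dist_norm using M(1) by (intro mult_left_mono norm_triangle_ineq4) auto
        finally show ?thesis .
      qed
      have "p s - p r = (E s - E r) * q s + E r * (q s - q r)" by (simp add: p_def algebra_simps)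
      then have "dist (p s) (p r) \<le> \<bar>E s - E r\<bar> * q s + E r * \<bar>q s - q r\<bar>"
        using abs_triangle_ineq[of "(E s - E r) * q s" "E r * (q s - q r)"] E2 q1
        by (simp add: dist_real_def abs_mult)
      also have "\<dots> \<le> (c * dist s r) * M\<^sup>2 + 1 * (2 * M * (dist (x s) (x r) + dist (y s) (y r)))"
        using E1 E2 q1 q2 \<omega> by (intro add_mono mult_mono) (auto simp: c_def)
      also have "\<dots> \<le> (c * M\<^sup>2 + 2 * M) * (dist s r + dist (x s) (x r) + dist (y s) (y r))"
      proof -
        have "0 \<le> c * M\<^sup>2 * (dist (x s) (x r) + dist (y s) (y r))" "0 \<le> 2 * M * dist s r"
          using \<omega> M(1) by (auto simp: c_def)
        then show ?thesis by (simp add: algebra_simps)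
      qed
      finally show "dist (p s) (p r) \<le> (c * M\<^sup>2 + 2 * M) * (dist s r + dist (x s) (x r) + dist (y s) (y r))" .
    qed (use \<omega> M(1) in \<open>simp add: c_def\<close>)
    have "AE s in lborel. s \<in> {t0<..<T} \<longrightarrow>
        (\<exists>v. (x has_vector_derivative v) (at s) \<and> 0 \<in> (\<lambda>u. v + u) ` ((\<lambda>a. a + D (x s)) ` A (x s)))"
      and "AE s in lborel. s \<in> {t0<..<T} \<longrightarrow>
        (\<exists>v. (y has_vector_derivative v) (at s) \<and> 0 \<in> (\<lambda>u. v + u) ` ((\<lambda>a. a + D (y s)) ` A (y s)))"
      using x y by (auto simp: strong_solution_def)
    then show "AE s in lborel. s \<in> {a<..<b} \<longrightarrow> (\<exists>d\<le>0. (p has_real_derivative d) (at s))"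
    proof eventually_elim
      case (elim s)
      show ?case
      proof
        assume "s \<in> {a<..<b}"
        then have s: "s \<in> {t0<..<T}" using ab by auto
        obtain v where v: "(x has_vector_derivative v) (at s)" "0 \<in> (\<lambda>u. v + u) ` ((\<lambda>a. a + D (x s)) ` A (x s))"
          using elim(1) s by blast
        obtain w where w: "(y has_vector_derivative w) (at s)" "0 \<in> (\<lambda>u. w + u) ` ((\<lambda>a. a + D (y s)) ` A (y s))"
          using elim(2) s by blast
        from v(2) obtain a1 where a1: "a1 \<in> A (x s)" "v = - (a1 + D (x s))"
          unfolding eq_neg_iff_add_eq_0 by force
        from w(2) obtain a2 where a2: "a2 \<in> A (y s)" "w = - (a2 + D (y s))"
          unfolding eq_neg_iff_add_eq_0 by force
        have "\<bar>inner (x s - y s) (D (x s) - D (y s))\<bar> \<le> norm (x s - y s) * (\<omega> * norm (x s - y s))"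
          using lipschitz_onD[OF D, of "x s" "y s"]
          by (intro order_trans[OF Cauchy_Schwarz_ineq2] mult_left_mono) (auto simp: dist_norm)
        also have "\<dots> = \<omega> * q s" by (simp add: q_def power2_norm_eq_inner[symmetric] power2_eq_square)
        finally have Dm: "- inner (x s - y s) (D (x s) - D (y s)) \<le> \<omega> * q s" by linarith
        have Am: "0 \<le> inner (x s - y s) (a1 - a2)" by (rule monotone_opD[OF A a1(1) a2(1)])
        \<comment> \<open>The monotone part has the good sign, and D contributes at most \<omega> *
          q s, which the derivative of E compensates.\<close>
        have "inner (x s - y s) (v - w) = - inner (x s - y s) (a1 - a2) - inner (x s - y s) (D (x s) - D (y s))"
          unfolding a1(2) a2(2) by (simp add: inner_diff_right inner_add_right inner_minus_right)
        then have le: "2 * inner (x s - y s) (v - w) - c * q s \<le> 0"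
          using Dm Am by (simp add: c_def)
        have Ed: "(E has_real_derivative - c * E s) (at s)"
          unfolding E_def by (auto intro!: derivative_eq_intros)
        have qd: "(q has_real_derivative 2 * inner (x s - y s) (v - w)) (at s)"
          unfolding q_def by (intro has_real_derivative_inner_self has_vector_derivative_diff v w)
        have "(p has_real_derivative (- c * E s) * q s + (2 * inner (x s - y s) (v - w)) * E s) (at s)"
          unfolding p_def by (rule DERIV_mult[OF Ed qd])
        moreover have "(- c * E s) * q s + (2 * inner (x s - y s) (v - w)) * E s
            = E s * (2 * inner (x s - y s) (v - w) - c * q s)"
          by (simp only: right_diff_distrib mult_minus_left) (simp only: mult_ac add_uminus_conv_diff uminus_add_conv_diff)
        moreover have "\<dots> \<le> 0" using le by (intro mult_nonneg_nonpos) (auto simp: E_def)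
        ultimately show "\<exists>d\<le>0. (p has_real_derivative d) (at s)" by metis
      qed
    qed
  qed
  have "x t0 = y t0" using x y by (simp add: strong_solution_def)
  have "p b \<le> 0" if b: "b \<in> {t0<..<T}" for b
  proof -
    have "p t0 \<ge> p b"
      by (rule continuous_ge_on_closure[where S = "{t0<..<b}"])
         (use b dec in \<open>auto intro!: continuous_on_subset[OF cp]\<close>)
    then show ?thesis using \<open>x t0 = y t0\<close> by (simp add: p_def q_def)
  qed
  then have "p t \<le> 0"
    by (rule continuous_le_on_closure[where S = "{t0<..<T}", rotated 2]) (use t \<open>t0 < T\<close> cp in auto)
  then have "q t \<le> 0" by (simp add: p_def E_def mult_le_0_iff)
  then have "x t - y t = 0" unfolding q_def by (metis inner_eq_zero_iff inner_ge_zero order_antisym)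
  then show ?thesis by simp
qed

text \<open>Adding D + \<omega> I leaves the domain unchanged, so the hypotheses on interior and
  closure pass from A to G. The flow is autonomous and starts at time 0, hence the translation by
  t0.\<close>

lemma strong_solution_exists:
  fixes A :: "'h::{real_inner, complete_space} \<Rightarrow> 'h set"
  assumes A: "maximal_monotone_op A" and int: "interior (op_dom A) \<noteq> {}" and D: "\<omega>-lipschitz_on UNIV D"
    and x0: "x0 \<in> closure (op_dom A)"
  shows "\<exists>x. strong_solution A (\<lambda>z. (\<lambda>a. a + D z) ` A z) t0 T x0 x"
proof -
  define G where "G z = (\<lambda>a. a + D z + \<omega> *\<^sub>R z) ` A z" for z
  have dom: "op_dom G = op_dom A" by (auto simp: op_dom_def G_def)
  have G: "maximal_monotone_op G"
    using maximal_monotone_op_lipschitz_perturbation[OF A D] unfolding G_def[abs_def] .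
  have \<omega>: "\<omega> \<ge> 0" using D by (rule lipschitz_on_nonneg)
  have int': "interior (op_dom G) \<noteq> {}" using int dom by simp
  have "x0 \<in> closure (op_dom G)" using x0 dom by simp
  then obtain U u where flow: "\<And>n. yosida_flow G \<omega> (1 / real (Suc n)) (U n)" "\<And>n. U n 0 = x0"
    "\<And>T. uniform_limit {0..T} U u sequentially"
    by (rule yosida_flow_limit[OF G \<omega>]) (rule that)
  note limit = flow_continuous[OF G \<omega> flow] flow_init[OF G \<omega> flow]
    flow_lipschitz[OF G \<omega> flow int'] flow_in_dom[OF G \<omega> flow int'] flow_has_derivative[OF G \<omega> flow int']
  obtain N where N: "countable N"
    "\<And>t. t > 0 \<Longrightarrow> t \<notin> N \<Longrightarrow> \<exists>v. (u has_vector_derivative v) (at t) \<and> \<omega> *\<^sub>R u t - v \<in> G (u t)"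
    by (rule limit(5)) (rule that)
  define x where "x t = u (t - t0)" for t
  have "strong_solution A (\<lambda>z. (\<lambda>a. a + D z) ` A z) t0 T x0 x"
    unfolding strong_solution_def
  proof (intro conjI allI impI)
    show "continuous_on {t0..T} x"
      unfolding x_def by (intro continuous_on_compose2[OF limit(1)[of "T - t0"]] continuous_intros) auto
    show "x t0 = x0" using limit(2) by (simp add: x_def)
    show "AE t in lborel. t \<in> {t0<..T} \<longrightarrow> x t \<in> op_dom A"
      using limit(4) dom by (auto simp: x_def)
    fix K assume K: "compact K \<and> K \<subseteq> {t0<..<T}"
    show "abs_continuous_on K x"
    proof (cases "K = {}")
      case False
      then obtain a b where ab: "a \<in> K" "b \<in> K" "\<And>s. s \<in> K \<Longrightarrow> a \<le> s \<and> s \<le> b"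
        using K compact_attains_inf[of K] compact_attains_sup[of K] by metis
      obtain L where L: "L-lipschitz_on {a - t0..b - t0} u"
        by (rule limit(3)[of "a - t0" "b - t0"]) (use ab K in auto)
      have "L-lipschitz_on K x"
      proof (rule lipschitz_onI)
        fix s r assume "s \<in> K" "r \<in> K"
        then have "dist (u (s - t0)) (u (r - t0)) \<le> L * dist (s - t0) (r - t0)"
          using ab(3) by (intro lipschitz_onD[OF L]) auto
        then show "dist (x s) (x r) \<le> L * dist s r" by (simp add: x_def dist_real_def)
      qed (rule lipschitz_on_nonneg[OF L])
      then show ?thesis by (rule lipschitz_on_imp_abs_continuous_on)
    next
      case True
      then have "0-lipschitz_on K x" by (simp add: lipschitz_on_def)
      then show ?thesis by (rule lipschitz_on_imp_abs_continuous_on)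
    qed
  next
    have "(\<lambda>s. s + t0) ` N \<in> null_sets lborel"
      using N(1) by (intro countable_imp_null_set_lborel countable_image)
    from AE_not_in[OF this]
    show "AE t in lborel. t \<in> {t0<..<T} \<longrightarrow>
        (\<exists>v. (x has_vector_derivative v) (at t) \<and> 0 \<in> (\<lambda>u. v + u) ` ((\<lambda>a. a + D (x t)) ` A (x t)))"
    proof eventually_elim
      case (elim t)
      show ?case
      proof
        assume t: "t \<in> {t0<..<T}"
        have "t - t0 \<notin> N" using elim by (metis diff_add_cancel imageI)
        then obtain v where v: "(u has_vector_derivative v) (at (t - t0))" "\<omega> *\<^sub>R u (t - t0) - v \<in> G (u (t - t0))"
          using N(2)[of "t - t0"] t by auto
        have "((\<lambda>t. t - t0) has_vector_derivative 1) (at t)"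
          by (auto intro!: derivative_eq_intros)
        from vector_diff_chain_at[OF this v(1)]
        have "(x has_vector_derivative v) (at t)" by (simp add: o_def x_def[abs_def])
        moreover obtain a where a: "a \<in> A (x t)" "\<omega> *\<^sub>R x t - v = a + D (x t) + \<omega> *\<^sub>R x t"
          using v(2) unfolding G_def x_def by blast
        moreover from a(2) have "0 = v + (a + D (x t))" by (simp add: algebra_simps)
        ultimately show "\<exists>v. (x has_vector_derivative v) (at t) \<and> 0 \<in> (\<lambda>u. v + u) ` ((\<lambda>a. a + D (x t)) ` A (x t))"
          by blast
      qed
    qed
  qed
  then show ?thesis by blast
qed

section \<open>The system driven by the measures \<open>m x\<close>\<close>

lemma Bexp_diagonal_lipschitz:
  fixes m :: "'h::{real_inner, complete_space} \<Rightarrow> 'b::polish_space measure"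
  assumes "\<beta> > 0" "\<tau> > 0"
    and m: "\<And>x. prob_measure_finite_first_moment (m x)"
    and B: "\<And>x. \<beta>-lipschitz_on UNIV (\<lambda>\<xi>. B x \<xi>)"
    and W: "\<And>x y. W1 (m x) (m y) \<le> ereal (\<tau> * norm (x - y))"
    and L: "\<And>x. L-lipschitz_on UNIV (Bexp B (m x))"
  shows "(L + \<beta> * \<tau>)-lipschitz_on UNIV (\<lambda>x. Bexp B (m x) x)"
proof (rule lipschitz_onI)
  fix x y
  \<comment> \<open>The intermediate value first moves the point under the fixed measure
    \<open>m x\<close>, costing L, and then the measure at the fixed point y, costing \<beta> *
    \<tau>.\<close>
  have "dist (Bexp B (m x) x) (Bexp B (m y) y)
      \<le> dist (Bexp B (m x) x) (Bexp B (m x) y) + dist (Bexp B (m x) y) (Bexp B (m y) y)"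
    by (rule dist_triangle)
  also have "dist (Bexp B (m x) x) (Bexp B (m x) y) \<le> L * dist x y"
    by (rule lipschitz_onD[OF L]) auto
  also have "dist (Bexp B (m x) y) (Bexp B (m y) y) \<le> \<beta> * (\<tau> * norm (x - y))"
    unfolding Bexp_def dist_norm by (rule norm_expect_diff_le_W1[OF m m B \<open>\<beta> > 0\<close> W])
  finally show "dist (Bexp B (m x) x) (Bexp B (m y) y) \<le> (L + \<beta> * \<tau>) * dist x y"
    by (simp add: dist_norm algebra_simps)
qed (use assms lipschitz_on_nonneg[OF L] in auto)

theorem proposition1:
  fixes m :: "'h::{real_inner, complete_space} \<Rightarrow> 'b::polish_space measure"
    and A :: "'h \<Rightarrow> 'h set"
    and B :: "'h \<Rightarrow> 'b \<Rightarrow> 'h"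
    and \<beta> \<tau> L t0 T :: real
    and xbar x0 :: 'h
  assumes "\<beta> > 0" and "\<tau> > 0" and "L > 0"
    and "\<And>x. prob_measure_finite_first_moment (m x)"
    and "maximal_monotone_op A"
    and "interior (op_dom A) \<noteq> {}"
    and "\<And>x. (\<lambda>\<xi>. B x \<xi>) \<in> borel_measurable (m x)"
    and "\<And>x. \<beta>-lipschitz_on UNIV (\<lambda>\<xi>. B x \<xi>)"
    and "\<And>x y. W1 (m x) (m y) \<le> ereal (\<tau> * norm (x - y))"
    and "\<And>x. L-lipschitz_on UNIV (Bexp B (m x))"
    and "(\<exists>\<mu>>0. \<forall>x. strongly_monotone_op \<mu> (Fop A B (m x))) \<or>
         (\<exists>\<phi>. (\<forall>t>0. \<phi> t > \<beta> * \<tau> * t) \<and> (\<forall>x. uniformly_monotone_op \<phi> (Fop A B (m x))))"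
    and "equilibrium A B m xbar"
    and "0 < t0" and "t0 < T"
    and "x0 \<in> closure (op_dom (Fop A B (m xbar)))"
  shows "\<exists>x.
      is_unique_strong_solution A
        (\<lambda>z. (\<lambda>u. u + gap B m xbar z) ` Fop A B (m xbar) z) t0 T x0 x \<and>
      is_unique_strong_solution A (\<lambda>z. Fop A B (m z) z) t0 T x0 x"
proof -
  define D where "D z = Bexp B (m z) z" for z
  have D: "(L + \<beta> * \<tau>)-lipschitz_on UNIV D"
    unfolding D_def using assms(1,2,4,8,9,10) by (rule Bexp_diagonal_lipschitz)
  have F: "(\<lambda>z. Fop A B (m z) z) = (\<lambda>z. (\<lambda>a. a + D z) ` A z)"
    by (simp add: Fop_def D_def)
  \<comment> \<open>The gap removes the \<open>Bexp B (m xbar) z\<close> contained in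
    \<open>Fop A B (m xbar) z\<close> and puts \<open>Bexp B (m z) z\<close> in its place.\<close>
  have gap: "(\<lambda>z. (\<lambda>u. u + gap B m xbar z) ` Fop A B (m xbar) z) = (\<lambda>z. (\<lambda>a. a + D z) ` A z)"
    by (simp add: Fop_def D_def gap_def image_image)
  have "x0 \<in> closure (op_dom A)"
    using assms(15) by (simp add: op_dom_def Fop_def)
  with assms(5,6) D obtain x where x: "strong_solution A (\<lambda>z. (\<lambda>a. a + D z) ` A z) t0 T x0 x"
    using strong_solution_exists by blast
  have "monotone_op A" using assms(5) by (simp add: maximal_monotone_op_def)
  then have "is_unique_strong_solution A (\<lambda>z. (\<lambda>a. a + D z) ` A z) t0 T x0 x"
    unfolding is_unique_strong_solution_def
    using x strong_solution_unique[OF _ D x _ _ \<open>t0 < T\<close>] by blast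
  then show ?thesis unfolding F gap by blast
qed

end
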